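(* Let $T=[0,1]$ or $T=\mathbb R$, let $\mathcal P=\mathcal P(T)$ be a set of probability densities on $T$, and let $\Pi_n$ be priors (probability measures) defined on some $\sigma$-algebra of $\mathcal P$ for which the maps $p\mapsto p(x)$ are measurable for all $x\in T$. Let $1<r<\infty$, let $\varepsilon_n\to0$ be a sequence of positive numbers such that $\sqrt n\,\varepsilon_n\to\infty$ as $n\to\infty$, let $\bar r=\max(r,2)$, and set $$\delta_n=\varepsilon_n(n\varepsilon_n^2)^{\frac12-\frac1{\bar r}}\gamma_n$$ for some sequence $\gamma_n\ge1$. Assume either (a) that $1<r<2$ and that $\varepsilon_n=O\big(\gamma_n(n\varepsilon_n^2)^{1/r-1}\big)$, or (b) that $2\le r<\infty$ and that $\varepsilon_n^2=O(\gamma_n/\sqrt n)$. Let $J_n$ be any sequence of resolution levels satisfying $2^{J_n}\le c\,n\varepsilon_n^2$ for some fixed $0<c<\infty$, let $K_j$ be an admissible approximating sequence, and let $\mathcal P_n$ be a sequence of subsets of $$\big\{p\in\mathcal P:\ \|K_{J_n}(p)-p\|_r\le C(K)\delta_n,\ \|p\|_{\mu_w}\le D\big\},$$ where $C(K)$ is a constant that depends only on the operator kernel $K$, $D$ is a fixed constant, and where $w>(2-r)/r$ if $r<2$ and $w=0$ if $r\ge2$. Let $X_1,X_2,\dots$ be i.i.d. with law $P_0$ and density $p_0$ on $T$. Assume that there exists $C>0$ such that, for every $n$ large enough: (1) $\Pi_n(\mathcal P\setminus\mathcal P_n)\le e^{-(C+4)n\varepsilon_n^2}$, and (2) $\Pi_n\big\{p\in\mathcal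 P:\ -P_0\log\frac p{p_0}\le\varepsilon_n^2,\ P_0\big(\log\frac p{p_0}\big)^2\le\varepsilon_n^2\big\}\ge e^{-Cn\varepsilon_n^2}$, and that, in addition, (3) there exists $0<B<\infty$ such that $\Pi_n(p\in\mathcal P:\|p\|_\infty>B\,|\,X_1,\dots,X_n)\to0$ as $n\to\infty$ in $P_0^{\mathbb N}$-probability. Let $p_0\in L^\infty(T)$ be such that $\|K_{J_n}(p_0)-p_0\|_r=O(\delta_n)$ and such that $\|p_0\|_{\mu_w}<\infty$ for some $w>(2-r)/r$ if $T=\mathbb R$ and $1<r<2$. If $\delta_n\to0$ as $n\to\infty$, then there exists $M<\infty$ such that $$\Pi_n\{p\in\mathcal P:\|p-p_0\|_r\ge M\delta_n\,|\,X_1,\dots,X_n\}\to0\quad\text{as }n\to\infty$$ in $P_0^{\mathbb N}$-probability.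
   Context: Notation: $P_0f=\int f\,dP_0$; $\|\cdot\|_r$ is the $L^r(T)$-norm (Lebesgue measure), $\|f\|_\infty=\sup_{x\in T}|f(x)|$. For $w\ge0$, $\|f\|_{\mu_w}=\int|f(t)|(1+|t|)^w\,dt$ (integral over the domain of $f$). The posterior is $\Pi_n(B|X_1,\dots,X_n)=\int_B\prod_{i=1}^np(X_i)\,d\Pi_n(p)\big/\int_{\mathcal P}\prod_{i=1}^np(X_i)\,d\Pi_n(p)$ for measurable $B$. For a kernel $K_j(x,y)$ on $T\times T$, $K_j(p)(x)=\int_TK_j(x,y)p(y)\,dy$. A function has bounded $q$-variation if the supremum over all finite increasing sequences $x_0<\dots<x_m$ of $\sum_i|f(x_i)-f(x_{i-1})|^q$ is finite. Admissible approximating sequence: the operators $K_j(x,y)=2^jK(2^jx,2^jy)$, $x,y\in T$, $j\ge0$ integer, satisfying one of the following. (a) (convolution kernel case) $K(x,y)=K(x-y)$ where $K\in L^\infty(\mathbb R)$ is of bounded $q$-variation for some finite $q\ge1$, right (or left) continuous, and $\|K\|_{\mu_v}<\infty$ for some $v>2$. (b) (multiresolution projection case) $K(x,y)=\sum_k\phi(x-k)\phi(y-k)$, the sum extending over any subset of $\mathbb Z$, where $\phi\in L^1\cap L^\infty$ has bounded $q$-variation for some finite $q\ge1$, $\sup_{x\in\mathbb R}\sum_k|\phi(x-k)|<\infty$, and $|K(x,y)|\le\Phi(|x-y|)$ for all $x,y$ and some $\Phi\in L^\infty(\mathbb R)$ with $\|\Phi\|_{\mu_v}<\infty$ for some $v>2$.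 (c) (multiresolution case, $T=[0,1]$) $K(x,y)=\sum_k\phi_k(x)\phi_k(y)$ is the projection kernel of a Cohen–Daubechies–Vial (CDV) wavelet basis of $L^2([0,1])$, i.e. for $j\ge J_0$, $K_j(x,y)=\sum_k\phi_{jk}(x)\phi_{jk}(y)$, $\phi_{jk}=2^{j/2}\phi_k(2^j\cdot)$, is the kernel of the orthogonal projection onto the $2^j$-dimensional space $V_j$ of the CDV multiresolution analysis. Here, for a Daubechies scaling function $\phi$ of order $N$ and $2^{J_0}\ge2N$, the orthonormal basis $\{\phi_{jk}\}$ of $V_j$ consists of $N$ left edge functions $2^{j/2}\phi^0_k(2^jx)$, $N$ right edge functions $2^{j/2}\phi_k^1(2^jx)$ ($\phi^0_k,\phi_k^1$ bounded, boundedly supported modifications of $\phi$), and the $2^j-2N$ interior functions $2^{j/2}\phi(2^jx-k)$ (Cohen, Daubechies, Vial 1993, Theorem 4.4). In this case only levels $j\ge J_0$ are considered.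
   Formalization: The formal theorem also assumes that (p,x) ↦ p(x) is jointly measurable for each prior's σ-algebra and the Borel sets; measurability of p ↦ p(x) for each fixed x alone does not suffice, and the claim can fail without it. *)

theory Defs
  imports "HOL-Probability.Probability" "HOL-Library.Landau_Symbols"
begin

section \<open>Norms and densities\<close>

text \<open>
  A density on \<open>T\<close> is represented by its extension by zero to the whole real line.
  All norms take values in \<^typ>\<open>ennreal\<close>, so that they are infinite (and not zero by
  convention) on functions that do not belong to the respective space.
\<close>

definition density_on :: "real set \<Rightarrow> (real \<Rightarrow> real) \<Rightarrow> bool" where
  "density_on T p \<longleftrightarrow>
     p \<in> borel_measurable borel \<and> (\<forall>x. 0 \<le> p x) \<and> (\<forall>x. x \<notin> T \<longrightarrow> p x = 0) \<and>
     (\<integral>\<^sup>+x. ennreal (p x) \<partial>lborel) = 1"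

definition law :: "(real \<Rightarrow> real) \<Rightarrow> real measure" where
  "law p = density lborel (\<lambda>x. ennreal (p x))"

definition Lr_norm :: "real set \<Rightarrow> real \<Rightarrow> (real \<Rightarrow> real) \<Rightarrow> ennreal" where
  "Lr_norm T r f =
     (let I = (\<integral>\<^sup>+x\<in>T. ennreal (\<bar>f x\<bar> powr r) \<partial>lborel)
      in if I = \<infinity> then \<infinity> else ennreal (enn2real I powr (1 / r)))"

definition sup_norm :: "real set \<Rightarrow> (real \<Rightarrow> real) \<Rightarrow> ennreal" where
  "sup_norm T f = (SUP x\<in>T. ennreal \<bar>f x\<bar>)"

definition mu_norm :: "real set \<Rightarrow> real \<Rightarrow> (real \<Rightarrow> real) \<Rightarrow> ennreal" where
  "mu_norm T w f = (\<integral>\<^sup>+t\<in>T. ennreal (\<bar>f t\<bar> * (1 + \<bar>t\<bar>) powr w) \<partial>lborel)"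

definition Linf :: "real set \<Rightarrow> (real \<Rightarrow> real) \<Rightarrow> bool" where
  "Linf T f \<longleftrightarrow>
     f \<in> borel_measurable (restrict_space borel T) \<and>
     (\<exists>B. AE x in lborel. x \<in> T \<longrightarrow> \<bar>f x\<bar> \<le> B)"

definition bounded_q_variation :: "real \<Rightarrow> (real \<Rightarrow> real) \<Rightarrow> bool" where
  "bounded_q_variation q f \<longleftrightarrow>
     (\<exists>B. \<forall>(m::nat) x::nat \<Rightarrow> real. strict_mono_on {..m} x \<longrightarrow>
        (\<Sum>i=1..m. \<bar>f (x i) - f (x (i - 1))\<bar> powr q) \<le> B)"


section \<open>Admissible approximating sequences\<close>

definition kernel_op :: "real set \<Rightarrow> (real \<Rightarrow> real \<Rightarrow> real) \<Rightarrow> (real \<Rightarrow> real) \<Rightarrow> real \<Rightarrow> real" where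
  "kernel_op T K p x = (LINT y:T|lborel. K x y * p y)"

definition dilated_kernel :: "(real \<Rightarrow> real \<Rightarrow> real) \<Rightarrow> nat \<Rightarrow> real \<Rightarrow> real \<Rightarrow> real" where
  "dilated_kernel K j x y = 2 ^ j * K (2 ^ j * x) (2 ^ j * y)"

definition convolution_kernel :: "(real \<Rightarrow> real \<Rightarrow> real) \<Rightarrow> bool" where
  "convolution_kernel K \<longleftrightarrow>
     (\<exists>\<kappa>. (\<forall>x y. K x y = \<kappa> (x - y)) \<and>
        Linf UNIV \<kappa> \<and>
        (\<exists>q\<ge>1. bounded_q_variation q \<kappa>) \<and>
        ((\<forall>x. continuous (at_right x) \<kappa>) \<or> (\<forall>x. continuous (at_left x) \<kappa>)) \<and>
        (\<exists>v>2. mu_norm UNIV v \<kappa> < \<infinity>))"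

definition multiresolution_kernel :: "(real \<Rightarrow> real \<Rightarrow> real) \<Rightarrow> bool" where
  "multiresolution_kernel K \<longleftrightarrow>
     (\<exists>(S::int set) \<phi>.
        (\<forall>x y. K x y = (\<Sum>\<^sub>\<infinity>k\<in>S. \<phi> (x - of_int k) * \<phi> (y - of_int k))) \<and>
        integrable lborel \<phi> \<and> Linf UNIV \<phi> \<and>
        (\<exists>q\<ge>1. bounded_q_variation q \<phi>) \<and>
        (\<exists>B. \<forall>x. (\<lambda>k. \<bar>\<phi> (x - of_int k)\<bar>) summable_on S \<and>
                  (\<Sum>\<^sub>\<infinity>k\<in>S. \<bar>\<phi> (x - of_int k)\<bar>) \<le> B) \<and>
        (\<exists>\<Phi>. Linf UNIV \<Phi> \<and> (\<forall>x y. \<bar>K x y\<bar> \<le> \<Phi> \<bar>x - y\<bar>) \<and>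
              (\<exists>v>2. mu_norm UNIV v \<Phi> < \<infinity>)))"

text \<open>
  Daubechies scaling functions of order \<open>N\<close>, normalised to have support in \<open>[1 - N, N]\<close> as in
  Cohen, Daubechies and Vial (1993): \<open>h\<close> is an orthonormal filter of length \<open>2 N\<close> whose
  wavelet has \<open>N\<close> vanishing moments, and \<open>\<phi>\<close> is the associated refinable function. Several
  filters are possible for one \<open>N\<close> (extremal phase, least asymmetric, \<dots>).
\<close>

definition daubechies_filter :: "nat \<Rightarrow> (int \<Rightarrow> real) \<Rightarrow> bool" where
  "daubechies_filter N h \<longleftrightarrow>
     (\<forall>k. k \<notin> {1 - int N..int N} \<longrightarrow> h k = 0) \<and>
     (\<Sum>k=1 - int N..int N. h k) = sqrt 2 \<and>
     (\<forall>l. (\<Sum>k=1 - int N..int N. h k * h (k + 2 * l)) = (if l = 0 then 1 else 0)) \<and>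
     (\<forall>l<N. (\<Sum>k=1 - int N..int N. (if even k then 1 else - 1) * of_int k ^ l * h k) = 0)"

definition daubechies_scaling :: "nat \<Rightarrow> (real \<Rightarrow> real) \<Rightarrow> bool" where
  "daubechies_scaling N \<phi> \<longleftrightarrow>
     N \<ge> 1 \<and> \<phi> \<in> borel_measurable borel \<and> bounded (range \<phi>) \<and>
     (\<forall>x. x \<notin> {1 - real N..real N} \<longrightarrow> \<phi> x = 0) \<and>
     (\<integral>x. \<phi> x \<partial>lborel) = 1 \<and>
     (\<forall>k::int. (\<integral>x. \<phi> x * \<phi> (x - of_int k) \<partial>lborel) = (if k = 0 then 1 else 0)) \<and>
     (\<exists>h. daubechies_filter N h \<and>
        (AE x in lborel. \<phi> x = sqrt 2 * (\<Sum>k=1 - int N..int N. h k * \<phi> (2 * x - of_int k))))"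

text \<open>
  The edge functions of Cohen, Daubechies and Vial before orthonormalisation, for the half lines
  \<open>[0, \<infinity>)\<close> and \<open>(-\<infinity>, 0]\<close>; the second family is the mirror image of the first.
  Together with the interior translates they reproduce polynomials of degree less than \<open>N\<close>.
\<close>

definition cdv_left :: "nat \<Rightarrow> (real \<Rightarrow> real) \<Rightarrow> nat \<Rightarrow> real \<Rightarrow> real" where
  "cdv_left N \<phi> k x =
     (if x \<ge> 0 then \<Sum>n=k..2 * N - 2. real (n choose k) * \<phi> (x + real n - real N + 1) else 0)"

definition cdv_right :: "nat \<Rightarrow> (real \<Rightarrow> real) \<Rightarrow> nat \<Rightarrow> real \<Rightarrow> real" where
  "cdv_right N \<phi> k x =
     (if x \<le> 0 then \<Sum>n=k..2 * N - 2. real (n choose k) * \<phi> (x - real n + real N) else 0)"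

text \<open>
  \<open>e 0, \<dots>, e (N - 1)\<close> is an orthonormalisation of \<open>f 0, \<dots>, f (N - 1)\<close>. The projection
  kernel below does not depend on which one is used.
\<close>

definition orthonormalisation :: "nat \<Rightarrow> (nat \<Rightarrow> real \<Rightarrow> real) \<Rightarrow> (nat \<Rightarrow> real \<Rightarrow> real) \<Rightarrow> bool" where
  "orthonormalisation N f e \<longleftrightarrow>
     (\<exists>A::nat \<Rightarrow> nat \<Rightarrow> real. \<forall>k<N. \<forall>x. e k x = (\<Sum>l<N. A k l * f l x)) \<and>
     (\<forall>k<N. \<forall>l<N. (\<integral>x. e k x * e l x \<partial>lborel) = (if k = l then 1 else 0))"

text \<open>
  The right edge functions live on \<open>(-\<infinity>, 0]\<close> and are attached to the end point \<open>1\<close> of the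
  interval, hence the argument \<open>2 ^ j * (x - 1)\<close>.
\<close>

definition cdv_kernel ::
    "nat \<Rightarrow> (real \<Rightarrow> real) \<Rightarrow> (nat \<Rightarrow> real \<Rightarrow> real) \<Rightarrow> (nat \<Rightarrow> real \<Rightarrow> real) \<Rightarrow>
     nat \<Rightarrow> real \<Rightarrow> real \<Rightarrow> real" where
  "cdv_kernel N \<phi> \<phi>0 \<phi>1 j x y =
     (let \<psi> = (\<lambda>f z. 2 powr (real j / 2) * f (2 ^ j * z)) in
       (\<Sum>k<N. \<psi> (\<phi>0 k) x * \<psi> (\<phi>0 k) y) +
       (\<Sum>k=N..<2 ^ j - N. \<psi> (\<lambda>u. \<phi> (u - real k)) x * \<psi> (\<lambda>u. \<phi> (u - real k)) y) +
       (\<Sum>k<N. \<psi> (\<phi>1 k) (x - 1) * \<psi> (\<phi>1 k) (y - 1)))"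

text \<open>
  \<open>K j\<close> is the kernel at resolution level \<open>j\<close>, and \<open>J0\<close> is the smallest level considered.
\<close>

definition admissible :: "real set \<Rightarrow> nat \<Rightarrow> (nat \<Rightarrow> real \<Rightarrow> real \<Rightarrow> real) \<Rightarrow> bool" where
  "admissible T J0 K \<longleftrightarrow>
     (\<exists>\<kappa>. (convolution_kernel \<kappa> \<or> multiresolution_kernel \<kappa>) \<and> J0 = 0 \<and>
        (\<forall>j. \<forall>x\<in>T. \<forall>y\<in>T. K j x y = dilated_kernel \<kappa> j x y)) \<or>
     (T = {0..1} \<and>
      (\<exists>N \<phi> \<phi>0 \<phi>1. daubechies_scaling N \<phi> \<and> 2 * N \<le> 2 ^ J0 \<and>
         orthonormalisation N (cdv_left N \<phi>) \<phi>0 \<and>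
         orthonormalisation N (cdv_right N \<phi>) \<phi>1 \<and>
         (\<forall>j\<ge>J0. \<forall>x\<in>T. \<forall>y\<in>T. K j x y = cdv_kernel N \<phi> \<phi>0 \<phi>1 j x y)))"


section \<open>Priors and posteriors\<close>

text \<open>
  Measurability of \<open>p \<mapsto> p x\<close> for each fixed \<open>x\<close> does not imply joint measurability of
  \<open>(p, x) \<mapsto> p x\<close>, which is what makes posterior probabilities measurable functions of the
  observations and what Fubini's theorem needs. It is therefore not part of \<open>prior_on\<close> and has
  to be assumed separately.
\<close>

definition prior_on :: "real set \<Rightarrow> (real \<Rightarrow> real) set \<Rightarrow> (real \<Rightarrow> real) measure \<Rightarrow> bool" where
  "prior_on T P \<pi> \<longleftrightarrow>
     prob_space \<pi> \<and> space \<pi> = P \<and> (\<forall>x\<in>T. (\<lambda>p. p x) \<in> borel_measurable \<pi>)"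

text \<open>
  The observations \<open>X 1, X 2, \<dots>\<close> are the coordinates \<open>\<omega> 0, \<omega> 1, \<dots>\<close> of a point of the
  infinite product space.
\<close>

definition posterior ::
    "(real \<Rightarrow> real) measure \<Rightarrow> nat \<Rightarrow> (nat \<Rightarrow> real) \<Rightarrow> (real \<Rightarrow> real) set \<Rightarrow> real" where
  "posterior \<pi> n \<omega> B =
     (LINT p:B|\<pi>. (\<Prod>i<n. p (\<omega> i))) / (LINT p|\<pi>. (\<Prod>i<n. p (\<omega> i)))"

definition tendsto_in_prob :: "'a measure \<Rightarrow> (nat \<Rightarrow> 'a \<Rightarrow> real) \<Rightarrow> real \<Rightarrow> bool" where
  "tendsto_in_prob M Y c \<longleftrightarrow>
     (\<forall>\<eta>>0. (\<lambda>n. measure M {\<omega> \<in> space M. \<bar>Y n \<omega> - c\<bar> > \<eta>}) \<longlonglongrightarrow> 0)"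

text \<open>
  Posterior probabilities are only meaningful for measurable sets, so measurability of the sets
  \<open>B n\<close> is part of the assertion that their posterior probabilities tend to zero.
\<close>

definition posterior_vanishes ::
    "(nat \<Rightarrow> (real \<Rightarrow> real) measure) \<Rightarrow> (real \<Rightarrow> real) \<Rightarrow> (nat \<Rightarrow> (real \<Rightarrow> real) set) \<Rightarrow> bool" where
  "posterior_vanishes \<pi> p0 B \<longleftrightarrow>
     (\<forall>\<^sub>F n in sequentially. B n \<in> sets (\<pi> n)) \<and>
     tendsto_in_prob (PiM UNIV (\<lambda>_::nat. law p0)) (\<lambda>n \<omega>. posterior (\<pi> n) n \<omega> (B n)) 0"

text \<open>
  Since \<open>ln 0 = 0\<close> in HOL, the condition that \<open>p\<close> is positive almost everywhere with respect to
  the law of \<open>p0\<close> is stated explicitly; without it the logarithm is infinite with positive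
  probability. A square integrable function is integrable with respect to a probability measure,
  so both moments below are genuine integrals.
\<close>

definition kl_neighbourhood ::
    "(real \<Rightarrow> real) set \<Rightarrow> (real \<Rightarrow> real) \<Rightarrow> real \<Rightarrow> (real \<Rightarrow> real) set" where
  "kl_neighbourhood P p0 \<epsilon> =
     {p \<in> P. (AE x in law p0. 0 < p x) \<and>
        integrable (law p0) (\<lambda>x. (ln (p x / p0 x))\<^sup>2) \<and>
        - (\<integral>x. ln (p x / p0 x) \<partial>law p0) \<le> \<epsilon>\<^sup>2 \<and>
        (\<integral>x. (ln (p x / p0 x))\<^sup>2 \<partial>law p0) \<le> \<epsilon>\<^sup>2}"

end

theory Submission
  imports Defs
begin

text \<open>
  The posterior is controlled by a test that is not built from the kernel estimator: it is a weighted
  chi-square statistic on cells of length \<open>1 / d\<close>, with \<open>d\<close> proportional to \<open>n * \<epsilon>\<^sup>2\<close>. If \<open>h = p - p0\<close>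
  is close to \<open>K h\<close> in comparison with its own norm, it inherits the modulus of continuity of
  \<open>K h\<close> under translations, so averaging \<open>h\<close> over cells much shorter than \<open>2 ^ - J\<close> keeps a fixed
  fraction of its \<open>L\<^sup>r\<close>-norm.

  Against such a \<open>p\<close>, one linear functional of the cell counts already exceeds the threshold, and a
  Chernoff bound for this functional makes the error exponentially small; no entropy bound and no
  concentration inequality for suprema is needed. Under \<open>p0\<close> the error only has to vanish, which follows
  from the variance of the statistic on boundedly many multiples of \<open>d\<close> cells and Markov's inequality on
  the remaining cells. For \<open>r < 2\<close> on the real line the weights \<open>(1 + \<bar>k\<bar> / d) powr a\<close> reduce the
  \<open>\<ell>\<^sup>r\<close>-norm to a weighted \<open>\<ell>\<^sup>2\<close>-norm by Hoelder's inequality.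
\<close>

section \<open>Integral inequalities\<close>

text \<open>Put \<tau> = n \<epsilon>^2 and s = min r 2. Taking d of order \<tau> gives every
  requirement on the test the same order. Separation by M \<delta> in L^r forces cell differences of
  l^s-norm v of order M \<epsilon> \<gamma> \<tau> powr (1/s - 1); the extra factor in \<delta> for
  r > 2 pays for replacing l^r by l^2. Hence n v^2 is at least of order M^2 \<tau> powr (2/s - 1).
  The threshold, seen through the linear functional, has order \<tau> powr (2/s - 1), and so has the
  exponent (C + 4) \<tau> times the variance of the functional, because a density bounded by B has
  cell probabilities at most B / d; this is the use of the posterior bound on the sup-norm. The
  functional is bounded by 1, which caps the Chernoff exponent at order n v, and the demand that n v
  dominate \<tau> reads \<epsilon> = O(\<gamma> \<tau> powr (1/s - 1)), the common form of both rate
  conditions. One large M therefore meets all demands. A merely vanishing error under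
  \<open>p0\<close> suffices because the rejection event is discarded once for all
  densities.\<close>

lemma powr_ge_tangent:
  fixes u a r :: real
  assumes "1 < r" "0 \<le> u" "0 < a"
  shows "r * a powr (r - 1) * u \<le> u powr r + (r - 1) * a powr r"
proof -
  have s: "1 / r + (r - 1) / r = 1" using assms by (simp add: field_simps)
  have "u * a powr (r - 1) \<le> u powr r / r + (a powr (r - 1)) powr (r / (r - 1)) / (r / (r - 1))"
    using assms by (intro Youngs_inequality) (auto simp: field_simps)
  also have "(a powr (r - 1)) powr (r / (r - 1)) = a powr r"
    using assms by (simp add: powr_powr)
  finally show ?thesis using assms by (simp add: field_simps)
qed

text \<open>Convexity at the midpoint: the tangent inequalities at \<open>a = (x + y) / 2\<close>
  are added for \<open>x\<close> and \<open>y\<close>.\<close>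

lemma powr_add_le:
  fixes x y r :: real
  assumes "1 < r" "0 \<le> x" "0 \<le> y"
  shows "(x + y) powr r \<le> 2 powr (r - 1) * (x powr r + y powr r)"
proof (cases "x + y = 0")
  case False
  define a where "a = (x + y) / 2"
  have a: "a > 0" using False assms by (simp add: a_def)
  have "r * a powr (r - 1) * x \<le> x powr r + (r - 1) * a powr r"
    "r * a powr (r - 1) * y \<le> y powr r + (r - 1) * a powr r"
    using assms a by (auto intro!: powr_ge_tangent)
  then have "r * a powr (r - 1) * (x + y) \<le> x powr r + y powr r + 2 * (r - 1) * a powr r"
    by (simp add: algebra_simps)
  moreover have xy: "x + y = 2 * a" by (simp add: a_def)
  ultimately have "r * a powr (r - 1) * (2 * a) \<le> x powr r + y powr r + 2 * (r - 1) * a powr r"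
    by simp
  moreover have "r * a powr (r - 1) * (2 * a) = 2 * r * a powr r" using a by (simp add: powr_diff)
  moreover have "2 * (r - 1) * a powr r = 2 * r * a powr r - 2 * a powr r" by (simp add: algebra_simps)
  ultimately have "2 * a powr r \<le> x powr r + y powr r" by linarith
  moreover have "(x + y) powr r = 2 powr r * a powr r"
    using a by (simp add: xy powr_mult)
  moreover have "(2::real) powr r = 2 powr (r - 1) * 2" by (simp add: powr_diff)
  ultimately show ?thesis by (simp add: mult.assoc mult_left_mono)
qed (use assms in auto)

lemma powr_add3_le:
  fixes x y z r :: real
  assumes "1 < r" "0 \<le> x" "0 \<le> y" "0 \<le> z"
  shows "(x + y + z) powr r \<le> 4 powr (r - 1) * (x powr r + y powr r + z powr r)"
proof -
  let ?c = "(2::real) powr (r - 1)"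
  have c: "1 \<le> ?c" using assms by (simp add: ge_one_powr_ge_zero)
  have "(x + y + z) powr r \<le> ?c * ((x + y) powr r + z powr r)"
    using assms by (intro powr_add_le) auto
  also have "\<dots> \<le> ?c * (?c * (x powr r + y powr r) + ?c * z powr r)"
    using assms c mult_right_mono[OF c, of "z powr r"]
    by (intro mult_left_mono add_mono powr_add_le) auto
  also have "\<dots> = 4 powr (r - 1) * (x powr r + y powr r + z powr r)"
    using powr_mult[of 2 2 "r - 1"] by (simp add: algebra_simps)
  finally show ?thesis .
qed

text \<open>Jensen's inequality for a weight of mass at most \<open>C\<close>, obtained by
  integrating the tangent inequality at the mean \<open>a\<close>. The right-hand side may be
  infinite, so it is a nonnegative integral; if \<open>m * u\<close> is not integrable, the Bochner
  integral on the left is 0.\<close>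

lemma integral_powr_le:
  fixes m u :: "'a \<Rightarrow> real"
  assumes [measurable]: "m \<in> borel_measurable M" "u \<in> borel_measurable M"
    and nn: "\<And>x. 0 \<le> m x" "\<And>x. 0 \<le> u x" and r: "1 < r" and C: "0 < C"
    and m: "(\<integral>\<^sup>+x. ennreal (m x) \<partial>M) \<le> ennreal C"
  shows "ennreal ((\<integral>x. m x * u x \<partial>M) powr r) \<le>
    ennreal (C powr (r - 1)) * (\<integral>\<^sup>+x. ennreal (m x * u x powr r) \<partial>M)"
proof (cases "(\<integral>x. m x * u x \<partial>M) = 0")
  case False
  then have int: "integrable M (\<lambda>x. m x * u x)"
    using not_integrable_integral_eq by blast
  define a where "a = (\<integral>x. m x * u x \<partial>M) / C"
  have a: "a > 0"
    using False C integral_nonneg_AE[where M = M and f = "\<lambda>x. m x * u x"] nn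
    by (simp add: a_def zero_less_divide_iff less_le)
  have aa: "a powr (r - 1) * a = a powr r" using a by (simp add: powr_diff)
  have "ennreal (r * C * a powr r) = ennreal (r * a powr (r - 1)) * (\<integral>\<^sup>+x. ennreal (m x * u x) \<partial>M)"
  proof -
    have "(\<integral>\<^sup>+x. ennreal (m x * u x) \<partial>M) = ennreal (C * a)"
      using int nn C by (subst nn_integral_eq_integral) (auto simp: a_def)
    then show ?thesis using r a C by (simp add: aa[symmetric] ac_simps flip: ennreal_mult)
  qed
  also have "\<dots> = (\<integral>\<^sup>+x. ennreal (m x * (r * a powr (r - 1) * u x)) \<partial>M)"
    using nn r by (subst nn_integral_cmult[symmetric]) (auto simp: ac_simps simp flip: ennreal_mult)
  also have "\<dots> \<le> (\<integral>\<^sup>+x. ennreal (m x * (u x powr r + (r - 1) * a powr r)) \<partial>M)"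
    using nn r a by (intro nn_integral_mono ennreal_leI mult_left_mono powr_ge_tangent) auto
  also have "\<dots> = (\<integral>\<^sup>+x. ennreal (m x * u x powr r) + ennreal ((r - 1) * a powr r) * ennreal (m x) \<partial>M)"
    using nn r by (intro nn_integral_cong, subst ennreal_mult[symmetric], simp, simp,
        subst ennreal_plus[symmetric]) (auto simp: distrib_left mult_ac)
  also have "\<dots> = (\<integral>\<^sup>+x. ennreal (m x * u x powr r) \<partial>M) + ennreal ((r - 1) * a powr r) * (\<integral>\<^sup>+x. ennreal (m x) \<partial>M)"
    by (simp add: nn_integral_add nn_integral_cmult)
  also have "\<dots> \<le> (\<integral>\<^sup>+x. ennreal (m x * u x powr r) \<partial>M) + ennreal ((r - 1) * a powr r) * ennreal C"
    by (intro add_left_mono mult_left_mono m) auto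
  finally have 1: "ennreal (r * C * a powr r) \<le> (\<integral>\<^sup>+x. ennreal (m x * u x powr r) \<partial>M) + ennreal ((r - 1) * a powr r * C)"
    using r C by (simp add: ennreal_mult)
  have 2: "ennreal (C * a powr r) \<le> (\<integral>\<^sup>+x. ennreal (m x * u x powr r) \<partial>M)"
  proof -
    have "r * C * a powr r = C * a powr r + (r - 1) * a powr r * C" by (simp add: algebra_simps)
    then have "ennreal (C * a powr r) + ennreal ((r - 1) * a powr r * C) \<le>
      (\<integral>\<^sup>+x. ennreal (m x * u x powr r) \<partial>M) + ennreal ((r - 1) * a powr r * C)"
      using 1 r C by (simp flip: ennreal_plus)
    then show ?thesis by (simp add: ennreal_add_left_cancel_le add.commute)
  qed
  have "(\<integral>x. m x * u x \<partial>M) powr r = (C * a) powr r" using C by (simp add: a_def)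
  also have "\<dots> = C powr (r - 1) * (C * a powr r)"
    using C a by (simp add: powr_mult powr_diff)
  finally show ?thesis using 2 C by (simp add: ennreal_mult mult_left_mono)
qed simp

text \<open>Schur's test: Jensen in \<open>y\<close> uses the row bound, Fubini then exposes the
  column bound. The column bound enters with power one, so small columns make the operator small
  although the rows are only bounded.\<close>

lemma nn_integral_kernel_powr_le:
  fixes k :: "real \<Rightarrow> real \<Rightarrow> real" and h :: "real \<Rightarrow> real"
  assumes k [measurable]: "(\<lambda>(x, y). k x y) \<in> borel_measurable (borel \<Otimes>\<^sub>M borel)"
    and h [measurable]: "h \<in> borel_measurable borel"
    and r: "1 < r" and C: "0 < C"
    and row: "\<And>x. (\<integral>\<^sup>+y. ennreal \<bar>k x y\<bar> \<partial>lborel) \<le> ennreal C"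
    and col: "\<And>y. (\<integral>\<^sup>+x. ennreal \<bar>k x y\<bar> \<partial>lborel) \<le> ennreal e"
  shows "(\<integral>\<^sup>+x. ennreal (\<bar>\<integral>y. k x y * h y \<partial>lborel\<bar> powr r) \<partial>lborel) \<le>
    ennreal (C powr (r - 1)) * ennreal e * (\<integral>\<^sup>+y. ennreal (\<bar>h y\<bar> powr r) \<partial>lborel)"
proof -
  have kx [measurable]: "k x \<in> borel_measurable borel" for x
    using measurable_compose[OF measurable_Pair1' k, of x] by simp
  have "ennreal (\<bar>\<integral>y. k x y * h y \<partial>lborel\<bar> powr r) \<le>
      ennreal (C powr (r - 1)) * (\<integral>\<^sup>+y. ennreal (\<bar>k x y\<bar> * \<bar>h y\<bar> powr r) \<partial>lborel)" for x
  proof -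
    have "\<bar>\<integral>y. k x y * h y \<partial>lborel\<bar> \<le> (\<integral>y. \<bar>k x y\<bar> * \<bar>h y\<bar> \<partial>lborel)"
      using integral_abs_bound[of lborel "\<lambda>y. k x y * h y"] by (simp add: abs_mult)
    then have "ennreal (\<bar>\<integral>y. k x y * h y \<partial>lborel\<bar> powr r) \<le> ennreal ((\<integral>y. \<bar>k x y\<bar> * \<bar>h y\<bar> \<partial>lborel) powr r)"
      using r by (intro ennreal_leI powr_mono2) auto
    also have "\<dots> \<le> ennreal (C powr (r - 1)) * (\<integral>\<^sup>+y. ennreal (\<bar>k x y\<bar> * \<bar>h y\<bar> powr r) \<partial>lborel)"
      by (intro integral_powr_le) (use r C row in auto)
    finally show ?thesis .
  qed
  then have "(\<integral>\<^sup>+x. ennreal (\<bar>\<integral>y. k x y * h y \<partial>lborel\<bar> powr r) \<partial>lborel) \<le>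
      (\<integral>\<^sup>+x. ennreal (C powr (r - 1)) * (\<integral>\<^sup>+y. ennreal (\<bar>k x y\<bar> * \<bar>h y\<bar> powr r) \<partial>lborel) \<partial>lborel)"
    by (intro nn_integral_mono)
  also have "\<dots> = ennreal (C powr (r - 1)) * (\<integral>\<^sup>+x. (\<integral>\<^sup>+y. ennreal (\<bar>k x y\<bar> * \<bar>h y\<bar> powr r) \<partial>lborel) \<partial>lborel)"
    by (intro nn_integral_cmult) measurable
  also have "(\<integral>\<^sup>+x. (\<integral>\<^sup>+y. ennreal (\<bar>k x y\<bar> * \<bar>h y\<bar> powr r) \<partial>lborel) \<partial>lborel) =
      (\<integral>\<^sup>+y. (\<integral>\<^sup>+x. ennreal (\<bar>k x y\<bar> * \<bar>h y\<bar> powr r) \<partial>lborel) \<partial>lborel)"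
    by (intro lborel_pair.Fubini') measurable
  also have "\<dots> = (\<integral>\<^sup>+y. (\<integral>\<^sup>+x. ennreal \<bar>k x y\<bar> \<partial>lborel) * ennreal (\<bar>h y\<bar> powr r) \<partial>lborel)"
  proof -
    have "(\<lambda>x. k x y) \<in> borel_measurable borel" for y
      using measurable_compose[OF measurable_Pair2' k, of y] by simp
    then show ?thesis
      by (intro nn_integral_cong) (simp add: ennreal_mult nn_integral_multc)
  qed
  also have "\<dots> \<le> (\<integral>\<^sup>+y. ennreal e * ennreal (\<bar>h y\<bar> powr r) \<partial>lborel)"
    by (intro nn_integral_mono mult_right_mono col) auto
  also have "\<dots> = ennreal e * (\<integral>\<^sup>+y. ennreal (\<bar>h y\<bar> powr r) \<partial>lborel)"
    by (intro nn_integral_cmult) measurable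
  finally show ?thesis by (simp add: mult.assoc mult_left_mono)
qed

section \<open>Continuity of translations in the mean\<close>

lemma integrable_translate:
  fixes f :: "real \<Rightarrow> real"
  shows "integrable lborel f \<Longrightarrow> integrable lborel (\<lambda>x. f (x + t))"
  using lborel_integrable_real_affine[of f 1 t] by (simp add: add.commute)

lemma integral_translate:
  fixes f :: "real \<Rightarrow> real"
  shows "(\<integral>x. f (x + t) \<partial>lborel) = (\<integral>x. f x \<partial>lborel)"
  using lborel_integral_real_affine[of 1 f t] by (simp add: add.commute)

text \<open>The triangle inequality through \<open>g\<close>; by translation invariance the error
  \<open>f - g\<close> costs the same at \<open>x\<close> and at \<open>x + t\<close>, hence the
  factor 2.\<close>

lemma integral_translate_diff_le:
  fixes f g :: "real \<Rightarrow> real"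
  assumes [simp]: "integrable lborel f" "integrable lborel g"
  shows "(\<integral>x. \<bar>f (x + t) - f x\<bar> \<partial>lborel) \<le>
    (\<integral>x. \<bar>g (x + t) - g x\<bar> \<partial>lborel) + 2 * (\<integral>x. \<bar>f x - g x\<bar> \<partial>lborel)"
proof -
  have [simp]: "integrable lborel (\<lambda>x. f (x + t))" "integrable lborel (\<lambda>x. g (x + t))"
    "integrable lborel (\<lambda>x. \<bar>f (x + t) - g (x + t)\<bar>)"
    using integrable_translate[of "\<lambda>x. \<bar>f x - g x\<bar>" t] by (auto intro: integrable_translate)
  have "(\<integral>x. \<bar>f (x + t) - f x\<bar> \<partial>lborel) \<le>
      (\<integral>x. \<bar>g (x + t) - g x\<bar> + (\<bar>f (x + t) - g (x + t)\<bar> + \<bar>f x - g x\<bar>) \<partial>lborel)"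
    by (intro integral_mono) auto
  also have "\<dots> = (\<integral>x. \<bar>g (x + t) - g x\<bar> \<partial>lborel) + 2 * (\<integral>x. \<bar>f x - g x\<bar> \<partial>lborel)"
    using integral_translate[of "\<lambda>x. \<bar>f x - g x\<bar>" t] by simp
  finally show ?thesis .
qed

text \<open>A point of an open set stays in it under small translations, so the part of
  \<open>U\<close> that is moved out of \<open>U\<close> shrinks to nothing by dominated
  convergence.\<close>

lemma translation_continuous_L1_open:
  fixes U :: "real set"
  assumes U: "open U" "emeasure lborel U < \<infinity>"
  shows "((\<lambda>t. \<integral>x. \<bar>indicat_real U (x + t) - indicat_real U x\<bar> \<partial>lborel) \<longlongrightarrow> 0) (at 0)"
proof (unfold tendsto_at_iff_sequentially, intro allI impI)
  fix X :: "nat \<Rightarrow> real" assume X: "\<forall>i. X i \<in> UNIV - {0}" "X \<longlonglongrightarrow> 0"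
  have [measurable]: "U \<in> sets borel" using U by simp
  have iU [simp]: "integrable lborel (indicat_real U)" using U by (simp add: integrable_real_indicator)
  have [simp]: "integrable lborel (\<lambda>x. indicat_real U (x + t))" for t
    by (intro integrable_translate) simp
  have prod_int [simp]: "integrable lborel (\<lambda>x. indicat_real U x * (1 - indicat_real U (x + t)))" for t
    by (rule Bochner_Integration.integrable_bound[OF iU]) (auto simp: indicator_def)
  \<comment> \<open>For indicators \<open>\<bar>b - a\<bar> = 2 * (a * (1 - b)) + (b - a)\<close>,
    and the last term integrates to 0 by translation invariance.\<close>
  have eq: "(\<integral>x. \<bar>indicat_real U (x + t) - indicat_real U x\<bar> \<partial>lborel) =
      2 * (\<integral>x. indicat_real U x * (1 - indicat_real U (x + t)) \<partial>lborel)" for t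
  proof -
    have "(\<integral>x. \<bar>indicat_real U (x + t) - indicat_real U x\<bar> \<partial>lborel) =
      (\<integral>x. 2 * (indicat_real U x * (1 - indicat_real U (x + t))) + (indicat_real U (x + t) - indicat_real U x) \<partial>lborel)"
      by (intro Bochner_Integration.integral_cong) (auto simp: indicator_def)
    also have "\<dots> = 2 * (\<integral>x. indicat_real U x * (1 - indicat_real U (x + t)) \<partial>lborel)"
      using integral_translate[of "indicat_real U" t] by simp
    finally show ?thesis .
  qed
  have "(\<lambda>i. \<integral>x. indicat_real U x * (1 - indicat_real U (x + X i)) \<partial>lborel) \<longlonglongrightarrow> (\<integral>x. 0 \<partial>(lborel :: real measure))"
  proof (rule integral_dominated_convergence[where w = "indicat_real U"])
    have "(\<lambda>i. indicat_real U x * (1 - indicat_real U (x + X i))) \<longlonglongrightarrow> 0" for x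
    proof (cases "x \<in> U")
      case True
      have "(\<lambda>i. x + X i) \<longlonglongrightarrow> x" using tendsto_add[OF tendsto_const X(2), of x] by simp
      then have "\<forall>\<^sub>F i in sequentially. x + X i \<in> U" using U(1) True by (rule topological_tendstoD)
      then have "\<forall>\<^sub>F i in sequentially. indicat_real U x * (1 - indicat_real U (x + X i)) = 0"
        by eventually_elim simp
      then show ?thesis by (rule tendsto_eventually)
    qed simp
    then show "AE x in lborel. (\<lambda>i. indicat_real U x * (1 - indicat_real U (x + X i))) \<longlonglongrightarrow> 0" by simp
  qed (auto simp: indicator_def)
  then show "((\<lambda>t. \<integral>x. \<bar>indicat_real U (x + t) - indicat_real U x\<bar> \<partial>lborel) \<circ> X) \<longlonglongrightarrow> 0"
    unfolding eq comp_def using tendsto_mult[OF tendsto_const[of 2]] by fastforce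
qed

text \<open>Indicators of measurable sets are approximated by open supersets through outer
  regularity, and the induction principle for integrable functions does the rest. The local fact
  \<open>approx\<close> is closedness under L^1 limits, needed both for the indicators and for the
  limit case.\<close>

lemma translation_continuous_L1:
  fixes f :: "real \<Rightarrow> real"
  assumes "integrable lborel f"
  shows "((\<lambda>t. \<integral>x. \<bar>f (x + t) - f x\<bar> \<partial>lborel) \<longlongrightarrow> 0) (at 0)"
proof -
  let ?L = "\<lambda>f t. \<integral>x. \<bar>f (x + t) - f x\<bar> \<partial>(lborel :: real measure)"
  have approx: "(?L f \<longlongrightarrow> 0) (at 0)"
    if f: "integrable lborel f"
      and g: "\<And>e. 0 < e \<Longrightarrow> \<exists>g. integrable lborel g \<and> (\<integral>x. \<bar>f x - g x\<bar> \<partial>lborel) < e \<and> (?L g \<longlongrightarrow> 0) (at 0)"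
    for f :: "real \<Rightarrow> real"
  proof (rule order_tendstoI)
    fix e :: real assume e: "0 < e"
    obtain g where g: "integrable lborel g" "(\<integral>x. \<bar>f x - g x\<bar> \<partial>lborel) < e / 3" "(?L g \<longlongrightarrow> 0) (at 0)"
      using g[of "e / 3"] e by auto
    have "\<forall>\<^sub>F t in at 0. ?L g t < e / 3" using g(3) e by (intro order_tendstoD(2)) auto
    then show "\<forall>\<^sub>F t in at 0. ?L f t < e"
    proof eventually_elim
      case (elim t)
      then show ?case using integral_translate_diff_le[OF f g(1), of t] g(2) by linarith
    qed
  next
    fix e :: real assume "e < 0"
    then have "e < ?L f t" for t
      by (rule less_le_trans) simp
    then show "\<forall>\<^sub>F t in at 0. e < ?L f t" by (simp add: always_eventually)
  qed
  from assms show ?thesis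
  proof (induction rule: integrable_induct)
    case (base A c)
    have [measurable]: "A \<in> sets borel" using base by simp
    have 1: "(?L (indicat_real A) \<longlongrightarrow> 0) (at 0)"
    proof (rule approx)
      show "integrable lborel (indicat_real A)" using base by (simp add: integrable_real_indicator)
      fix e :: real assume e: "0 < e"
      obtain U where U: "open U" "A \<subseteq> U" "emeasure lborel (U - A) < ennreal e"
        using base by (auto intro: outer_regular_lborel[OF _ e, of A])
      have [measurable]: "U \<in> sets borel" using U by simp
      have "emeasure lborel U \<le> emeasure lborel A + emeasure lborel (U - A)"
        using U(2) emeasure_subadditive[of A lborel "U - A"] by (simp add: Un_absorb1)
      also have "\<dots> < \<infinity>" using base order.strict_trans[OF U(3) ennreal_less_top] by simp
      finally have fin: "emeasure lborel U < \<infinity>" .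
      have "(\<integral>x. \<bar>indicat_real A x - indicat_real U x\<bar> \<partial>lborel) = (\<integral>x. indicat_real (U - A) x \<partial>lborel)"
        using U(2) by (intro Bochner_Integration.integral_cong) (auto simp: indicator_def)
      also have "\<dots> = measure lborel (U - A)" by simp
      also have "\<dots> < e" 
        using U(3) order.strict_trans[OF U(3) ennreal_less_top] by (simp add: measure_def)
      finally show "\<exists>g. integrable lborel g \<and> (\<integral>x. \<bar>indicat_real A x - g x\<bar> \<partial>lborel) < e \<and> (?L g \<longlongrightarrow> 0) (at 0)"
        using translation_continuous_L1_open[OF U(1) fin] fin
        by (intro exI[of _ "indicat_real U"]) (auto simp: integrable_real_indicator)
    qed
    have "?L (\<lambda>x. indicat_real A x *\<^sub>R c) t = \<bar>c\<bar> * ?L (indicat_real A) t" for t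
      by (subst integral_mult_right_zero[symmetric])
        (auto intro!: Bochner_Integration.integral_cong simp: abs_mult[symmetric] algebra_simps)
    then show ?case using tendsto_mult[OF tendsto_const[of "\<bar>c\<bar>"] 1] by simp
  next
    case (add f g)
    have [simp]: "integrable lborel (\<lambda>x. f (x + t))" "integrable lborel (\<lambda>x. g (x + t))"
      "integrable lborel f" "integrable lborel g" for t
      using add by (auto intro: integrable_translate)
    show ?case
    proof (rule tendsto_sandwich[OF _ _ tendsto_const])
      show "\<forall>\<^sub>F t in at 0. ?L (\<lambda>x. f x + g x) t \<le> ?L f t + ?L g t"
      proof (intro always_eventually allI)
        fix t
        have "?L (\<lambda>x. f x + g x) t \<le> (\<integral>x. \<bar>f (x + t) - f x\<bar> + \<bar>g (x + t) - g x\<bar> \<partial>lborel)"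
          by (intro integral_mono) auto
        then show "?L (\<lambda>x. f x + g x) t \<le> ?L f t + ?L g t" by simp
      qed
      show "((\<lambda>t. ?L f t + ?L g t) \<longlongrightarrow> 0) (at 0)" using tendsto_add[OF add(3,4)] by simp
    qed (auto intro!: always_eventually integral_nonneg_AE)
  next
    case (lim f s)
    show ?case
    proof (rule approx)
      show "integrable lborel f" by fact
      fix e :: real assume e: "0 < e"
      have "(\<lambda>i. \<integral>x. \<bar>f x - s i x\<bar> \<partial>lborel) \<longlonglongrightarrow> (\<integral>x. 0 \<partial>(lborel :: real measure))"
      \<comment> \<open>The approximants satisfy
        \<open>\<bar>s i x\<bar> \<le> 2 * \<bar>f x\<bar>\<close>, which leaves
        \<open>3 * \<bar>f x\<bar>\<close> for the difference.\<close>
      proof (rule integral_dominated_convergence[where w = "\<lambda>x. 3 * \<bar>f x\<bar>"])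
        show "AE x in lborel. (\<lambda>i. \<bar>f x - s i x\<bar>) \<longlonglongrightarrow> 0"
        proof (intro AE_I2)
          fix x :: real assume "x \<in> space lborel"
          then have "(\<lambda>i. s i x) \<longlonglongrightarrow> f x" using lim by auto
          from tendsto_rabs[OF tendsto_diff[OF tendsto_const[of "f x"] this]]
          show "(\<lambda>i. \<bar>f x - s i x\<bar>) \<longlonglongrightarrow> 0" by simp
        qed
        show "AE x in lborel. norm \<bar>f x - s i x\<bar> \<le> 3 * \<bar>f x\<bar>" for i
        proof (intro AE_I2)
          fix x :: real assume "x \<in> space lborel"
          then have "norm (s i x) \<le> 2 * norm (f x)" using lim by blast
          then show "norm \<bar>f x - s i x\<bar> \<le> 3 * \<bar>f x\<bar>" by simp
        qed
      qed (use lim in auto)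
      then have "(\<lambda>i. \<integral>x. \<bar>f x - s i x\<bar> \<partial>lborel) \<longlonglongrightarrow> 0" by simp
      then have "\<forall>\<^sub>F i in sequentially. (\<integral>x. \<bar>f x - s i x\<bar> \<partial>lborel) < e"
        using e by (intro order_tendstoD(2)) auto
      then obtain i where "(\<integral>x. \<bar>f x - s i x\<bar> \<partial>lborel) < e" by (auto simp: eventually_sequentially)
      then show "\<exists>g. integrable lborel g \<and> (\<integral>x. \<bar>f x - g x\<bar> \<partial>lborel) < e \<and> (?L g \<longlongrightarrow> 0) (at 0)"
        using lim by (intro exI[of _ "s i"]) auto
    qed
  qed
qed

lemma translation_L1_small:
  fixes f :: "real \<Rightarrow> real"
  assumes f: "integrable lborel f" and e: "0 < e"
  obtains s where "0 < s" "\<And>t. \<bar>t\<bar> \<le> s \<Longrightarrow> (\<integral>\<^sup>+x. ennreal \<bar>f (x + t) - f x\<bar> \<partial>lborel) \<le> ennreal e"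
proof -
  have "\<forall>\<^sub>F t in at 0. (\<integral>x. \<bar>f (x + t) - f x\<bar> \<partial>lborel) < e"
    using translation_continuous_L1[OF f] e by (intro order_tendstoD(2)) auto
  then obtain s where s: "0 < s" "\<And>t. t \<noteq> 0 \<Longrightarrow> \<bar>t\<bar> < s \<Longrightarrow> (\<integral>x. \<bar>f (x + t) - f x\<bar> \<partial>lborel) < e"
    by (auto simp: eventually_at dist_real_def)
  show ?thesis
  proof (rule that[of "s / 2"])
    fix t :: real assume t: "\<bar>t\<bar> \<le> s / 2"
    have "(\<integral>x. \<bar>f (x + t) - f x\<bar> \<partial>lborel) \<le> e"
    proof (cases "t = 0")
      case False
      then show ?thesis using s t by (intro less_imp_le s(2)) auto
    qed (use e in simp)
    then show "(\<integral>\<^sup>+x. ennreal \<bar>f (x + t) - f x\<bar> \<partial>lborel) \<le> ennreal e"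
      using integrable_translate[OF f, of t] f e by (subst nn_integral_eq_integral) auto
  qed (use s in simp)
qed

section \<open>Translation regularity of the approximating kernels\<close>

text \<open>
  The only properties of the approximating kernels used in the proof. The displacement \<open>t\<close> is measured
  on the scale \<open>2 ^ - j\<close> of the kernel.
\<close>

definition translation_regular :: "real set \<Rightarrow> nat \<Rightarrow> (nat \<Rightarrow> real \<Rightarrow> real \<Rightarrow> real) \<Rightarrow> bool" where
  "translation_regular T J0 K \<longleftrightarrow>
     (\<forall>j\<ge>J0. (\<lambda>(x, y). indicat_real T x * indicat_real T y * K j x y) \<in> borel_measurable (borel \<Otimes>\<^sub>M borel)) \<and>
     (\<exists>C>0. \<forall>j\<ge>J0. \<forall>x\<in>T. (\<integral>\<^sup>+y\<in>T. ennreal \<bar>K j x y\<bar> \<partial>lborel) \<le> ennreal C) \<and>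
     (\<forall>e>0. \<exists>s>0. \<forall>j\<ge>J0. \<forall>t. \<bar>t\<bar> * 2 ^ j \<le> s \<longrightarrow> (\<forall>y\<in>T.
        (\<integral>\<^sup>+x\<in>{x \<in> T. x + t \<in> T}. ennreal \<bar>K j (x + t) y - K j x y\<bar> \<partial>lborel) \<le> ennreal e))"

text \<open>Lets the estimates be proved for a kernel \<open>G\<close> on the whole plane, where
  substitutions leave the domain alone; restriction to \<open>T\<close> only decreases the
  integrals.\<close>

lemma translation_regularI:
  fixes G :: "nat \<Rightarrow> real \<Rightarrow> real \<Rightarrow> real"
  assumes [measurable]: "T \<in> sets borel"
    and G [measurable]: "\<And>j. j \<ge> J0 \<Longrightarrow> (\<lambda>(x, y). G j x y) \<in> borel_measurable (borel \<Otimes>\<^sub>M borel)"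
    and eq: "\<And>j x y. j \<ge> J0 \<Longrightarrow> x \<in> T \<Longrightarrow> y \<in> T \<Longrightarrow> K j x y = G j x y"
    and C: "\<And>j x. j \<ge> J0 \<Longrightarrow> (\<integral>\<^sup>+y. ennreal \<bar>G j x y\<bar> \<partial>lborel) \<le> ennreal C"
    and e: "\<And>e. e > 0 \<Longrightarrow> \<exists>s>0. \<forall>j\<ge>J0. \<forall>t. \<bar>t\<bar> * 2 ^ j \<le> s \<longrightarrow>
      (\<forall>y. (\<integral>\<^sup>+x. ennreal \<bar>G j (x + t) y - G j x y\<bar> \<partial>lborel) \<le> ennreal e)"
  shows "translation_regular T J0 K"
  unfolding translation_regular_def
proof (intro conjI allI impI)
  fix j assume j: "J0 \<le> j"
  have "(\<lambda>(x, y). indicat_real T x * indicat_real T y * K j x y) =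
      (\<lambda>(x, y). indicat_real T x * indicat_real T y * G j x y)"
    using eq[OF j] by (auto simp: fun_eq_iff indicator_def)
  moreover have "\<dots> \<in> borel_measurable (borel \<Otimes>\<^sub>M borel)"
    using G[OF j] by measurable
  ultimately show "(\<lambda>(x, y). indicat_real T x * indicat_real T y * K j x y) \<in> borel_measurable (borel \<Otimes>\<^sub>M borel)"
    by simp
next
  show "\<exists>C>0. \<forall>j\<ge>J0. \<forall>x\<in>T. (\<integral>\<^sup>+y\<in>T. ennreal \<bar>K j x y\<bar> \<partial>lborel) \<le> ennreal C"
  proof (intro exI[of _ "max C 1"] conjI allI impI ballI)
    fix j x assume "J0 \<le> j" "x \<in> T"
    then have "(\<integral>\<^sup>+y\<in>T. ennreal \<bar>K j x y\<bar> \<partial>lborel) \<le> (\<integral>\<^sup>+y. ennreal \<bar>G j x y\<bar> \<partial>lborel)"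
      using eq by (intro nn_integral_mono) (auto simp: indicator_def)
    also have "\<dots> \<le> ennreal (max C 1)"
      using C[OF \<open>J0 \<le> j\<close>, of x] by (rule order_trans) (simp add: ennreal_leI)
    finally show "(\<integral>\<^sup>+y\<in>T. ennreal \<bar>K j x y\<bar> \<partial>lborel) \<le> ennreal (max C 1)" .
  qed simp
next
  fix e' :: real assume "0 < e'"
  from e[OF this] obtain s where s: "s > 0" "\<And>j t y. j \<ge> J0 \<Longrightarrow> \<bar>t\<bar> * 2 ^ j \<le> s \<Longrightarrow>
      (\<integral>\<^sup>+x. ennreal \<bar>G j (x + t) y - G j x y\<bar> \<partial>lborel) \<le> ennreal e'" by blast
  show "\<exists>s>0. \<forall>j\<ge>J0. \<forall>t. \<bar>t\<bar> * 2 ^ j \<le> s \<longrightarrow> (\<forall>y\<in>T.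
        (\<integral>\<^sup>+x\<in>{x \<in> T. x + t \<in> T}. ennreal \<bar>K j (x + t) y - K j x y\<bar> \<partial>lborel) \<le> ennreal e')"
  proof (intro exI[of _ s] conjI allI impI ballI s(1))
    fix j t y assume *: "J0 \<le> j" "\<bar>t\<bar> * 2 ^ j \<le> s" "y \<in> T"
    then have "(\<integral>\<^sup>+x\<in>{x \<in> T. x + t \<in> T}. ennreal \<bar>K j (x + t) y - K j x y\<bar> \<partial>lborel) \<le>
        (\<integral>\<^sup>+x. ennreal \<bar>G j (x + t) y - G j x y\<bar> \<partial>lborel)"
      using eq by (intro nn_integral_mono) (auto simp: indicator_def)
    also have "\<dots> \<le> ennreal e'" using s(2) * by simp
    finally show "(\<integral>\<^sup>+x\<in>{x \<in> T. x + t \<in> T}. ennreal \<bar>K j (x + t) y - K j x y\<bar> \<partial>lborel) \<le> ennreal e'" .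
  qed
qed

lemma nn_integral_dilate:
  fixes f :: "real \<Rightarrow> ennreal"
  assumes [measurable]: "f \<in> borel_measurable borel"
  shows "(\<integral>\<^sup>+x. ennreal (2 ^ j) * f (2 ^ j * x) \<partial>lborel) = (\<integral>\<^sup>+x. f x \<partial>lborel)"
  using nn_integral_real_affine[of f "2 ^ j" 0] by (simp add: nn_integral_cmult)

lemma integrable_of_mu_norm:
  assumes "Linf UNIV f" "mu_norm UNIV v f < \<infinity>" "0 \<le> v"
  shows "integrable lborel f"
proof (rule integrableI_bounded)
  show [measurable]: "f \<in> borel_measurable lborel"
    using assms(1) by (auto simp: Linf_def)
  have "(\<integral>\<^sup>+x. ennreal (norm (f x)) \<partial>lborel) \<le> mu_norm UNIV v f"
    unfolding mu_norm_def
    using assms(3) by (intro nn_integral_mono) (auto intro!: ennreal_leI mult_left_mono[where a = 1, simplified] ge_one_powr_ge_zero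
        simp: mult_le_cancel_left1)
  then show "(\<integral>\<^sup>+x. ennreal (norm (f x)) \<partial>lborel) < \<infinity>" using assms(2) by simp
qed

text \<open>Dilation and shift reduce the row integrals to the L^1-norm of \<open>g\<close>, and the
  column differences to its L^1-modulus at \<open>2 ^ j * t\<close>, uniformly in \<open>j\<close>
  and \<open>y\<close>.\<close>

lemma translation_regular_convolution:
  assumes T: "T \<in> sets borel" and K: "convolution_kernel \<kappa>"
    and eq: "\<And>j x y. x \<in> T \<Longrightarrow> y \<in> T \<Longrightarrow> K j x y = dilated_kernel \<kappa> j x y"
  shows "translation_regular T J0 K"
proof -
  obtain g v where g: "\<And>x y. \<kappa> x y = g (x - y)" "Linf UNIV g" "v > 2" "mu_norm UNIV v g < \<infinity>"
    using K unfolding convolution_kernel_def by blast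
  have gi: "integrable lborel g" using g by (intro integrable_of_mu_norm[of g v]) auto
  have [measurable]: "g \<in> borel_measurable borel" using gi by auto
  show ?thesis
  proof (rule translation_regularI[OF T, where G = "\<lambda>j x y. 2 ^ j * g (2 ^ j * x - 2 ^ j * y)" and C = "\<integral>x. \<bar>g x\<bar> \<partial>lborel"])
    fix j x
    show "(\<lambda>(x, y). 2 ^ j * g (2 ^ j * x - 2 ^ j * y)) \<in> borel_measurable (borel \<Otimes>\<^sub>M borel)"
      by measurable
    have "(\<integral>\<^sup>+y. ennreal \<bar>2 ^ j * g (2 ^ j * x - 2 ^ j * y)\<bar> \<partial>lborel) = (\<integral>\<^sup>+y. ennreal \<bar>g y\<bar> \<partial>lborel)"
      using nn_integral_real_affine[of "\<lambda>y. ennreal \<bar>g y\<bar>" "- (2 ^ j)" "2 ^ j * x"]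
      by (simp add: nn_integral_cmult abs_mult ennreal_mult)
    also have "\<dots> = ennreal (\<integral>x. \<bar>g x\<bar> \<partial>lborel)" using gi by (intro nn_integral_eq_integral) auto
    finally show "(\<integral>\<^sup>+y. ennreal \<bar>2 ^ j * g (2 ^ j * x - 2 ^ j * y)\<bar> \<partial>lborel) \<le> ennreal (\<integral>x. \<bar>g x\<bar> \<partial>lborel)"
      by simp
  next
    fix e :: real assume "0 < e"
    then obtain s where s: "0 < s" "\<And>t. \<bar>t\<bar> \<le> s \<Longrightarrow> (\<integral>\<^sup>+x. ennreal \<bar>g (x + t) - g x\<bar> \<partial>lborel) \<le> ennreal e"
      using translation_L1_small[OF gi] by metis
    show "\<exists>s>0. \<forall>j\<ge>J0. \<forall>t. \<bar>t\<bar> * 2 ^ j \<le> s \<longrightarrow> (\<forall>y. (\<integral>\<^sup>+x. ennreal \<bar>2 ^ j * g (2 ^ j * (x + t) - 2 ^ j * y)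
        - 2 ^ j * g (2 ^ j * x - 2 ^ j * y)\<bar> \<partial>lborel) \<le> ennreal e)"
    proof (intro exI[of _ s] conjI allI impI s(1))
      fix j :: nat and t y :: real assume t: "\<bar>t\<bar> * 2 ^ j \<le> s"
      have "(\<integral>\<^sup>+x. ennreal \<bar>2 ^ j * g (2 ^ j * (x + t) - 2 ^ j * y) - 2 ^ j * g (2 ^ j * x - 2 ^ j * y)\<bar> \<partial>lborel) =
         (\<integral>\<^sup>+x. ennreal \<bar>g (x + 2 ^ j * t) - g x\<bar> \<partial>lborel)"
      proof -
        have "\<bar>2 ^ j * g (2 ^ j * (x + t) - 2 ^ j * y) - 2 ^ j * g (2 ^ j * x - 2 ^ j * y)\<bar> =
            2 ^ j * \<bar>g (- (2 ^ j * y) + 2 ^ j * x + 2 ^ j * t) - g (- (2 ^ j * y) + 2 ^ j * x)\<bar>" for x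
          unfolding right_diff_distrib[symmetric] abs_mult by (simp add: algebra_simps)
        then show ?thesis
          using nn_integral_real_affine[of "\<lambda>x. ennreal \<bar>g (x + 2 ^ j * t) - g x\<bar>" "2 ^ j" "- (2 ^ j * y)"]
          by (simp add: nn_integral_cmult ennreal_mult)
      qed
      also have "\<dots> \<le> ennreal e" using t by (intro s(2)) (simp add: abs_mult mult.commute)
      finally show "(\<integral>\<^sup>+x. ennreal \<bar>2 ^ j * g (2 ^ j * (x + t) - 2 ^ j * y) - 2 ^ j * g (2 ^ j * x - 2 ^ j * y)\<bar> \<partial>lborel) \<le> ennreal e" .
    qed
  qed (simp add: eq dilated_kernel_def g(1))
qed

text \<open>Covers the multiresolution and the boundary-corrected kernels at once.\<close>

lemma translation_regular_frame:
  fixes a :: "nat \<Rightarrow> nat \<Rightarrow> real \<Rightarrow> real"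
  assumes T: "T \<in> sets borel"
    and A: "finite A" "\<And>\<alpha>. \<alpha> \<in> A \<Longrightarrow> integrable lborel \<alpha>"
    and a: "\<And>j i. j \<ge> J0 \<Longrightarrow> \<exists>\<alpha>\<in>A. \<exists>s. a j i = (\<lambda>u. \<alpha> (u - s))"
    and sum: "\<And>j z. j \<ge> J0 \<Longrightarrow> summable (\<lambda>i. \<bar>a j i z\<bar>)"
    and B: "\<And>j z. j \<ge> J0 \<Longrightarrow> (\<Sum>i. \<bar>a j i z\<bar>) \<le> B"
    and eq: "\<And>j x y. j \<ge> J0 \<Longrightarrow> x \<in> T \<Longrightarrow> y \<in> T \<Longrightarrow>
      K j x y = 2 ^ j * (\<Sum>i. a j i (2 ^ j * x) * a j i (2 ^ j * y))"
  shows "translation_regular T J0 K"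
proof -
  have am [measurable]: "a j i \<in> borel_measurable borel" if "j \<ge> J0" for j i
    using a[OF that, of i] A(2) by (auto dest!: borel_measurable_integrable)
  have B0: "0 \<le> B"
    using suminf_nonneg[OF sum] B by (meson abs_ge_zero order_refl order_trans)
  have bd: "\<bar>a j i z\<bar> \<le> B" if "j \<ge> J0" for j i z
    using sum_le_suminf[OF sum[OF that], of "{i}" z] B[OF that, of z] by simp
  have sumB: "(\<Sum>i. ennreal \<bar>a j i z\<bar>) \<le> ennreal B" if "j \<ge> J0" for j z
    using sum[OF that] B[OF that] by (subst suminf_ennreal2) (auto intro: ennreal_leI)
  have prod: "summable (\<lambda>i. \<bar>a j i x\<bar> * \<bar>a j i y\<bar>)" if "j \<ge> J0" for j x y
    by (rule summable_comparison_test[OF _ summable_mult[OF sum[OF that, of y], of B]])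
      (auto intro!: mult_right_mono bd that)
  have prod': "summable (\<lambda>i. a j i x * a j i y)" if "j \<ge> J0" for j x y
    by (rule summable_rabs_cancel) (use prod[OF that] in \<open>simp add: abs_mult\<close>)
  \<comment> \<open>Finitely many profiles \<open>\<alpha>\<close> generate all functions
    \<open>a j i\<close> by translation, so one constant bounds all their L^1-norms.\<close>
  define C where "C = (\<Sum>\<alpha>\<in>A. \<integral>x. \<bar>\<alpha> x\<bar> \<partial>lborel)"
  have C0: "0 \<le> C" unfolding C_def by (intro sum_nonneg) simp
  have aC: "(\<integral>\<^sup>+x. ennreal \<bar>a j i x\<bar> \<partial>lborel) \<le> ennreal C" if j: "j \<ge> J0" for j i
  proof -
    obtain \<alpha> s where \<alpha>: "\<alpha> \<in> A" "a j i = (\<lambda>u. \<alpha> (u - s))" using a[OF j] by blast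
    have [measurable]: "\<alpha> \<in> borel_measurable borel" using A(2)[OF \<alpha>(1)] by auto
    have "(\<integral>\<^sup>+x. ennreal \<bar>a j i x\<bar> \<partial>lborel) = (\<integral>\<^sup>+x. ennreal \<bar>\<alpha> x\<bar> \<partial>lborel)"
      using nn_integral_real_affine[of "\<lambda>x. ennreal \<bar>\<alpha> x\<bar>" 1 "-s"] by (simp add: \<alpha>)
    also have "\<dots> = ennreal (\<integral>x. \<bar>\<alpha> x\<bar> \<partial>lborel)" using A(2)[OF \<alpha>(1)] by (intro nn_integral_eq_integral) auto
    also have "\<dots> \<le> ennreal C" unfolding C_def
      using A \<alpha> by (intro ennreal_leI member_le_sum) auto
    finally show ?thesis .
  qed
  show ?thesis
  proof (rule translation_regularI[OF T, where G = "\<lambda>j x y. 2 ^ j * (\<Sum>i. a j i (2 ^ j * x) * a j i (2 ^ j * y))" and C = "C * B"])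
    fix j assume j: "J0 \<le> j"
    note [measurable] = am[OF j]
    show "(\<lambda>(x, y). 2 ^ j * (\<Sum>i. a j i (2 ^ j * x) * a j i (2 ^ j * y))) \<in> borel_measurable (borel \<Otimes>\<^sub>M borel)"
      by measurable
    fix x :: real
    have "(\<integral>\<^sup>+y. ennreal \<bar>2 ^ j * (\<Sum>i. a j i (2 ^ j * x) * a j i (2 ^ j * y))\<bar> \<partial>lborel) \<le>
        (\<integral>\<^sup>+y. (\<Sum>i. ennreal (2 ^ j) * (ennreal \<bar>a j i (2 ^ j * x)\<bar> * ennreal \<bar>a j i (2 ^ j * y)\<bar>)) \<partial>lborel)"
    proof (intro nn_integral_mono)
      fix y :: real
      have "\<bar>2 ^ j * (\<Sum>i. a j i (2 ^ j * x) * a j i (2 ^ j * y))\<bar> \<le> 2 ^ j * (\<Sum>i. \<bar>a j i (2 ^ j * x)\<bar> * \<bar>a j i (2 ^ j * y)\<bar>)"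
        using summable_rabs[of "\<lambda>i. a j i (2 ^ j * x) * a j i (2 ^ j * y)"] prod[OF j]
        by (simp add: abs_mult)
      then show "ennreal \<bar>2 ^ j * (\<Sum>i. a j i (2 ^ j * x) * a j i (2 ^ j * y))\<bar> \<le>
        (\<Sum>i. ennreal (2 ^ j) * (ennreal \<bar>a j i (2 ^ j * x)\<bar> * ennreal \<bar>a j i (2 ^ j * y)\<bar>))"
        using prod[OF j] by (simp add: ennreal_mult[symmetric] suminf_ennreal2 ennreal_leI summable_mult suminf_mult)
    qed
    also have "\<dots> = (\<Sum>i. ennreal \<bar>a j i (2 ^ j * x)\<bar> * (\<integral>\<^sup>+y. ennreal (2 ^ j) * ennreal \<bar>a j i (2 ^ j * y)\<bar> \<partial>lborel))"
      by (subst nn_integral_suminf) (auto simp: nn_integral_cmult[symmetric] ac_simps)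
    also have "\<dots> \<le> (\<Sum>i. ennreal \<bar>a j i (2 ^ j * x)\<bar> * ennreal C)"
      using aC[OF j] nn_integral_dilate[of "\<lambda>y. ennreal \<bar>a j _ y\<bar>" j]
      by (intro suminf_le mult_left_mono) auto
    also have "\<dots> = (\<Sum>i. ennreal \<bar>a j i (2 ^ j * x)\<bar>) * ennreal C" by (rule ennreal_suminf_multc)
    also have "\<dots> \<le> ennreal B * ennreal C" by (intro mult_right_mono sumB j) simp
    also have "\<dots> = ennreal (C * B)" using B0 C0 by (simp add: ennreal_mult mult.commute)
    finally show "(\<integral>\<^sup>+y. ennreal \<bar>2 ^ j * (\<Sum>i. a j i (2 ^ j * x) * a j i (2 ^ j * y))\<bar> \<partial>lborel) \<le> ennreal (C * B)" .
  next
    fix e :: real assume e: "0 < e"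
    \<comment> \<open>The final estimate is \<open>B * e'\<close>; the \<open>+ 1\<close> covers
      \<open>B = 0\<close>.\<close>
    define e' where "e' = e / (B + 1)"
    have e': "0 < e'" using e B0 by (simp add: e'_def)
    have "\<forall>\<alpha>\<in>A. \<exists>s>0. \<forall>t. \<bar>t\<bar> \<le> s \<longrightarrow> (\<integral>\<^sup>+x. ennreal \<bar>\<alpha> (x + t) - \<alpha> x\<bar> \<partial>lborel) \<le> ennreal e'"
      using translation_L1_small[OF A(2) e'] by metis
    then obtain S where S: "\<And>\<alpha>. \<alpha> \<in> A \<Longrightarrow> S \<alpha> > 0"
      "\<And>\<alpha> t. \<alpha> \<in> A \<Longrightarrow> \<bar>t\<bar> \<le> S \<alpha> \<Longrightarrow> (\<integral>\<^sup>+x. ennreal \<bar>\<alpha> (x + t) - \<alpha> x\<bar> \<partial>lborel) \<le> ennreal e'"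
      by metis
    \<comment> \<open>The minimum over the finite set of profiles gives one displacement for all
      translates and levels; the element 1 covers an empty \<open>A\<close>.\<close>
    define s where "s = Min (insert 1 (S ` A))"
    have s: "s > 0" "\<And>\<alpha>. \<alpha> \<in> A \<Longrightarrow> s \<le> S \<alpha>" using A(1) S(1) by (auto simp: s_def)
    show "\<exists>s>0. \<forall>j\<ge>J0. \<forall>t. \<bar>t\<bar> * 2 ^ j \<le> s \<longrightarrow> (\<forall>y.
        (\<integral>\<^sup>+x. ennreal \<bar>2 ^ j * (\<Sum>i. a j i (2 ^ j * (x + t)) * a j i (2 ^ j * y))
          - 2 ^ j * (\<Sum>i. a j i (2 ^ j * x) * a j i (2 ^ j * y))\<bar> \<partial>lborel) \<le> ennreal e)"
    proof (intro exI[of _ s] conjI allI impI s(1))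
      fix j :: nat and t y :: real assume j: "J0 \<le> j" and t: "\<bar>t\<bar> * 2 ^ j \<le> s"
      note [measurable] = am[OF j]
      have mod: "(\<integral>\<^sup>+x. ennreal \<bar>a j i (x + 2 ^ j * t) - a j i x\<bar> \<partial>lborel) \<le> ennreal e'" for i
      proof -
        obtain \<alpha> r where \<alpha>: "\<alpha> \<in> A" "a j i = (\<lambda>u. \<alpha> (u - r))" using a[OF j] by blast
        have [measurable]: "\<alpha> \<in> borel_measurable borel" using A(2)[OF \<alpha>(1)] by auto
        have "(\<integral>\<^sup>+x. ennreal \<bar>a j i (x + 2 ^ j * t) - a j i x\<bar> \<partial>lborel) =
            (\<integral>\<^sup>+x. ennreal \<bar>\<alpha> (x + 2 ^ j * t) - \<alpha> x\<bar> \<partial>lborel)"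
          using nn_integral_real_affine[of "\<lambda>x. ennreal \<bar>\<alpha> (x + 2 ^ j * t) - \<alpha> x\<bar>" 1 "-r"]
          by (simp add: \<alpha> algebra_simps)
        also have "\<dots> \<le> ennreal e'"
          using t s(2)[OF \<alpha>(1)] by (intro S(2) \<alpha>) (simp add: abs_mult mult.commute)
        finally show ?thesis .
      qed
      have "(\<integral>\<^sup>+x. ennreal \<bar>2 ^ j * (\<Sum>i. a j i (2 ^ j * (x + t)) * a j i (2 ^ j * y))
          - 2 ^ j * (\<Sum>i. a j i (2 ^ j * x) * a j i (2 ^ j * y))\<bar> \<partial>lborel) \<le>
        (\<integral>\<^sup>+x. (\<Sum>i. ennreal \<bar>a j i (2 ^ j * y)\<bar> * (ennreal (2 ^ j) * ennreal \<bar>a j i (2 ^ j * x + 2 ^ j * t) - a j i (2 ^ j * x)\<bar>)) \<partial>lborel)"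
      proof (intro nn_integral_mono)
        fix x :: real
        let ?d = "\<lambda>i. (a j i (2 ^ j * x + 2 ^ j * t) - a j i (2 ^ j * x)) * a j i (2 ^ j * y)"
        have eq: "2 ^ j * (\<Sum>i. a j i (2 ^ j * (x + t)) * a j i (2 ^ j * y))
          - 2 ^ j * (\<Sum>i. a j i (2 ^ j * x) * a j i (2 ^ j * y)) = 2 ^ j * (\<Sum>i. ?d i)"
          using suminf_diff[OF prod'[OF j] prod'[OF j], of "2 ^ j * x + 2 ^ j * t" "2 ^ j * y" "2 ^ j * x" "2 ^ j * y"]
          by (simp add: algebra_simps)
        have sd: "summable (\<lambda>i. \<bar>?d i\<bar>)"
          using summable_add[OF prod[OF j, of "2 ^ j * x + 2 ^ j * t" "2 ^ j * y"] prod[OF j, of "2 ^ j * x" "2 ^ j * y"]]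
          by (rule summable_comparison_test[rotated])
            (auto simp: abs_mult simp flip: distrib_right intro!: mult_right_mono)
        have "\<bar>2 ^ j * (\<Sum>i. ?d i)\<bar> \<le> 2 ^ j * (\<Sum>i. \<bar>?d i\<bar>)"
          using summable_rabs[OF sd] by (simp add: abs_mult)
        then show "ennreal \<bar>2 ^ j * (\<Sum>i. a j i (2 ^ j * (x + t)) * a j i (2 ^ j * y))
          - 2 ^ j * (\<Sum>i. a j i (2 ^ j * x) * a j i (2 ^ j * y))\<bar> \<le>
          (\<Sum>i. ennreal \<bar>a j i (2 ^ j * y)\<bar> * (ennreal (2 ^ j) * ennreal \<bar>a j i (2 ^ j * x + 2 ^ j * t) - a j i (2 ^ j * x)\<bar>))"
          unfolding eq using summable_mult[OF sd, of "2 ^ j"] sd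
          by (simp add: ennreal_mult[symmetric] suminf_ennreal2 abs_mult ac_simps suminf_mult ennreal_leI)
      qed
      also have "\<dots> = (\<Sum>i. ennreal \<bar>a j i (2 ^ j * y)\<bar> *
          (\<integral>\<^sup>+x. ennreal (2 ^ j) * ennreal \<bar>a j i (2 ^ j * x + 2 ^ j * t) - a j i (2 ^ j * x)\<bar> \<partial>lborel))"
        by (subst nn_integral_suminf) (auto simp: nn_integral_cmult)
      also have "\<dots> \<le> (\<Sum>i. ennreal \<bar>a j i (2 ^ j * y)\<bar> * ennreal e')"
        using mod nn_integral_dilate[of "\<lambda>x. ennreal \<bar>a j _ (x + 2 ^ j * t) - a j _ x\<bar>" j]
        by (intro suminf_le mult_left_mono) auto
      also have "\<dots> = (\<Sum>i. ennreal \<bar>a j i (2 ^ j * y)\<bar>) * ennreal e'" by (rule ennreal_suminf_multc)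
      also have "\<dots> \<le> ennreal B * ennreal e'" by (intro mult_right_mono sumB j) simp
      also have "\<dots> = ennreal (B * e')" using B0 e' by (simp add: ennreal_mult)
      also have "\<dots> \<le> ennreal e"
        using B0 e by (intro ennreal_leI) (simp add: e'_def field_simps)
      finally show "(\<integral>\<^sup>+x. ennreal \<bar>2 ^ j * (\<Sum>i. a j i (2 ^ j * (x + t)) * a j i (2 ^ j * y))
          - 2 ^ j * (\<Sum>i. a j i (2 ^ j * x) * a j i (2 ^ j * y))\<bar> \<partial>lborel) \<le> ennreal e" .
    qed
  qed (use eq in auto)
qed

text \<open>Rewrites an unordered sum over a set of integers as a series over the naturals padded
  with zeros, the form in which measurability of the sum and \<open>nn_integral_suminf\<close>
  apply.\<close>

lemma suminf_int_decode:
  fixes g :: "int \<Rightarrow> real"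
  assumes "(\<lambda>k. \<bar>g k\<bar>) summable_on S"
  defines "g' \<equiv> (\<lambda>i. if int_decode i \<in> S then g (int_decode i) else 0)"
  shows "summable (\<lambda>i. \<bar>g' i\<bar>)" "(\<Sum>i. g' i) = infsum g S"
proof -
  have bij: "bij_betw int_decode UNIV UNIV" by (rule bij_int_decode)
  let ?g = "\<lambda>k. if k \<in> S then g k else 0"
  have abs: "(\<lambda>k. norm (?g k)) summable_on UNIV"
  proof -
    have "(\<lambda>k. \<bar>g k\<bar>) summable_on S \<longleftrightarrow> (\<lambda>k. norm (?g k)) summable_on UNIV"
      by (rule summable_on_cong_neutral) auto
    then show ?thesis using assms(1) by blast
  qed
  then have "(\<lambda>i. norm (?g (int_decode i))) summable_on UNIV"
    using summable_on_reindex_bij_betw[OF bij, of "\<lambda>k. norm (?g k)"] by simp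
  then have s: "(\<lambda>i. norm (g' i)) summable_on UNIV" by (simp add: g'_def)
  then show 1: "summable (\<lambda>i. \<bar>g' i\<bar>)" using summable_on_imp_summable[of "\<lambda>i. norm (g' i)"] by simp
  have "(\<Sum>i. g' i) = infsum g' UNIV"
    using norm_summable_imp_has_sum[of g' "suminf g'"] 1 summable_sums[OF summable_rabs_cancel[OF 1]]
    by (simp add: infsumI)
  also have "\<dots> = infsum ?g UNIV"
    using infsum_reindex_bij_betw[OF bij, of ?g] by (simp add: g'_def)
  also have "\<dots> = infsum g S" by (rule infsum_cong_neutral) auto
  finally show "(\<Sum>i. g' i) = infsum g S" .
qed

lemma translation_regular_multiresolution:
  assumes T: "T \<in> sets borel" and K: "multiresolution_kernel \<kappa>"
    and eq: "\<And>j x y. x \<in> T \<Longrightarrow> y \<in> T \<Longrightarrow> K j x y = dilated_kernel \<kappa> j x y"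
  shows "translation_regular T J0 K"
proof -
  obtain S \<phi> B where \<kappa>: "\<And>x y. \<kappa> x y = (\<Sum>\<^sub>\<infinity>k\<in>S. \<phi> (x - of_int k) * \<phi> (y - of_int k))"
    and \<phi>: "integrable lborel \<phi>"
    and B: "\<And>x. (\<lambda>k. \<bar>\<phi> (x - of_int k)\<bar>) summable_on S" "\<And>x. (\<Sum>\<^sub>\<infinity>k\<in>S. \<bar>\<phi> (x - of_int k)\<bar>) \<le> B"
    using K unfolding multiresolution_kernel_def by blast
  \<comment> \<open>Indices outside \<open>S\<close> give the zero function, hence the profile
    \<open>\<lambda>_. 0\<close> next to \<open>\<phi>\<close> below.\<close>
  define a where "a = (\<lambda>(j::nat) i z. if int_decode i \<in> S then \<phi> (z - of_int (int_decode i)) else 0)"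
  have bd: "\<bar>\<phi> (x - of_int k)\<bar> \<le> B" if "k \<in> S" for x k
  proof -
    have "(\<Sum>\<^sub>\<infinity>k\<in>{k}. \<bar>\<phi> (x - of_int k)\<bar>) \<le> (\<Sum>\<^sub>\<infinity>k\<in>S. \<bar>\<phi> (x - of_int k)\<bar>)"
      using that B(1) by (intro infsum_mono_neutral) auto
    then show ?thesis using B(2)[of x] by simp
  qed
  show ?thesis
  proof (rule translation_regular_frame[OF T, where a = a and A = "{\<phi>, \<lambda>_. 0}" and B = B])
    fix j i :: nat
    show "\<exists>\<alpha>\<in>{\<phi>, \<lambda>_. 0}. \<exists>s. a j i = (\<lambda>u. \<alpha> (u - s))"
      by (auto simp: a_def fun_eq_iff)
  next
    fix j :: nat and z :: real
    have *: "a j i z = (if int_decode i \<in> S then \<phi> (z - of_int (int_decode i)) else 0)" for i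
      by (simp add: a_def)
    have **: "\<bar>a j i z\<bar> = (if int_decode i \<in> S then \<bar>\<phi> (z - of_int (int_decode i))\<bar> else 0)" for i
      by (simp add: a_def)
    show "summable (\<lambda>i. \<bar>a j i z\<bar>)" unfolding * by (rule suminf_int_decode(1)) (rule B)
    have "(\<lambda>k. \<bar>\<bar>\<phi> (z - of_int k)\<bar>\<bar>) summable_on S" using B(1) by simp
    from suminf_int_decode(2)[OF this] show "(\<Sum>i. \<bar>a j i z\<bar>) \<le> B" using B(2)[of z] unfolding ** by simp
  next
    fix j :: nat and x y :: real assume xy: "x \<in> T" "y \<in> T"
    have "(\<lambda>k. \<bar>\<phi> (2 ^ j * x - of_int k) * \<phi> (2 ^ j * y - of_int k)\<bar>) summable_on S"
      by (rule summable_on_comparison_test[OF summable_on_cmult_right[OF B(1)[of "2 ^ j * y"], of B]])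
        (auto simp: abs_mult intro!: mult_right_mono bd)
    from suminf_int_decode(2)[OF this]
    have "(\<Sum>i. a j i (2 ^ j * x) * a j i (2 ^ j * y)) = \<kappa> (2 ^ j * x) (2 ^ j * y)"
      unfolding \<kappa> by (subst (asm) eq_commute) (auto simp: a_def intro!: suminf_cong)
    then show "K j x y = 2 ^ j * (\<Sum>i. a j i (2 ^ j * x) * a j i (2 ^ j * y))"
      using xy by (simp add: eq dilated_kernel_def)
  qed (use \<phi> in auto)
qed

section \<open>Boundary-corrected wavelets on the unit interval\<close>

lemma sum_translates_le:
  fixes \<phi> :: "real \<Rightarrow> real"
  assumes supp: "\<And>x. x \<notin> {1 - real N..real N} \<Longrightarrow> \<phi> x = 0" and M: "\<And>x. \<bar>\<phi> x\<bar> \<le> M"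
  shows "(\<Sum>i=m..<n. \<bar>\<phi> (z - real i)\<bar>) \<le> 2 * real N * M"
proof -
  \<comment> \<open>The integers \<open>i\<close> for which \<open>z - i\<close> lies in the support
    interval, whose length is \<open>2 * N - 1\<close>; there are at most \<open>2 * N\<close> of
    them.\<close>
  let ?I = "nat ` {\<lceil>z - N\<rceil>..\<lfloor>z + N - 1\<rfloor>}"
  have M0: "0 \<le> M" using M[of 0] by linarith
  have "(\<Sum>i=m..<n. \<bar>\<phi> (z - real i)\<bar>) = (\<Sum>i\<in>{m..<n} \<inter> ?I. \<bar>\<phi> (z - real i)\<bar>)"
  proof (rule sum.mono_neutral_right)
    show "\<forall>i\<in>{m..<n} - ({m..<n} \<inter> ?I). \<bar>\<phi> (z - real i)\<bar> = 0"
    proof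
      fix i assume i: "i \<in> {m..<n} - ({m..<n} \<inter> ?I)"
      then have "int i \<notin> {\<lceil>z - N\<rceil>..\<lfloor>z + N - 1\<rfloor>}"
        by (metis DiffE IntI image_eqI nat_int)
      then have "z - real i \<notin> {1 - real N..real N}"
        by (simp only: atLeastAtMost_iff ceiling_le_iff le_floor_iff) (simp, linarith)
      then show "\<bar>\<phi> (z - real i)\<bar> = 0" using supp by simp
    qed
  qed auto
  also have "\<dots> \<le> real (card ({m..<n} \<inter> ?I)) * M"
    using M by (intro sum_bounded_above) auto
  also have "\<dots> \<le> real (2 * N) * M"
  proof (intro mult_right_mono M0 of_nat_mono)
    have "card ({m..<n} \<inter> ?I) \<le> card ?I" by (intro card_mono) auto
    also have "\<dots> \<le> card {\<lceil>z - N\<rceil>..\<lfloor>z + N - 1\<rfloor>}" by (intro card_image_le) auto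
    also have "\<dots> \<le> 2 * N" by (simp, linarith)
    finally show "card ({m..<n} \<inter> ?I) \<le> 2 * N" .
  qed
  finally show ?thesis by simp
qed

lemma orthonormalisation_bounded_integrable:
  fixes f :: "nat \<Rightarrow> real \<Rightarrow> real"
  assumes e: "orthonormalisation N f e" and k: "k < N"
    and f: "\<And>l. l < N \<Longrightarrow> integrable lborel (f l)" "\<And>l. l < N \<Longrightarrow> \<exists>M. \<forall>x. \<bar>f l x\<bar> \<le> M"
  shows "integrable lborel (e k)" "\<exists>M. \<forall>x. \<bar>e k x\<bar> \<le> M"
proof -
  obtain A where A: "\<And>x. e k x = (\<Sum>l<N. A k l * f l x)"
    using e k unfolding orthonormalisation_def by blast
  have ek: "e k = (\<lambda>x. \<Sum>l<N. A k l * f l x)" using A by auto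
  show "integrable lborel (e k)" unfolding ek by (auto intro!: f)
  obtain M where M: "\<And>l x. l < N \<Longrightarrow> \<bar>f l x\<bar> \<le> M l" using f(2) by metis
  have "\<bar>e k x\<bar> \<le> (\<Sum>l<N. \<bar>A k l\<bar> * M l)" for x
    unfolding A by (rule order_trans[OF sum_abs]) (auto simp: abs_mult intro!: sum_mono mult_left_mono M)
  then show "\<exists>M. \<forall>x. \<bar>e k x\<bar> \<le> M" by blast
qed

lemma daubechies_scaling_bounded_integrable:
  assumes "daubechies_scaling N \<phi>"
  shows "integrable lborel \<phi>" "\<exists>M. \<forall>x. \<bar>\<phi> x\<bar> \<le> M"
    "\<And>x. x \<notin> {1 - real N..real N} \<Longrightarrow> \<phi> x = 0"
proof -
  show z: "\<And>x. x \<notin> {1 - real N..real N} \<Longrightarrow> \<phi> x = 0"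
    using assms unfolding daubechies_scaling_def by blast
  have [measurable]: "\<phi> \<in> borel_measurable borel" using assms unfolding daubechies_scaling_def by blast
  show b: "\<exists>M. \<forall>x. \<bar>\<phi> x\<bar> \<le> M"
    using assms unfolding daubechies_scaling_def bounded_iff by auto
  then obtain M where M: "\<And>x. \<bar>\<phi> x\<bar> \<le> M" by blast
  show "integrable lborel \<phi>"
  proof (rule Bochner_Integration.integrable_bound)
    show "integrable lborel (\<lambda>x. M * indicat_real {1 - real N..real N} x)"
      by (intro integrable_mult_right integrable_real_indicator) (auto simp: emeasure_lborel_Icc_eq)
    show "AE x in lborel. norm (\<phi> x) \<le> norm (M * indicat_real {1 - real N..real N} x)"
      using M z by (intro AE_I2) (fastforce simp: indicator_def intro: order_trans[OF M])
  qed simp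
qed

lemma cdv_edge_bounded_integrable:
  assumes "daubechies_scaling N \<phi>"
  shows "integrable lborel (cdv_left N \<phi> k)" "\<exists>M. \<forall>x. \<bar>cdv_left N \<phi> k x\<bar> \<le> M"
    "integrable lborel (cdv_right N \<phi> k)" "\<exists>M. \<forall>x. \<bar>cdv_right N \<phi> k x\<bar> \<le> M"
proof -
  note \<phi> = daubechies_scaling_bounded_integrable[OF assms]
  obtain M where M: "\<And>x. \<bar>\<phi> x\<bar> \<le> M" using \<phi>(2) by blast
  have M0: "0 \<le> M" using M[of 0] by linarith
  have int: "integrable lborel (\<lambda>x. \<phi> (x + s))" for s
    using \<phi>(1) by (rule integrable_translate)
  have l: "cdv_left N \<phi> k = (\<lambda>x. indicat_real {0..} x * (\<Sum>n=k..2 * N - 2. real (n choose k) * \<phi> (x + (real n - real N + 1))))"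
    by (auto simp: cdv_left_def fun_eq_iff indicator_def algebra_simps)
  have r: "cdv_right N \<phi> k = (\<lambda>x. indicat_real {..0} x * (\<Sum>n=k..2 * N - 2. real (n choose k) * \<phi> (x + (real N - real n))))"
    by (auto simp: cdv_right_def fun_eq_iff indicator_def algebra_simps)
  show "integrable lborel (cdv_left N \<phi> k)" "integrable lborel (cdv_right N \<phi> k)"
    unfolding l r
    using integrable_real_mult_indicator[of "{0::real..}" lborel] integrable_real_mult_indicator[of "{..0::real}" lborel]
    by (simp_all add: int mult.commute[of "indicat_real _ _"])
  have "\<bar>\<Sum>n=k..2 * N - 2. real (n choose k) * \<phi> (x + s n)\<bar> \<le> (\<Sum>n=k..2 * N - 2. real (n choose k) * M)" for x s
    by (rule order_trans[OF sum_abs]) (auto simp: abs_mult intro!: sum_mono mult_left_mono M)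
  moreover have "0 \<le> (\<Sum>n=k..2 * N - 2. real (n choose k) * M)" using M0 by (intro sum_nonneg) auto
  ultimately show "\<exists>M. \<forall>x. \<bar>cdv_left N \<phi> k x\<bar> \<le> M" "\<exists>M. \<forall>x. \<bar>cdv_right N \<phi> k x\<bar> \<le> M"
    unfolding l r by (auto intro!: exI[of _ "\<Sum>n=k..2 * N - 2. real (n choose k) * M"] simp: indicator_def)
qed

text \<open>The order in which the boundary-corrected basis is numbered: \<open>N\<close> left edge
  functions, the interior translates, \<open>N\<close> right edge functions, with
  \<open>L = 2 ^ j\<close> in total.\<close>

lemma sum_three_blocks:
  fixes f g h :: "nat \<Rightarrow> real"
  assumes "2 * N \<le> L"
  shows "(\<Sum>i<L. if i < N then f i else if i < L - N then g i else h (i - (L - N))) =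
    (\<Sum>i<N. f i) + (\<Sum>i=N..<L - N. g i) + (\<Sum>i<N. h i)"
proof -
  let ?F = "\<lambda>i. if i < N then f i else if i < L - N then g i else h (i - (L - N))"
  have "(\<Sum>i<L. ?F i) = sum ?F {0..<N} + sum ?F {N..<L - N} + sum ?F {L - N..<L}"
    using assms by (simp only: sum.atLeastLessThan_concat lessThan_atLeast0)
  also have "sum ?F {0..<N} = (\<Sum>i<N. f i)" by (simp add: atLeast0LessThan)
  also have "sum ?F {N..<L - N} = (\<Sum>i=N..<L - N. g i)" by (intro sum.cong) auto
  also have "sum ?F {L - N..<L} = (\<Sum>i=0..<N. ?F (i + (L - N)))"
    using assms sum.shift_bounds_nat_ivl[of ?F 0 "L - N" N] by simp
  also have "\<dots> = (\<Sum>i<N. h i)" using assms by (intro sum.cong) auto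
  finally show ?thesis .
qed

lemma translation_regular_cdv:
  assumes T: "T \<in> sets borel" and \<phi>: "daubechies_scaling N \<phi>" and J0: "2 * N \<le> 2 ^ J0"
    and \<phi>0: "orthonormalisation N (cdv_left N \<phi>) \<phi>0"
    and \<phi>1: "orthonormalisation N (cdv_right N \<phi>) \<phi>1"
    and eq: "\<And>j x y. j \<ge> J0 \<Longrightarrow> x \<in> T \<Longrightarrow> y \<in> T \<Longrightarrow> K j x y = cdv_kernel N \<phi> \<phi>0 \<phi>1 j x y"
  shows "translation_regular T J0 K"
proof -
  note p = daubechies_scaling_bounded_integrable[OF \<phi>]
  note e = cdv_edge_bounded_integrable[OF \<phi>]
  note p0 = orthonormalisation_bounded_integrable[OF \<phi>0 _ e(1,2)]
  note p1 = orthonormalisation_bounded_integrable[OF \<phi>1 _ e(3,4)]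
  obtain M where M: "\<And>x. \<bar>\<phi> x\<bar> \<le> M" using p(2) by blast
  obtain M0 where M0: "\<And>k x. k < N \<Longrightarrow> \<bar>\<phi>0 k x\<bar> \<le> M0 k" using p0(2) by metis
  obtain M1 where M1: "\<And>k x. k < N \<Longrightarrow> \<bar>\<phi>1 k x\<bar> \<le> M1 k" using p1(2) by metis
  \<comment> \<open>The right edge functions are attached to the end point 1, which dilation moves
    to \<open>2 ^ j\<close>; indices from \<open>2 ^ j\<close> on are padding.\<close>
  define a where "a = (\<lambda>j i u. if i < N then \<phi>0 i u else if i < 2 ^ j - N then \<phi> (u - real i)
    else if i < 2 ^ j then \<phi>1 (i - (2 ^ j - N)) (u - 2 ^ j) else 0)"
  have L: "2 * N \<le> 2 ^ j" if "j \<ge> J0" for j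
    using J0 power_increasing[OF that, of "2::nat"] by linarith
  \<comment> \<open>Stated for a general \<open>F\<close> with \<open>F 0 0 = 0\<close>, since it
    serves both the sums of absolute values and the products in the kernel.\<close>
  have fin: "(\<Sum>i. F (a j i x) (a j i y)) = (\<Sum>i<N. F (\<phi>0 i x) (\<phi>0 i y)) +
      (\<Sum>i=N..<2 ^ j - N. F (\<phi> (x - real i)) (\<phi> (y - real i))) + (\<Sum>i<N. F (\<phi>1 i (x - 2 ^ j)) (\<phi>1 i (y - 2 ^ j)))"
    and sm: "summable (\<lambda>i. F (a j i x) (a j i y))"
    if "j \<ge> J0" "F 0 0 = 0" for F :: "real \<Rightarrow> real \<Rightarrow> real" and j x y
  proof -
    have "(\<Sum>i. F (a j i x) (a j i y)) = (\<Sum>i<2 ^ j. F (a j i x) (a j i y))"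
      using that L[OF that(1)] by (intro suminf_finite) (auto simp: a_def)
    also have "\<dots> = (\<Sum>i<2 ^ j. if i < N then F (\<phi>0 i x) (\<phi>0 i y) else if i < 2 ^ j - N then F (\<phi> (x - real i)) (\<phi> (y - real i))
        else F (\<phi>1 (i - (2 ^ j - N)) (x - 2 ^ j)) (\<phi>1 (i - (2 ^ j - N)) (y - 2 ^ j)))"
      by (intro sum.cong) (auto simp: a_def)
    finally show "(\<Sum>i. F (a j i x) (a j i y)) = (\<Sum>i<N. F (\<phi>0 i x) (\<phi>0 i y)) +
      (\<Sum>i=N..<2 ^ j - N. F (\<phi> (x - real i)) (\<phi> (y - real i))) + (\<Sum>i<N. F (\<phi>1 i (x - 2 ^ j)) (\<phi>1 i (y - 2 ^ j)))"
      using sum_three_blocks[OF L[OF that(1)], of "\<lambda>i. F (\<phi>0 i x) (\<phi>0 i y)" "\<lambda>i. F (\<phi> (x - real i)) (\<phi> (y - real i))"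
          "\<lambda>i. F (\<phi>1 i (x - 2 ^ j)) (\<phi>1 i (y - 2 ^ j))"] by simp
    show "summable (\<lambda>i. F (a j i x) (a j i y))"
      using that L[OF that(1)] by (intro summable_finite[of "{..<2 ^ j}"]) (auto simp: a_def)
  qed
  show ?thesis
  proof (rule translation_regular_frame[OF T, where a = a and A = "{\<phi>, \<lambda>_. 0} \<union> \<phi>0 ` {..<N} \<union> \<phi>1 ` {..<N}"
        and B = "(\<Sum>k<N. M0 k) + 2 * real N * M + (\<Sum>k<N. M1 k)"])
    fix j i :: nat assume "J0 \<le> j"
    note L = L[OF this]
    consider "i < N" | "N \<le> i" "i < 2 ^ j - N" | "N \<le> i" "2 ^ j - N \<le> i" "i < 2 ^ j" | "2 ^ j \<le> i" "N \<le> i"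
      using L by linarith
    then show "\<exists>\<alpha>\<in>{\<phi>, \<lambda>_. 0} \<union> \<phi>0 ` {..<N} \<union> \<phi>1 ` {..<N}. \<exists>s. a j i = (\<lambda>u. \<alpha> (u - s))"
    proof cases
      case 1
      then show ?thesis by (intro bexI[of _ "\<phi>0 i"] exI[of _ 0]) (auto simp: a_def)
    next
      case 2
      then show ?thesis by (intro bexI[of _ \<phi>] exI[of _ "real i"]) (auto simp: a_def)
    next
      case 3
      then show ?thesis by (intro bexI[of _ "\<phi>1 (i - (2 ^ j - N))"] exI[of _ "2 ^ j"]) (auto simp: a_def)
    next
      case 4
      then show ?thesis by (intro bexI[of _ "\<lambda>_. 0"]) (auto simp: a_def)
    qed
  next
    fix j z assume j: "J0 \<le> j"
    show "summable (\<lambda>i. \<bar>a j i z\<bar>)" using sm[OF j, of "\<lambda>u v. \<bar>u\<bar>"] by simp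
    have "(\<Sum>i=N..<2 ^ j - N. \<bar>\<phi> (z - real i)\<bar>) \<le> 2 * real N * M"
      by (rule sum_translates_le) (use p(3) M in auto)
    then show "(\<Sum>i. \<bar>a j i z\<bar>) \<le> (\<Sum>k<N. M0 k) + 2 * real N * M + (\<Sum>k<N. M1 k)"
      using fin[OF j, of "\<lambda>u v. \<bar>u\<bar>" z] 
        sum_mono[of "{..<N}" "\<lambda>k. \<bar>\<phi>0 k z\<bar>" M0] sum_mono[of "{..<N}" "\<lambda>k. \<bar>\<phi>1 k (z - 2 ^ j)\<bar>" M1] M0 M1
      by simp
  next
    fix j x y assume j: "J0 \<le> j" and xy: "x \<in> T" "y \<in> T"
    have pw: "(2::real) powr (real j / 2) * 2 powr (real j / 2) = 2 ^ j"
      by (simp add: powr_realpow flip: powr_add)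
    have pw': "2 powr (real j / 2) * u * (2 powr (real j / 2) * v) = 2 ^ j * (u * v)" for u v :: real
      using pw by (simp add: mult_ac)
    show "K j x y = 2 ^ j * (\<Sum>i. a j i (2 ^ j * x) * a j i (2 ^ j * y))"
      unfolding eq[OF j xy] cdv_kernel_def Let_def pw' fin[OF j, of "(*)", simplified]
      by (simp add: sum_distrib_left distrib_left right_diff_distrib)
  qed (use p(1) p0(1) p1(1) in auto)
qed

lemma admissible_imp_translation_regular:
  assumes T: "T = {0..1} \<or> T = UNIV" and K: "admissible T J0 K"
  shows "translation_regular T J0 K"
proof -
  have Tb: "T \<in> sets borel" using T by auto
  from K show ?thesis
    unfolding admissible_def
    using translation_regular_convolution[OF Tb, of _ K] translation_regular_multiresolution[OF Tb, of _ K]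
      translation_regular_cdv[OF Tb, of _ _ J0 _ _ K]
    by (elim disjE exE conjE) blast+
qed

section \<open>Averages over cells\<close>

lemma nn_integral_translate:
  fixes f :: "real \<Rightarrow> ennreal"
  assumes [measurable]: "f \<in> borel_measurable borel"
  shows "(\<integral>\<^sup>+x. f (x + t) \<partial>lborel) = (\<integral>\<^sup>+x. f x \<partial>lborel)"
  using nn_integral_real_affine[of f 1 t] by (simp add: add.commute)

text \<open>\<open>h (x + t) - h x\<close> is compared with \<open>kh (x + t) - kh x\<close>. The
  approximation errors at \<open>x\<close> and at \<open>x + t\<close> contribute at most
  \<open>E\<close> each. The difference of \<open>kh\<close> is an integral operator applied to
  \<open>h\<close> with rows at most \<open>2 * C\<close> and columns at most \<open>e\<close>, so
  Schur's test applies. The bound \<open>b\<close> makes \<open>kh\<close> a genuine integral, which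
  the linearity used for this difference requires.\<close>

lemma modulus_of_continuity_le:
  fixes k :: "real \<Rightarrow> real \<Rightarrow> real" and h :: "real \<Rightarrow> real"
  defines "kh \<equiv> \<lambda>x. \<integral>y. k x y * h y \<partial>lborel"
  assumes [measurable]: "T \<in> sets borel" "h \<in> borel_measurable borel"
    and k [measurable]: "(\<lambda>(x, y). k x y) \<in> borel_measurable (borel \<Otimes>\<^sub>M borel)"
    and b: "AE x in lborel. \<bar>h x\<bar> \<le> b" and r: "1 < r" and C: "0 < C" and e: "0 < e"
    and row: "\<And>x. (\<integral>\<^sup>+y. ennreal \<bar>k x y\<bar> \<partial>lborel) \<le> ennreal C"
    and col: "\<And>y. (\<integral>\<^sup>+x\<in>{x \<in> T. x + t \<in> T}. ennreal \<bar>k (x + t) y - k x y\<bar> \<partial>lborel) \<le> ennreal e"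
    and E: "(\<integral>\<^sup>+x\<in>T. ennreal (\<bar>kh x - h x\<bar> powr r) \<partial>lborel) \<le> ennreal E" "0 \<le> E"
    and I: "(\<integral>\<^sup>+x. ennreal (\<bar>h x\<bar> powr r) \<partial>lborel) \<le> ennreal I" "0 \<le> I"
  shows "(\<integral>\<^sup>+x\<in>{x \<in> T. x + t \<in> T}. ennreal (\<bar>h (x + t) - h x\<bar> powr r) \<partial>lborel) \<le>
    ennreal (4 powr (r - 1) * (2 * E + (2 * C) powr (r - 1) * e * I))"
proof -
  define D where "D = {x \<in> T. x + t \<in> T}"
  have [measurable]: "D \<in> sets borel" unfolding D_def by measurable
  have kx [measurable]: "k x \<in> borel_measurable borel" for x
    using measurable_compose[OF measurable_Pair1' k, of x] by simp
  have [measurable]: "kh \<in> borel_measurable borel" unfolding kh_def by measurable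
  have kint: "integrable lborel (k x)" for x
    using row[of x] by (intro integrableI_bounded) (auto intro: le_less_trans)
  have int: "integrable lborel (\<lambda>y. k x y * h y)" for x
  proof (rule Bochner_Integration.integrable_bound[where f = "\<lambda>y. b * \<bar>k x y\<bar>"])
    show "AE y in lborel. norm (k x y * h y) \<le> norm (b * \<bar>k x y\<bar>)"
      using b
    proof eventually_elim
      case (elim y)
      then have "\<bar>k x y\<bar> * \<bar>h y\<bar> \<le> \<bar>k x y\<bar> * \<bar>b\<bar>" by (intro mult_left_mono) auto
      then show ?case by (simp add: abs_mult mult.commute)
    qed
  qed (use kint in auto)
  define g where "g = (\<lambda>x y. indicat_real D x * (k (x + t) y - k x y))"
  have gh: "(\<integral>y. g x y * h y \<partial>lborel) = indicat_real D x * (kh (x + t) - kh x)" for x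
  proof -
    have "(\<integral>y. g x y * h y \<partial>lborel) = (\<integral>y. indicat_real D x * (k (x + t) y * h y - k x y * h y) \<partial>lborel)"
      by (intro Bochner_Integration.integral_cong) (auto simp: g_def algebra_simps)
    then show ?thesis by (simp add: kh_def int)
  qed
  have "(\<integral>\<^sup>+x. ennreal (\<bar>\<integral>y. g x y * h y \<partial>lborel\<bar> powr r) \<partial>lborel) \<le>
    ennreal ((2 * C) powr (r - 1)) * ennreal e * (\<integral>\<^sup>+y. ennreal (\<bar>h y\<bar> powr r) \<partial>lborel)"
  proof (rule nn_integral_kernel_powr_le)
    show "(\<lambda>(x, y). g x y) \<in> borel_measurable (borel \<Otimes>\<^sub>M borel)" unfolding g_def by measurable
    show "(\<integral>\<^sup>+y. ennreal \<bar>g x y\<bar> \<partial>lborel) \<le> ennreal (2 * C)" for x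
    proof -
      have "(\<integral>\<^sup>+y. ennreal \<bar>g x y\<bar> \<partial>lborel) \<le> (\<integral>\<^sup>+y. ennreal \<bar>k (x + t) y\<bar> + ennreal \<bar>k x y\<bar> \<partial>lborel)"
        by (intro nn_integral_mono) (auto simp: g_def indicator_def abs_mult simp flip: ennreal_plus intro!: ennreal_leI)
      also have "\<dots> \<le> ennreal C + ennreal C"
        by (subst nn_integral_add) (auto intro!: add_mono row)
      finally show ?thesis using C by (simp flip: ennreal_plus)
    qed
    show "(\<integral>\<^sup>+x. ennreal \<bar>g x y\<bar> \<partial>lborel) \<le> ennreal e" for y
    proof -
      have "(\<integral>\<^sup>+x. ennreal \<bar>g x y\<bar> \<partial>lborel) = (\<integral>\<^sup>+x\<in>{x \<in> T. x + t \<in> T}. ennreal \<bar>k (x + t) y - k x y\<bar> \<partial>lborel)"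
        by (intro nn_integral_cong) (auto simp: g_def D_def indicator_def)
      then show ?thesis using col[of y] by simp
    qed
  qed (use r C in auto)
  also have "\<dots> \<le> ennreal ((2 * C) powr (r - 1)) * ennreal e * ennreal I"
    by (intro mult_left_mono I) auto
  also have "\<dots> = ennreal ((2 * C) powr (r - 1) * e * I)" using e I by (simp add: ennreal_mult)
  finally have g_le: "(\<integral>\<^sup>+x. ennreal (\<bar>indicat_real D x * (kh (x + t) - kh x)\<bar> powr r) \<partial>lborel) \<le>
      ennreal ((2 * C) powr (r - 1) * e * I)" unfolding gh .
  let ?E = "\<lambda>x. ennreal (\<bar>kh x - h x\<bar> powr r) * indicator T x"
  have "(\<integral>\<^sup>+x\<in>{x \<in> T. x + t \<in> T}. ennreal (\<bar>h (x + t) - h x\<bar> powr r) \<partial>lborel) \<le>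
      (\<integral>\<^sup>+x. ennreal (4 powr (r - 1)) * ((?E (x + t) + ?E x) + ennreal (\<bar>indicat_real D x * (kh (x + t) - kh x)\<bar> powr r)) \<partial>lborel)"
  proof (intro nn_integral_mono)
    fix x :: real
    show "ennreal (\<bar>h (x + t) - h x\<bar> powr r) * indicator {x \<in> T. x + t \<in> T} x \<le>
      ennreal (4 powr (r - 1)) * ((?E (x + t) + ?E x) + ennreal (\<bar>indicat_real D x * (kh (x + t) - kh x)\<bar> powr r))"
    proof (cases "x \<in> D")
      case True
      have "\<bar>h (x + t) - h x\<bar> powr r \<le> (\<bar>kh (x + t) - h (x + t)\<bar> + \<bar>kh x - h x\<bar> + \<bar>kh (x + t) - kh x\<bar>) powr r"
        using r by (intro powr_mono2) auto
      also have "\<dots> \<le> 4 powr (r - 1) * (\<bar>kh (x + t) - h (x + t)\<bar> powr r + \<bar>kh x - h x\<bar> powr r + \<bar>kh (x + t) - kh x\<bar> powr r)"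
        using r by (intro powr_add3_le) auto
      finally show ?thesis using True by (simp add: D_def ennreal_mult[symmetric] ennreal_plus[symmetric] ennreal_leI del: ennreal_plus)
    qed (auto simp: D_def)
  qed
  also have "\<dots> = ennreal (4 powr (r - 1)) * ((\<integral>\<^sup>+x. ?E (x + t) \<partial>lborel) + (\<integral>\<^sup>+x. ?E x \<partial>lborel) +
      (\<integral>\<^sup>+x. ennreal (\<bar>indicat_real D x * (kh (x + t) - kh x)\<bar> powr r) \<partial>lborel))"
    by (simp add: nn_integral_cmult nn_integral_add)
  also have "(\<integral>\<^sup>+x. ?E (x + t) \<partial>lborel) = (\<integral>\<^sup>+x. ?E x \<partial>lborel)"
    by (rule nn_integral_translate) measurable
  also have "ennreal (4 powr (r - 1)) * ((\<integral>\<^sup>+x. ?E x \<partial>lborel) + (\<integral>\<^sup>+x. ?E x \<partial>lborel) +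
      (\<integral>\<^sup>+x. ennreal (\<bar>indicat_real D x * (kh (x + t) - kh x)\<bar> powr r) \<partial>lborel)) \<le>
    ennreal (4 powr (r - 1)) * ((ennreal E + ennreal E) + ennreal ((2 * C) powr (r - 1) * e * I))"
    by (intro mult_left_mono add_mono E g_le) auto
  also have "\<dots> = ennreal (4 powr (r - 1) * (2 * E + (2 * C) powr (r - 1) * e * I))"
    using E(2) I(2) e by (simp add: ennreal_mult[symmetric] ennreal_plus[symmetric] del: ennreal_plus)
  finally show ?thesis .
qed

section \<open>Cells of length 1 / d and the mass seen by cell averages\<close>

definition cell :: "nat \<Rightarrow> int \<Rightarrow> real set" where
  "cell d k = {x. \<lfloor>real d * x\<rfloor> = k}"

lemma cell_measurable [measurable]: "cell d k \<in> sets borel"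
proof -
  have "cell d k = (\<lambda>x. \<lfloor>real d * x\<rfloor>) -` {k} \<inter> space borel" by (auto simp: cell_def)
  also have "\<dots> \<in> sets borel" by (rule measurable_sets[of _ borel "count_space UNIV"]) auto
  finally show ?thesis .
qed

lemma cell_eq: "0 < d \<Longrightarrow> cell d k = {of_int k / real d..<(of_int k + 1) / real d}"
  by (auto simp: cell_def floor_eq_iff field_simps)

lemma emeasure_cell: "0 < d \<Longrightarrow> emeasure lborel (cell d k) = ennreal (1 / real d)"
  by (simp add: cell_eq divide_right_mono diff_divide_distrib[symmetric])

text \<open>On a cell, \<open>h x\<close> differs from the average of \<open>h\<close> by a mean of
  the differences \<open>h x - h y\<close>. Jensen turns these into a double integral over pairs in
  a common cell, hence at distance at most \<open>1 / d\<close>; substituting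
  \<open>y = x + t\<close> and exchanging the integrals leaves only translation differences.\<close>

lemma cell_approximation:
  fixes h :: "real \<Rightarrow> real"
  assumes d: "0 < d" and r: "1 < r" and [measurable]: "T \<in> sets borel" and h: "integrable lborel h"
    and F: "finite F" "\<And>k. k \<in> F \<Longrightarrow> cell d k \<subseteq> T"
    and E: "\<And>t. \<bar>t\<bar> \<le> 1 / real d \<Longrightarrow>
      (\<integral>\<^sup>+x\<in>{x \<in> T. x + t \<in> T}. ennreal (\<bar>h (x + t) - h x\<bar> powr r) \<partial>lborel) \<le> ennreal E" and E0: "0 \<le> E"
  shows "(\<integral>\<^sup>+x\<in>(\<Union>k\<in>F. cell d k). ennreal (\<bar>h x\<bar> powr r) \<partial>lborel) \<le>
    ennreal (2 powr (r - 1) * (real d powr (r - 1) * (\<Sum>k\<in>F. \<bar>\<integral>x. indicat_real (cell d k) x * h x \<partial>lborel\<bar> powr r) + 2 * E))"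
proof -
  have [measurable]: "h \<in> borel_measurable borel" using h by auto
  let ?\<Delta> = "\<lambda>k. \<integral>x. indicat_real (cell d k) x * h x \<partial>lborel"
  have hi: "integrable lborel (\<lambda>x. indicat_real (cell d k) x * h x)" for k
    using integrable_real_mult_indicator[OF _ h, of "cell d k"] by (simp add: mult.commute)
  have ind: "integrable lborel (indicat_real (cell d k))" "measure lborel (cell d k) = 1 / real d" for k
    using emeasure_cell[OF d, of k] by (auto simp: measure_def intro!: integrable_real_indicator)
  have pointwise: "ennreal (\<bar>h x\<bar> powr r) \<le> ennreal (2 powr (r - 1)) * (ennreal (\<bar>real d * ?\<Delta> k\<bar> powr r) +
      (\<integral>\<^sup>+y. ennreal (real d) * (indicator (cell d k) y * ennreal (\<bar>h y - h x\<bar> powr r)) \<partial>lborel))" for x k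
  proof -
    have "\<bar>h x - real d * ?\<Delta> k\<bar> = \<bar>\<integral>y. real d * indicat_real (cell d k) y * (h x - h y) \<partial>lborel\<bar>"
    proof -
      have "(\<integral>y. real d * indicat_real (cell d k) y * (h x - h y) \<partial>lborel) =
        (\<integral>y. h x * real d * indicat_real (cell d k) y - real d * (indicat_real (cell d k) y * h y) \<partial>lborel)"
        by (intro Bochner_Integration.integral_cong) (auto simp: algebra_simps)
      also have "\<dots> = h x - real d * ?\<Delta> k"
        using d by (subst Bochner_Integration.integral_diff) (auto simp: ind hi)
      finally show ?thesis by simp
    qed
    also have "\<dots> \<le> (\<integral>y. (real d * indicat_real (cell d k) y) * \<bar>h y - h x\<bar> \<partial>lborel)"
      using integral_abs_bound[of lborel "\<lambda>y. real d * indicat_real (cell d k) y * (h x - h y)"]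
      by (simp add: abs_mult abs_minus_commute)
    finally have "ennreal (\<bar>h x - real d * ?\<Delta> k\<bar> powr r) \<le>
        ennreal ((\<integral>y. (real d * indicat_real (cell d k) y) * \<bar>h y - h x\<bar> \<partial>lborel) powr r)"
      using r by (intro ennreal_leI powr_mono2) auto
    also have "\<dots> \<le> ennreal (1 powr (r - 1)) * (\<integral>\<^sup>+y. ennreal (real d * indicat_real (cell d k) y * \<bar>h y - h x\<bar> powr r) \<partial>lborel)"
    proof (rule integral_powr_le)
      have "(\<integral>\<^sup>+y. ennreal (real d * indicat_real (cell d k) y) \<partial>lborel) = ennreal (real d) * emeasure lborel (cell d k)"
        by (simp add: ennreal_mult nn_integral_cmult ennreal_indicator)
      also have "\<dots> = ennreal 1" using d by (simp add: emeasure_cell flip: ennreal_mult)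
      finally show "(\<integral>\<^sup>+y. ennreal (real d * indicat_real (cell d k) y) \<partial>lborel) \<le> ennreal 1" by simp
    qed (use r in auto)
    also have "\<dots> = (\<integral>\<^sup>+y. ennreal (real d) * (indicator (cell d k) y * ennreal (\<bar>h y - h x\<bar> powr r)) \<partial>lborel)"
      by (auto intro!: nn_integral_cong simp: ennreal_mult ennreal_indicator mult.assoc)
    finally have 1: "ennreal (\<bar>h x - real d * ?\<Delta> k\<bar> powr r) \<le>
        (\<integral>\<^sup>+y. ennreal (real d) * (indicator (cell d k) y * ennreal (\<bar>h y - h x\<bar> powr r)) \<partial>lborel)" .
    have "\<bar>h x\<bar> powr r \<le> (\<bar>real d * ?\<Delta> k\<bar> + \<bar>h x - real d * ?\<Delta> k\<bar>) powr r"
      using r by (intro powr_mono2) auto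
    also have "\<dots> \<le> 2 powr (r - 1) * (\<bar>real d * ?\<Delta> k\<bar> powr r + \<bar>h x - real d * ?\<Delta> k\<bar> powr r)"
      using r by (intro powr_add_le) auto
    finally have "ennreal (\<bar>h x\<bar> powr r) \<le> ennreal (2 powr (r - 1)) * (ennreal (\<bar>real d * ?\<Delta> k\<bar> powr r) + ennreal (\<bar>h x - real d * ?\<Delta> k\<bar> powr r))"
      by (simp add: ennreal_mult[symmetric] ennreal_plus[symmetric] ennreal_leI del: ennreal_plus)
    also have "\<dots> \<le> ennreal (2 powr (r - 1)) * (ennreal (\<bar>real d * ?\<Delta> k\<bar> powr r) +
      (\<integral>\<^sup>+y. ennreal (real d) * (indicator (cell d k) y * ennreal (\<bar>h y - h x\<bar> powr r)) \<partial>lborel))"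
      by (intro mult_left_mono add_left_mono 1) auto
    finally show ?thesis .
  qed
  have ind_sum: "indicator (\<Union>k\<in>F. cell d k) x = (\<Sum>k\<in>F. indicator (cell d k) x :: ennreal)" for x
    by (rule indicator_UN_disjoint[symmetric, THEN sym]) (use F(1) in \<open>auto simp: disjoint_family_on_def cell_def\<close>)
  have "(\<integral>\<^sup>+x\<in>(\<Union>k\<in>F. cell d k). ennreal (\<bar>h x\<bar> powr r) \<partial>lborel) =
      (\<Sum>k\<in>F. \<integral>\<^sup>+x. indicator (cell d k) x * ennreal (\<bar>h x\<bar> powr r) \<partial>lborel)"
    unfolding ind_sum by (subst nn_integral_sum[symmetric]) (auto simp: sum_distrib_right mult.commute sum_distrib_left)
  also have "\<dots> \<le> (\<Sum>k\<in>F. \<integral>\<^sup>+x. indicator (cell d k) x * (ennreal (2 powr (r - 1)) * (ennreal (\<bar>real d * ?\<Delta> k\<bar> powr r) +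
      (\<integral>\<^sup>+y. ennreal (real d) * (indicator (cell d k) y * ennreal (\<bar>h y - h x\<bar> powr r)) \<partial>lborel))) \<partial>lborel)"
    by (intro sum_mono nn_integral_mono mult_left_mono pointwise) auto
  also have "\<dots> = (\<Sum>k\<in>F. ennreal (2 powr (r - 1)) * (ennreal (\<bar>real d * ?\<Delta> k\<bar> powr r) * ennreal (1 / real d) +
      ennreal (real d) * (\<integral>\<^sup>+x. (\<integral>\<^sup>+y. indicator (cell d k) x * indicator (cell d k) y * ennreal (\<bar>h y - h x\<bar> powr r) \<partial>lborel) \<partial>lborel)))"
  proof (intro sum.cong refl)
    fix k
    have "(\<integral>\<^sup>+x. indicator (cell d k) x * (ennreal (2 powr (r - 1)) * (ennreal (\<bar>real d * ?\<Delta> k\<bar> powr r) +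
      (\<integral>\<^sup>+y. ennreal (real d) * (indicator (cell d k) y * ennreal (\<bar>h y - h x\<bar> powr r)) \<partial>lborel))) \<partial>lborel) =
     (\<integral>\<^sup>+x. ennreal (2 powr (r - 1)) * (ennreal (\<bar>real d * ?\<Delta> k\<bar> powr r) * indicator (cell d k) x +
      ennreal (real d) * (\<integral>\<^sup>+y. indicator (cell d k) x * indicator (cell d k) y * ennreal (\<bar>h y - h x\<bar> powr r) \<partial>lborel)) \<partial>lborel)"
      by (intro nn_integral_cong) (auto simp: nn_integral_cmult indicator_def)
    then show "(\<integral>\<^sup>+x. indicator (cell d k) x * (ennreal (2 powr (r - 1)) * (ennreal (\<bar>real d * ?\<Delta> k\<bar> powr r) +
      (\<integral>\<^sup>+y. ennreal (real d) * (indicator (cell d k) y * ennreal (\<bar>h y - h x\<bar> powr r)) \<partial>lborel))) \<partial>lborel) =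
      ennreal (2 powr (r - 1)) * (ennreal (\<bar>real d * ?\<Delta> k\<bar> powr r) * ennreal (1 / real d) +
      ennreal (real d) * (\<integral>\<^sup>+x. (\<integral>\<^sup>+y. indicator (cell d k) x * indicator (cell d k) y * ennreal (\<bar>h y - h x\<bar> powr r) \<partial>lborel) \<partial>lborel))"
      using emeasure_cell[OF d, of k] by (simp add: nn_integral_cmult nn_integral_add)
  qed
  also have "\<dots> = ennreal (2 powr (r - 1)) * ((\<Sum>k\<in>F. ennreal (\<bar>real d * ?\<Delta> k\<bar> powr r) * ennreal (1 / real d)) +
      (\<Sum>k\<in>F. ennreal (real d) * (\<integral>\<^sup>+x. (\<integral>\<^sup>+y. indicator (cell d k) x * indicator (cell d k) y * ennreal (\<bar>h y - h x\<bar> powr r) \<partial>lborel) \<partial>lborel)))"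
    by (simp only: sum_distrib_left[symmetric] sum.distrib)
  also have "(\<Sum>k\<in>F. ennreal (\<bar>real d * ?\<Delta> k\<bar> powr r) * ennreal (1 / real d)) =
      ennreal (real d powr (r - 1) * (\<Sum>k\<in>F. \<bar>?\<Delta> k\<bar> powr r))"
  proof -
    have "ennreal (\<bar>real d * ?\<Delta> k\<bar> powr r) * ennreal (1 / real d) = ennreal (real d powr (r - 1) * \<bar>?\<Delta> k\<bar> powr r)" for k
      using d by (subst ennreal_mult[symmetric]) (auto simp: abs_mult powr_mult powr_diff)
    then show ?thesis by (simp add: sum_distrib_left sum_ennreal)
  qed
  also have "(\<Sum>k\<in>F. ennreal (real d) * (\<integral>\<^sup>+x. (\<integral>\<^sup>+y. indicator (cell d k) x * indicator (cell d k) y * ennreal (\<bar>h y - h x\<bar> powr r) \<partial>lborel) \<partial>lborel)) =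
      ennreal (real d) * (\<integral>\<^sup>+x. (\<integral>\<^sup>+y. (\<Sum>k\<in>F. indicator (cell d k) x * indicator (cell d k) y * ennreal (\<bar>h y - h x\<bar> powr r)) \<partial>lborel) \<partial>lborel)"
    by (simp add: sum_distrib_left[symmetric] nn_integral_sum)
  also have "\<dots> \<le> ennreal (real d) * (\<integral>\<^sup>+x. (\<integral>\<^sup>+y. indicator {-(1 / real d)..1 / real d} (y - x) *
      (ennreal (\<bar>h y - h x\<bar> powr r) * (indicator T x * indicator T y)) \<partial>lborel) \<partial>lborel)"
  proof (intro mult_left_mono nn_integral_mono)
    fix x y :: real
    show "(\<Sum>k\<in>F. indicator (cell d k) x * indicator (cell d k) y * ennreal (\<bar>h y - h x\<bar> powr r)) \<le>
      indicator {-(1 / real d)..1 / real d} (y - x) * (ennreal (\<bar>h y - h x\<bar> powr r) * (indicator T x * indicator T y))"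
    proof (cases "\<lfloor>real d * x\<rfloor> \<in> F \<and> \<lfloor>real d * y\<rfloor> = \<lfloor>real d * x\<rfloor>")
      case True
      have "(\<Sum>k\<in>F. indicator (cell d k) x * indicator (cell d k) y * ennreal (\<bar>h y - h x\<bar> powr r)) =
          (\<Sum>k\<in>{\<lfloor>real d * x\<rfloor>}. indicator (cell d k) x * indicator (cell d k) y * ennreal (\<bar>h y - h x\<bar> powr r))"
        using F(1) True by (intro sum.mono_neutral_right) (auto simp: cell_def indicator_def)
      also have "\<dots> = ennreal (\<bar>h y - h x\<bar> powr r)" using True by (simp add: cell_def)
      moreover have "x \<in> T" "y \<in> T" using True F(2)[of "\<lfloor>real d * x\<rfloor>"] by (auto simp: cell_def)
      moreover have "y - x \<in> {-(1 / real d)..1 / real d}"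
      proof -
        have "\<bar>real d * y - real d * x\<bar> \<le> 1" using True by linarith
        then show ?thesis using d by (auto simp: abs_le_iff field_simps)
      qed
      ultimately show ?thesis by (simp add: indicator_def)
    next
      case False
      then have "(\<Sum>k\<in>F. indicator (cell d k) x * indicator (cell d k) y * ennreal (\<bar>h y - h x\<bar> powr r)) = 0"
        by (intro sum.neutral) (auto simp: cell_def indicator_def)
      then show ?thesis by simp
    qed
  qed simp
  also have "(\<integral>\<^sup>+x. (\<integral>\<^sup>+y. indicator {-(1 / real d)..1 / real d} (y - x) * (ennreal (\<bar>h y - h x\<bar> powr r) * (indicator T x * indicator T y)) \<partial>lborel) \<partial>lborel) =
      (\<integral>\<^sup>+x. (\<integral>\<^sup>+t. indicator {-(1 / real d)..1 / real d} t * (ennreal (\<bar>h (x + t) - h x\<bar> powr r) * (indicator T x * indicator T (x + t))) \<partial>lborel) \<partial>lborel)"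
    (is "(\<integral>\<^sup>+x. ?L x \<partial>lborel) = (\<integral>\<^sup>+x. ?R x \<partial>lborel)")
  proof (rule nn_integral_cong)
    fix x :: real
    show "?L x = ?R x"
      using nn_integral_translate[of "\<lambda>y. indicator {-(1 / real d)..1 / real d} (y - x) * (ennreal (\<bar>h y - h x\<bar> powr r) * (indicator T x * indicator T y))" x]
      by (simp add: add.commute[of _ x])
  qed
  also have "\<dots> = (\<integral>\<^sup>+t. (\<integral>\<^sup>+x. indicator {-(1 / real d)..1 / real d} t * (ennreal (\<bar>h (x + t) - h x\<bar> powr r) * (indicator T x * indicator T (x + t))) \<partial>lborel) \<partial>lborel)"
  proof -
    define g :: "real \<Rightarrow> real \<Rightarrow> ennreal" where
      "g = (\<lambda>t x. indicator {-(1 / real d)..1 / real d} t * (ennreal (\<bar>h (x + t) - h x\<bar> powr r) * (indicator T x * indicator T (x + t))))"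
    have "case_prod g \<in> borel_measurable (lborel \<Otimes>\<^sub>M lborel)"
      unfolding g_def by measurable
    from lborel_pair.Fubini'[OF this] show ?thesis unfolding g_def .
  qed
  also have "\<dots> \<le> (\<integral>\<^sup>+t. indicator {-(1 / real d)..1 / real d} t * ennreal E \<partial>lborel)"
  proof (intro nn_integral_mono)
    fix t :: real
    show "(\<integral>\<^sup>+x. indicator {-(1 / real d)..1 / real d} t * (ennreal (\<bar>h (x + t) - h x\<bar> powr r) * (indicator T x * indicator T (x + t))) \<partial>lborel) \<le>
      indicator {-(1 / real d)..1 / real d} t * ennreal E"
    proof (cases "t \<in> {-(1 / real d)..1 / real d}")
      case True
      have "(\<integral>\<^sup>+x. ennreal (\<bar>h (x + t) - h x\<bar> powr r) * (indicator T x * indicator T (x + t)) \<partial>lborel) =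
          (\<integral>\<^sup>+x\<in>{x \<in> T. x + t \<in> T}. ennreal (\<bar>h (x + t) - h x\<bar> powr r) \<partial>lborel)"
        by (intro nn_integral_cong) (auto simp: indicator_def)
      then show ?thesis using E[of t] True by auto
    qed simp
  qed
  \<comment> \<open>The shifts form an interval of length \<open>2 / d\<close>, which cancels
    against the density \<open>d\<close> of the average and leaves \<open>2 * E\<close>.\<close>
  also have "\<dots> = ennreal (2 / real d) * ennreal E"
    using d by (simp add: nn_integral_multc emeasure_lborel_Icc_eq)
  also have "ennreal (real d) * (ennreal (2 / real d) * ennreal E) = ennreal (2 * E)"
    using d E0 by (simp flip: ennreal_mult)
  finally show ?thesis
    using E0 by (simp add: add_left_mono mult_left_mono ennreal_mult[symmetric] ennreal_plus[symmetric] sum_nonneg del: ennreal_plus)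
qed

text \<open>Monotone convergence over the cells with index in \<open>{- int m..int m}\<close> that
  lie inside \<open>T\<close>; half of a positive finite mass is strictly below the supremum, so a
  finite stage reaches it.\<close>

lemma exists_cells_half_mass:
  fixes h :: "real \<Rightarrow> real"
  assumes d: "0 < d" and T: "T = {0..1} \<or> T = UNIV" and [measurable]: "h \<in> borel_measurable borel"
    and supp: "\<And>x. x \<notin> T \<Longrightarrow> h x = 0" and I: "(\<integral>\<^sup>+x. ennreal (\<bar>h x\<bar> powr r) \<partial>lborel) = ennreal I" "0 < I"
  obtains F where "finite F" "\<And>k. k \<in> F \<Longrightarrow> cell d k \<subseteq> T"
    "ennreal (I / 2) \<le> (\<integral>\<^sup>+x\<in>(\<Union>k\<in>F. cell d k). ennreal (\<bar>h x\<bar> powr r) \<partial>lborel)"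
proof -
  define F where "F = (\<lambda>m::nat. {k \<in> {- int m..int m}. cell d k \<subseteq> T})"
  define f where "f = (\<lambda>m x. ennreal (\<bar>h x\<bar> powr r) * indicator (\<Union>k\<in>F m. cell d k) x)"
  have [measurable]: "(\<Union>k\<in>F m. cell d k) \<in> sets borel" for m
    by (intro sets.finite_UN) (auto simp: F_def intro: finite_subset[of _ "{- int m..int m}"])
  have [measurable]: "f m \<in> borel_measurable lborel" for m unfolding f_def by measurable
  have "incseq f"
  proof (intro incseq_SucI le_funI)
    fix m x
    have "F m \<subseteq> F (Suc m)" by (auto simp: F_def)
    then show "f m x \<le> f (Suc m) x" unfolding f_def
      by (intro mult_left_mono) (auto simp: indicator_def)
  qed
  then have "(SUP m. \<integral>\<^sup>+x. f m x \<partial>lborel) = (\<integral>\<^sup>+x. (SUP m. f m x) \<partial>lborel)"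
    by (subst nn_integral_monotone_convergence_SUP) auto
  also have "\<dots> = (\<integral>\<^sup>+x. ennreal (\<bar>h x\<bar> powr r) \<partial>lborel)"
  proof (rule nn_integral_cong_AE)
    \<comment> \<open>For \<open>T = {0..1}\<close> the cell containing 1 sticks out of
      \<open>T\<close>, so this point is not covered.\<close>
    have "AE x in lborel. x \<noteq> (1::real)" by (rule AE_lborel_singleton)
    then show "AE x in lborel. (SUP m. f m x) = ennreal (\<bar>h x\<bar> powr r)"
    proof eventually_elim
      case (elim x)
      show ?case
      proof (cases "x \<in> T")
        case False
        then show ?thesis using supp[OF False] by (simp add: f_def)
      next
        case True
        define k where "k = \<lfloor>real d * x\<rfloor>"
        have "cell d k \<subseteq> T"
        proof (cases "T = UNIV")
          case False
          then have T: "T = {0..1}" and x: "0 \<le> x" "x < 1" using T True elim by auto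
          have "k < int d" using x d unfolding k_def by (simp add: floor_less_iff)
          then have k: "0 \<le> k" "k + 1 \<le> int d" using x d by (auto simp: k_def)
          then have "real_of_int (k + 1) \<le> real_of_int (int d)" by (intro of_int_le_iff[THEN iffD2])
          then have "(real_of_int k + 1) / real d \<le> 1" using d by (simp add: field_simps)
          moreover have "0 \<le> real_of_int k / real d" using k d by simp
          ultimately show ?thesis unfolding cell_eq[OF d] T by (auto simp del: of_int_add)
        qed auto
        then have "x \<in> (\<Union>k\<in>F (nat \<bar>k\<bar>). cell d k)"
          by (intro UN_I[of k]) (auto simp: F_def cell_def k_def)
        then have "f (nat \<bar>k\<bar>) x = ennreal (\<bar>h x\<bar> powr r)" unfolding f_def by simp
        moreover have "f m x \<le> ennreal (\<bar>h x\<bar> powr r)" for m by (auto simp: f_def indicator_def)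
        ultimately show ?thesis by (intro antisym SUP_least SUP_upper2[of "nat \<bar>k\<bar>"]) auto
      qed
    qed
  qed
  finally have "ennreal (I / 2) < (SUP m. \<integral>\<^sup>+x. f m x \<partial>lborel)" using I by (simp add: ennreal_lessI)
  then obtain m where "ennreal (I / 2) < (\<integral>\<^sup>+x. f m x \<partial>lborel)" by (auto simp: less_SUP_iff)
  then have "ennreal (I / 2) \<le> (\<integral>\<^sup>+x\<in>(\<Union>k\<in>F m. cell d k). ennreal (\<bar>h x\<bar> powr r) \<partial>lborel)"
    unfolding f_def by simp
  moreover have "finite (F m)" by (rule finite_subset[of _ "{- int m..int m}"]) (auto simp: F_def)
  ultimately show ?thesis by (intro that[of "F m"]) (auto simp: F_def)
qed

text \<open>An absorption argument: the modulus of continuity of \<open>h\<close> at distance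
  \<open>1 / d\<close> is bounded by \<open>E\<close> and by a multiple of \<open>I\<close> itself.
  With cells short on the scale \<open>2 ^ - j\<close> this multiple is so small that it can be
  subtracted from \<open>I / 2\<close>.\<close>

lemma cells_detect:
  assumes T: "T = {0..1} \<or> T = UNIV" and K: "translation_regular T J0 K" and r: "1 < r"
  obtains s where "0 < s" "\<And>j d h b E I. J0 \<le> j \<Longrightarrow> 2 ^ j \<le> s * real d \<Longrightarrow> integrable lborel h \<Longrightarrow>
    (\<And>x. x \<notin> T \<Longrightarrow> h x = 0) \<Longrightarrow> AE x in lborel. \<bar>h x\<bar> \<le> b \<Longrightarrow> 0 \<le> E \<Longrightarrow> 0 < I \<Longrightarrow>
    (\<integral>\<^sup>+x\<in>T. ennreal (\<bar>kernel_op T (K j) h x - h x\<bar> powr r) \<partial>lborel) \<le> ennreal E \<Longrightarrow>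
    (\<integral>\<^sup>+x. ennreal (\<bar>h x\<bar> powr r) \<partial>lborel) = ennreal I \<Longrightarrow>
    \<exists>F. finite F \<and> I \<le> 16 powr r * (real d powr (r - 1) * (\<Sum>k\<in>F. \<bar>\<integral>x. indicat_real (cell d k) x * h x \<partial>lborel\<bar> powr r) + E)"
proof -
  have [measurable]: "T \<in> sets borel" using T by auto
  obtain C where C: "0 < C" "\<And>j x. j \<ge> J0 \<Longrightarrow> x \<in> T \<Longrightarrow> (\<integral>\<^sup>+y\<in>T. ennreal \<bar>K j x y\<bar> \<partial>lborel) \<le> ennreal C"
    using K unfolding translation_regular_def by blast
  \<comment> \<open>Chosen so that the total coefficient of \<open>I\<close> in the error of the
    cell approximation is \<open>1 / 4\<close>, half of the mass kept in \<open>F\<close>.\<close>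
  define e where "e = 1 / (4 * 2 powr (r - 1) * 2 * 4 powr (r - 1) * (2 * C) powr (r - 1))"
  have e: "0 < e" using C by (simp add: e_def)
  obtain s where s: "0 < s" "\<And>j t y. j \<ge> J0 \<Longrightarrow> \<bar>t\<bar> * 2 ^ j \<le> s \<Longrightarrow> y \<in> T \<Longrightarrow>
      (\<integral>\<^sup>+x\<in>{x \<in> T. x + t \<in> T}. ennreal \<bar>K j (x + t) y - K j x y\<bar> \<partial>lborel) \<le> ennreal e"
  proof -
    have "\<exists>s>0. \<forall>j\<ge>J0. \<forall>t. \<bar>t\<bar> * 2 ^ j \<le> s \<longrightarrow> (\<forall>y\<in>T.
      (\<integral>\<^sup>+x\<in>{x \<in> T. x + t \<in> T}. ennreal \<bar>K j (x + t) y - K j x y\<bar> \<partial>lborel) \<le> ennreal e)"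
      using K e unfolding translation_regular_def by (elim conjE allE[of _ e] impE) auto
    then show ?thesis using that by blast
  qed
  show ?thesis
  proof (rule that[OF s(1)])
    fix j d :: nat and h :: "real \<Rightarrow> real" and b E I :: real
    assume j: "J0 \<le> j" and jd: "2 ^ j \<le> s * real d" and h: "integrable lborel h"
      and supp: "\<And>x. x \<notin> T \<Longrightarrow> h x = 0" and b: "AE x in lborel. \<bar>h x\<bar> \<le> b" and E0: "0 \<le> E" and I0: "0 < I"
      and E: "(\<integral>\<^sup>+x\<in>T. ennreal (\<bar>kernel_op T (K j) h x - h x\<bar> powr r) \<partial>lborel) \<le> ennreal E"
      and I: "(\<integral>\<^sup>+x. ennreal (\<bar>h x\<bar> powr r) \<partial>lborel) = ennreal I"
    have [measurable]: "h \<in> borel_measurable borel" using h by auto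
    have "(0::real) < 2 ^ j" by simp
    then have "0 < s * real d" using jd by linarith
    then have d: "0 < d" using s(1) by (simp add: zero_less_mult_iff)
    define k where "k = (\<lambda>x y. indicat_real T x * indicat_real T y * K j x y)"
    have [measurable]: "(\<lambda>(x, y). k x y) \<in> borel_measurable (borel \<Otimes>\<^sub>M borel)"
      using K j unfolding translation_regular_def k_def by auto
    have kh: "kernel_op T (K j) h x = (\<integral>y. k x y * h y \<partial>lborel)" if "x \<in> T" for x
      unfolding kernel_op_def set_lebesgue_integral_def
      by (intro Bochner_Integration.integral_cong) (use that supp in \<open>auto simp: k_def indicator_def\<close>)
    define M where "M = 4 powr (r - 1) * (2 * E + (2 * C) powr (r - 1) * e * I)"
    have mod: "(\<integral>\<^sup>+x\<in>{x \<in> T. x + t \<in> T}. ennreal (\<bar>h (x + t) - h x\<bar> powr r) \<partial>lborel) \<le> ennreal M"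
      if t: "\<bar>t\<bar> \<le> 1 / real d" for t
      unfolding M_def
    proof (rule modulus_of_continuity_le[where k = k and b = b])
      show "(\<integral>\<^sup>+y. ennreal \<bar>k x y\<bar> \<partial>lborel) \<le> ennreal C" for x
      proof (cases "x \<in> T")
        case True
        have "(\<integral>\<^sup>+y. ennreal \<bar>k x y\<bar> \<partial>lborel) = (\<integral>\<^sup>+y\<in>T. ennreal \<bar>K j x y\<bar> \<partial>lborel)"
          using True by (intro nn_integral_cong) (auto simp: k_def indicator_def)
        then show ?thesis using C(2)[OF j True] by simp
      qed (simp add: k_def)
      show "(\<integral>\<^sup>+x\<in>{x \<in> T. x + t \<in> T}. ennreal \<bar>k (x + t) y - k x y\<bar> \<partial>lborel) \<le> ennreal e" for y
      proof (cases "y \<in> T")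
        case True
        have "\<bar>t\<bar> * 2 ^ j \<le> 1 / real d * (s * real d)" using t jd by (intro mult_mono) auto
        then have ts: "\<bar>t\<bar> * 2 ^ j \<le> s" using d by simp
        have "(\<integral>\<^sup>+x\<in>{x \<in> T. x + t \<in> T}. ennreal \<bar>k (x + t) y - k x y\<bar> \<partial>lborel) =
            (\<integral>\<^sup>+x\<in>{x \<in> T. x + t \<in> T}. ennreal \<bar>K j (x + t) y - K j x y\<bar> \<partial>lborel)"
          using True by (intro nn_integral_cong) (auto simp: k_def indicator_def)
        then show ?thesis using s(2)[OF j ts True] by simp
      qed (simp add: k_def)
      have "(\<integral>\<^sup>+x\<in>T. ennreal (\<bar>(\<integral>y. k x y * h y \<partial>lborel) - h x\<bar> powr r) \<partial>lborel) =
          (\<integral>\<^sup>+x\<in>T. ennreal (\<bar>kernel_op T (K j) h x - h x\<bar> powr r) \<partial>lborel)"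
        by (intro nn_integral_cong) (auto simp: kh indicator_def)
      then show "(\<integral>\<^sup>+x\<in>T. ennreal (\<bar>(\<integral>y. k x y * h y \<partial>lborel) - h x\<bar> powr r) \<partial>lborel) \<le> ennreal E"
        using E by simp
    qed (use r C e E0 I0 I b in auto)
    have M0: "0 \<le> M" using E0 I0 e by (simp add: M_def)
    obtain F where F: "finite F" "\<And>k. k \<in> F \<Longrightarrow> cell d k \<subseteq> T"
      "ennreal (I / 2) \<le> (\<integral>\<^sup>+x\<in>(\<Union>k\<in>F. cell d k). ennreal (\<bar>h x\<bar> powr r) \<partial>lborel)"
      using exists_cells_half_mass[OF d T _ supp I I0] by auto
    let ?S = "real d powr (r - 1) * (\<Sum>k\<in>F. \<bar>\<integral>x. indicat_real (cell d k) x * h x \<partial>lborel\<bar> powr r)"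
    have S0: "0 \<le> ?S" by (intro mult_nonneg_nonneg sum_nonneg) auto
    have "ennreal (I / 2) \<le> ennreal (2 powr (r - 1) * (?S + 2 * M))"
      by (rule order_trans[OF F(3) cell_approximation[where T = T]]) (use d r h F mod M0 in auto)
    then have "I / 2 \<le> 2 powr (r - 1) * (?S + 2 * M)"
      using S0 M0 by (subst (asm) ennreal_le_iff) (auto intro!: mult_nonneg_nonneg)
    also have "\<dots> = 2 powr (r - 1) * ?S + 2 powr (r - 1) * 4 * 4 powr (r - 1) * E + I / 4"
    proof -
      have "2 powr (r - 1) * 2 * 4 powr (r - 1) * (2 * C) powr (r - 1) * e = 1 / 4"
        using C by (simp add: e_def)
      moreover have "2 powr (r - 1) * (?S + 2 * M) = 2 powr (r - 1) * ?S + 2 powr (r - 1) * 4 * 4 powr (r - 1) * E +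
          (2 powr (r - 1) * 2 * 4 powr (r - 1) * (2 * C) powr (r - 1) * e) * I"
        unfolding M_def by (simp add: algebra_simps)
      ultimately show ?thesis by simp
    qed
    also have "\<dots> \<le> 4 * (2 powr (r - 1) * 4 powr (r - 1)) * (?S + E) + I / 4"
    proof -
      have "(1::real) \<le> 4 powr (r - 1)" using r by (simp add: ge_one_powr_ge_zero)
      then have "2 powr (r - 1) * ?S \<le> 4 * (2 powr (r - 1) * 4 powr (r - 1)) * ?S"
        by (intro mult_right_mono S0) simp
      then show ?thesis by (simp add: algebra_simps)
    qed
    also have "(2::real) powr (r - 1) * 4 powr (r - 1) = 8 powr (r - 1)"
      by (simp flip: powr_mult)
    finally have "I \<le> 16 * 8 powr (r - 1) * (?S + E)" by simp
    also have "\<dots> \<le> 16 powr r * (?S + E)"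
    proof (intro mult_right_mono add_nonneg_nonneg S0 E0)
      have "(8::real) powr (r - 1) \<le> 16 powr (r - 1)" using r by (intro powr_mono2) auto
      then show "16 * 8 powr (r - 1) \<le> 16 powr r" by (simp add: powr_diff)
    qed
    finally show "\<exists>F. finite F \<and> I \<le> 16 powr r * (real d powr (r - 1) * (\<Sum>k\<in>F. \<bar>\<integral>x. indicat_real (cell d k) x * h x \<partial>lborel\<bar> powr r) + E)"
      using F(1) by blast
  qed
qed

section \<open>Errors of the second kind\<close>

text \<open>For \<open>x = - y < 0\<close> it follows from
  \<open>(1 - y + y\<^sup>2) * (1 + y) = 1 + y ^ 3 \<ge> 1\<close> and
  \<open>1 + y \<le> exp y\<close>.\<close>

lemma exp_le_quadratic:
  fixes x :: real
  assumes "\<bar>x\<bar> \<le> 1"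
  shows "exp x \<le> 1 + x + x\<^sup>2"
proof (cases "0 \<le> x")
  case True
  then show ?thesis using exp_bound[of x] assms by simp
next
  case False
  define y where "y = - x"
  have y: "0 < y" "y \<le> 1" using False assms by (auto simp: y_def)
  have "1 \<le> 1 + y ^ 3" using y by simp
  also have "1 + y ^ 3 = (1 - y + y\<^sup>2) * (1 + y)" by (simp add: algebra_simps power2_eq_square power3_eq_cube)
  also have "\<dots> \<le> (1 - y + y\<^sup>2) * exp y"
    using y by (intro mult_left_mono) (auto simp: exp_ge_add_one_self)
  finally have "exp (- y) * 1 \<le> exp (- y) * ((1 - y + y\<^sup>2) * exp y)" by (intro mult_left_mono) auto
  also have "\<dots> = 1 - y + y\<^sup>2" by (simp add: mult_exp_exp mult.left_commute)
  finally show ?thesis by (simp add: y_def)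
qed

text \<open>Hoelder's inequality from Young's, with \<open>a\<close> normalised by
  \<open>l = A powr (1 / s)\<close>.\<close>

lemma sum_mult_le_powr:
  fixes a b :: "'a \<Rightarrow> real"
  assumes s: "1 < s" "1 < s'" "1 / s + 1 / s' = 1"
    and a: "\<And>k. k \<in> F \<Longrightarrow> 0 \<le> a k" and b: "\<And>k. k \<in> F \<Longrightarrow> 0 \<le> b k"
    and A: "0 < A" "(\<Sum>k\<in>F. a k powr s) \<le> A" and bs: "(\<Sum>k\<in>F. b k powr s') \<le> 1"
  shows "(\<Sum>k\<in>F. a k * b k) \<le> A powr (1 / s)"
proof -
  define l where "l = A powr (1 / s)"
  have l: "0 < l" "l powr s = A" using A s by (auto simp: l_def powr_powr)
  have "(\<Sum>k\<in>F. a k * b k) = l * (\<Sum>k\<in>F. a k / l * b k)"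
    using l by (simp add: sum_distrib_left)
  also have "\<dots> \<le> l * (\<Sum>k\<in>F. (a k / l) powr s / s + b k powr s' / s')"
    using l s a b by (intro mult_left_mono sum_mono Youngs_inequality) auto
  also have "(\<Sum>k\<in>F. (a k / l) powr s / s + b k powr s' / s') = (\<Sum>k\<in>F. a k powr s) / A / s + (\<Sum>k\<in>F. b k powr s') / s'"
  proof -
    have "(a k / l) powr s = a k powr s / A" if "k \<in> F" for k
      using l a[OF that] by (simp add: powr_divide)
    then show ?thesis by (simp add: sum.distrib sum_divide_distrib)
  qed
  also have "l * \<dots> \<le> l * (1 / s + 1 / s')"
    using l s A bs by (intro mult_left_mono add_mono divide_right_mono) auto
  finally show ?thesis using s by (simp add: l_def)
qed

text \<open>Hoelder's inequality for coefficients in the unit ball of the dual exponent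
  \<open>r / (r - 1)\<close>. It is used with the reciprocal cell weights and, through the next
  lemma, with the cell probabilities.\<close>

lemma sum_mult_square_le:
  fixes a c :: "'a \<Rightarrow> real"
  assumes r: "1 < r" "r < 2" and a: "\<And>k. k \<in> F \<Longrightarrow> 0 \<le> a k"
    and c: "(\<Sum>k\<in>F. \<bar>c k\<bar> powr (r / (r - 1))) \<le> 1"
    and A: "0 < A" "(\<Sum>k\<in>F. a k powr (r / (2 - r))) \<le> A"
  shows "(\<Sum>k\<in>F. a k * (c k)\<^sup>2) \<le> A powr (2 / r - 1)"
proof -
  have "(\<Sum>k\<in>F. a k * (c k)\<^sup>2) \<le> A powr (1 / (r / (2 - r)))"
  proof (rule sum_mult_le_powr[where s' = "r / (2 * (r - 1))"])
    show "1 / (r / (2 - r)) + 1 / (r / (2 * (r - 1))) = 1" using r by (simp add: field_simps)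
    have "(c k)\<^sup>2 powr (r / (2 * (r - 1))) = \<bar>c k\<bar> powr (r / (r - 1))" for k
    proof -
      have "(c k)\<^sup>2 = \<bar>c k\<bar> powr 2" by simp
      moreover have "2 * (r / (2 * (r - 1))) = r / (r - 1)" using r by (simp add: field_simps)
      ultimately show ?thesis by (simp only: powr_powr)
    qed
    then show "(\<Sum>k\<in>F. (c k)\<^sup>2 powr (r / (2 * (r - 1)))) \<le> 1" using c by simp
  qed (use r a A in \<open>auto simp: field_simps\<close>)
  also have "1 / (r / (2 - r)) = 2 / r - 1" using r by (simp add: field_simps)
  finally show ?thesis .
qed

text \<open>Controls the variance of a normalised linear functional of the cell counts. Total mass
  at most 1 and maximum at most \<open>b\<close> interpolate to the bound
  \<open>b powr (s - 1)\<close> for the sum of the \<open>q k powr s\<close>; at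
  \<open>r = 2\<close> the exponent \<open>s\<close> would be infinite and the estimate is
  direct.\<close>

lemma sum_probability_square_le:
  fixes q c :: "'a \<Rightarrow> real"
  assumes r: "1 < r" "r \<le> 2" and q: "\<And>k. k \<in> F \<Longrightarrow> 0 \<le> q k" "\<And>k. k \<in> F \<Longrightarrow> q k \<le> b" "(\<Sum>k\<in>F. q k) \<le> 1"
    and b: "0 < b" and c: "(\<Sum>k\<in>F. \<bar>c k\<bar> powr (r / (r - 1))) \<le> 1"
  shows "(\<Sum>k\<in>F. q k * (c k)\<^sup>2) \<le> b powr (2 - 2 / r)"
proof (cases "r = 2")
  case True
  have "(\<Sum>k\<in>F. q k * (c k)\<^sup>2) \<le> (\<Sum>k\<in>F. b * (c k)\<^sup>2)" by (intro sum_mono mult_right_mono q) auto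
  also have "\<dots> = b * (\<Sum>k\<in>F. \<bar>c k\<bar> powr (r / (r - 1)))" using True by (simp add: sum_distrib_left)
  also have "\<dots> \<le> b * 1" using b c by (intro mult_left_mono) auto
  finally show ?thesis using True b by simp
next
  case False
  define s where "s = r / (2 - r)"
  have s: "1 < s" using r False by (simp add: s_def field_simps)
  have "(\<Sum>k\<in>F. q k powr s) \<le> (\<Sum>k\<in>F. q k * b powr (s - 1))"
  proof (intro sum_mono)
    fix k assume k: "k \<in> F"
    have "q k powr s = q k * q k powr (s - 1)"
      using q(1)[OF k] by (cases "q k = 0") (auto simp: powr_diff)
    also have "\<dots> \<le> q k * b powr (s - 1)" using q k s by (intro mult_left_mono powr_mono2) auto
    finally show "q k powr s \<le> q k * b powr (s - 1)" .
  qed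
  also have "\<dots> \<le> 1 * b powr (s - 1)" using q(3) 
    unfolding sum_distrib_right[symmetric] by (intro mult_right_mono) auto
  finally have "(\<Sum>k\<in>F. q k * (c k)\<^sup>2) \<le> (b powr (s - 1)) powr (2 / r - 1)"
    using r False b by (intro sum_mult_square_le[OF _ _ q(1) c]) (auto simp: s_def)
  also have "\<dots> = b powr (2 - 2 / r)"
  proof -
    have "(s - 1) * (2 / r - 1) = 2 - 2 / r" using r False by (simp add: s_def field_simps)
    then show ?thesis by (simp add: powr_powr)
  qed
  finally show ?thesis .
qed

section \<open>Product measures and likelihood ratios\<close>

lemma prob_space_law: "density_on T p \<Longrightarrow> prob_space (law p)"
  unfolding law_def density_on_def
  by (intro prob_spaceI) (simp add: emeasure_density)

lemma sets_law [simp, measurable_cong]: "sets (law p) = sets borel"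
  by (simp add: law_def)

lemma space_law [simp]: "space (law p) = UNIV"
  by (simp add: law_def)

lemma sequence_space_law: "density_on T p \<Longrightarrow> sequence_space (law p)"
  unfolding sequence_space_def product_prob_space_def product_sigma_finite_def product_prob_space_axioms_def
  by (auto intro: prob_space_law prob_space_imp_sigma_finite)

context sequence_space
begin

lemma measurable_case_nat_pair: "(\<lambda>(x, \<omega>). case_nat x \<omega>) \<in> M \<Otimes>\<^sub>M S \<rightarrow>\<^sub>M S"
  by measurable

text \<open>Splits off the first observation; functionals of the first \<open>n\<close> observations
  are handled by induction on \<open>n\<close> through this identity.\<close>

lemma nn_integral_sequence_Cons:
  assumes [measurable]: "f \<in> borel_measurable S"
  shows "(\<integral>\<^sup>+\<omega>. f \<omega> \<partial>S) = (\<integral>\<^sup>+x. (\<integral>\<^sup>+\<omega>. f (case_nat x \<omega>) \<partial>S) \<partial>M)"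
proof -
  have [measurable]: "(\<lambda>(x, \<omega>). case_nat x \<omega>) \<in> M \<Otimes>\<^sub>M S \<rightarrow>\<^sub>M S" by (rule measurable_case_nat_pair)
  have "(\<integral>\<^sup>+\<omega>. f \<omega> \<partial>S) = (\<integral>\<^sup>+\<omega>. f \<omega> \<partial>distr (M \<Otimes>\<^sub>M S) S (\<lambda>(x, \<omega>). case_nat x \<omega>))"
    by (simp add: PiM_iter)
  also have "\<dots> = (\<integral>\<^sup>+z. f (case z of (x, \<omega>) \<Rightarrow> case_nat x \<omega>) \<partial>(M \<Otimes>\<^sub>M S))"
    by (rule nn_integral_distr) measurable
  also have "\<dots> = (\<integral>\<^sup>+x. (\<integral>\<^sup>+\<omega>. f (case_nat x \<omega>) \<partial>S) \<partial>M)"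
    by (subst P.nn_integral_fst[symmetric]) (auto simp: measurable_compose[OF measurable_case_nat_pair])
  finally show ?thesis .
qed

lemma nn_integral_prod_iid:
  assumes [measurable]: "u \<in> borel_measurable M"
  shows "(\<integral>\<^sup>+\<omega>. (\<Prod>i<n. u (\<omega> i)) \<partial>S) = (\<integral>\<^sup>+x. u x \<partial>M) ^ n"
proof (induction n)
  case 0
  then show ?case by (simp add: P.emeasure_space_1)
next
  case (Suc n)
  have "(\<integral>\<^sup>+\<omega>. (\<Prod>i<Suc n. u (\<omega> i)) \<partial>S) = (\<integral>\<^sup>+x. (\<integral>\<^sup>+\<omega>. u x * (\<Prod>i<n. u (\<omega> i)) \<partial>S) \<partial>M)"
    by (subst nn_integral_sequence_Cons) (simp_all add: prod.lessThan_Suc_shift del: prod.lessThan_Suc)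
  also have "\<dots> = (\<integral>\<^sup>+x. u x \<partial>M) * (\<integral>\<^sup>+x. u x \<partial>M) ^ n"
    by (simp add: nn_integral_cmult nn_integral_multc Suc.IH)
  finally show ?case by simp
qed

end

text \<open>Under the law of \<open>p0\<close> almost surely no denominator vanishes; where one
  does, its factor is 0 by the convention for division.\<close>

definition lratio :: "(real \<Rightarrow> real) \<Rightarrow> nat \<Rightarrow> (real \<Rightarrow> real) \<Rightarrow> (nat \<Rightarrow> real) \<Rightarrow> real" where
  "lratio p0 n p \<omega> = (\<Prod>i<n. p (\<omega> i) / p0 (\<omega> i))"

lemma density_onD:
  assumes "density_on T p"
  shows "p \<in> borel_measurable borel" "\<And>x. 0 \<le> p x" "\<And>x. x \<notin> T \<Longrightarrow> p x = 0"
    "integrable lborel p" "(\<integral>x. p x \<partial>lborel) = 1"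
proof -
  show [measurable]: "p \<in> borel_measurable borel" and nn: "\<And>x. 0 \<le> p x" and "\<And>x. x \<notin> T \<Longrightarrow> p x = 0"
    using assms by (auto simp: density_on_def)
  have 1: "(\<integral>\<^sup>+x. ennreal (p x) \<partial>lborel) = 1" using assms by (auto simp: density_on_def)
  then show int: "integrable lborel p" using nn by (intro integrableI_bounded) auto
  show "(\<integral>x. p x \<partial>lborel) = 1"
    using nn 1 by (subst integral_eq_nn_integral) auto
qed

text \<open>Only an inequality, since the mass of \<open>p\<close> on the zero set of
  \<open>p0\<close> is lost.\<close>

lemma nn_integral_law_ratio_le:
  assumes p: "density_on T p" and p0: "density_on T p0" and [measurable]: "g \<in> borel_measurable borel"
  shows "(\<integral>\<^sup>+x. g x * ennreal (p x / p0 x) \<partial>law p0) \<le> (\<integral>\<^sup>+x. g x * ennreal (p x) \<partial>lborel)"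
proof -
  note [measurable] = density_onD(1)[OF p] density_onD(1)[OF p0]
  have "(\<integral>\<^sup>+x. g x * ennreal (p x / p0 x) \<partial>law p0) = (\<integral>\<^sup>+x. ennreal (p0 x) * (g x * ennreal (p x / p0 x)) \<partial>lborel)"
    unfolding law_def by (rule nn_integral_density) auto
  also have "\<dots> \<le> (\<integral>\<^sup>+x. g x * ennreal (p x) \<partial>lborel)"
  proof (rule nn_integral_mono)
    fix x
    show "ennreal (p0 x) * (g x * ennreal (p x / p0 x)) \<le> g x * ennreal (p x)"
    proof (cases "p0 x = 0")
      case False
      have "ennreal (p0 x) * ennreal (p x / p0 x) = ennreal (p x)"
        using False density_onD(2)[OF p0, of x] density_onD(2)[OF p, of x] by (simp flip: ennreal_mult)
      then show ?thesis by (simp add: mult.left_commute)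
    qed simp
  qed
  finally show ?thesis .
qed

text \<open>
  Integrating the likelihood ratio against the law of \<open>p0\<close> expresses probabilities under \<open>p\<close> without
  a second product measure; absolute continuity is not needed because only upper bounds occur.
\<close>

lemma chernoff_lower_tail:
  fixes f p p0 :: "real \<Rightarrow> real"
  assumes p: "density_on T p" and p0: "density_on T p0" and [measurable]: "f \<in> borel_measurable borel"
    and f: "\<And>x. \<bar>f x\<bar> \<le> 1" and V: "(\<integral>x. p x * (f x)\<^sup>2 \<partial>lborel) \<le> V" and t: "0 \<le> t" "t \<le> 1 / 2"
  shows "(\<integral>\<^sup>+\<omega>\<in>{\<omega>. (\<Sum>i<n. f (\<omega> i) - (\<integral>x. p x * f x \<partial>lborel)) \<le> - y}. ennreal (lratio p0 n p \<omega>) \<partial>PiM UNIV (\<lambda>_. law p0))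
    \<le> ennreal (exp (real n * t\<^sup>2 * V - t * y))"
proof -
  note pd = density_onD[OF p] and p0d = density_onD[OF p0]
  note [measurable] = pd(1) p0d(1)
  interpret sequence_space "law p0" using p0 by (rule sequence_space_law)
  define m where "m = (\<integral>x. p x * f x \<partial>lborel)"
  have pf: "integrable lborel (\<lambda>x. p x * f x)"
    by (rule Bochner_Integration.integrable_bound[OF pd(4)]) (auto simp: abs_mult pd(2) f intro!: mult_left_le)
  have f2: "(f x)\<^sup>2 \<le> 1" for x using f[of x] by (simp add: abs_square_le_1)
  have pf2: "integrable lborel (\<lambda>x. p x * (f x)\<^sup>2)"
    by (rule Bochner_Integration.integrable_bound[OF pd(4)]) (auto simp: abs_mult pd(2) f2 intro!: mult_left_le)
  have m1: "\<bar>m\<bar> \<le> 1"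
  proof -
    have "\<bar>m\<bar> \<le> (\<integral>x. \<bar>p x * f x\<bar> \<partial>lborel)" unfolding m_def by (rule integral_abs_bound)
    also have "\<dots> \<le> (\<integral>x. p x \<partial>lborel)"
      using integrable_abs[OF pf] pd f by (intro integral_mono) (auto simp: abs_mult intro!: mult_left_le)
    finally show ?thesis using pd by simp
  qed
  define g where "g = (\<lambda>x. exp (- t * (f x - m)))"
  have [measurable]: "g \<in> borel_measurable borel" unfolding g_def by measurable
  \<comment> \<open>\<open>t \<le> 1 / 2\<close> and \<open>\<bar>f x - m\<bar> \<le> 2\<close> keep
    the exponent in the range of the quadratic bound.\<close>
  have gle: "g x \<le> 1 - t * (f x - m) + t\<^sup>2 * (f x - m)\<^sup>2" for x
  proof -
    have "\<bar>f x - m\<bar> \<le> 2" using f[of x] m1 by linarith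
    then have "t * \<bar>f x - m\<bar> \<le> 1 / 2 * 2" using t by (intro mult_mono) auto
    then have "\<bar>- t * (f x - m)\<bar> \<le> 1" using t by (simp add: abs_mult)
    from exp_le_quadratic[OF this] show ?thesis by (simp add: g_def power_mult_distrib)
  qed
  have "(\<integral>\<^sup>+x. ennreal (g x) * ennreal (p x / p0 x) \<partial>law p0) \<le> (\<integral>\<^sup>+x. ennreal (g x) * ennreal (p x) \<partial>lborel)"
    by (rule nn_integral_law_ratio_le[OF p p0]) measurable
  also have "\<dots> \<le> (\<integral>\<^sup>+x. ennreal ((1 - t * (f x - m) + t\<^sup>2 * (f x - m)\<^sup>2) * p x) \<partial>lborel)"
    using gle pd(2) by (intro nn_integral_mono) (auto simp: g_def ennreal_mult[symmetric] intro!: ennreal_leI mult_right_mono)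
  also have "\<dots> = ennreal (\<integral>x. (1 - t * (f x - m) + t\<^sup>2 * (f x - m)\<^sup>2) * p x \<partial>lborel)"
  proof (rule nn_integral_eq_integral)
    have "(\<lambda>x. (1 - t * (f x - m) + t\<^sup>2 * (f x - m)\<^sup>2) * p x) =
      (\<lambda>x. (1 + t * m + t\<^sup>2 * m\<^sup>2) * p x + (- t - 2 * t\<^sup>2 * m) * (p x * f x) + t\<^sup>2 * (p x * (f x)\<^sup>2))"
      by (auto simp: fun_eq_iff algebra_simps power2_eq_square)
    then show "integrable lborel (\<lambda>x. (1 - t * (f x - m) + t\<^sup>2 * (f x - m)\<^sup>2) * p x)"
      using pd(4) pf pf2 by simp
    have "0 \<le> 1 - t * (f x - m) + t\<^sup>2 * (f x - m)\<^sup>2" for x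
      using gle[of x] by (simp add: g_def order_trans[OF exp_ge_zero])
    then show "AE x in lborel. 0 \<le> (1 - t * (f x - m) + t\<^sup>2 * (f x - m)\<^sup>2) * p x" using pd(2) by simp
  qed
  also have "(\<integral>x. (1 - t * (f x - m) + t\<^sup>2 * (f x - m)\<^sup>2) * p x \<partial>lborel) =
      (\<integral>x. (1 + t * m + t\<^sup>2 * m\<^sup>2) * p x + (- t - 2 * t\<^sup>2 * m) * (p x * f x) + t\<^sup>2 * (p x * (f x)\<^sup>2) \<partial>lborel)"
    by (intro Bochner_Integration.integral_cong) (auto simp: algebra_simps power2_eq_square)
  \<comment> \<open>The term linear in \<open>f - m\<close> has mean zero under \<open>p\<close>, so
    only \<open>t\<^sup>2\<close> times the variance of \<open>f\<close> is added to 1.\<close>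
  also have "\<dots> = 1 + t * m + t\<^sup>2 * m\<^sup>2 + (- t - 2 * t\<^sup>2 * m) * m + t\<^sup>2 * (\<integral>x. p x * (f x)\<^sup>2 \<partial>lborel)"
    using pd(4,5) pf pf2 by (simp add: m_def)
  also have "\<dots> = 1 - t\<^sup>2 * m\<^sup>2 + t\<^sup>2 * (\<integral>x. p x * (f x)\<^sup>2 \<partial>lborel)"
    by (simp add: algebra_simps power2_eq_square)
  also have "ennreal \<dots> \<le> ennreal (exp (t\<^sup>2 * V))"
  proof (rule ennreal_leI)
    have "t\<^sup>2 * (\<integral>x. p x * (f x)\<^sup>2 \<partial>lborel) \<le> t\<^sup>2 * V" using V by (intro mult_left_mono) auto
    moreover have "0 \<le> t\<^sup>2 * m\<^sup>2" by simp
    ultimately show "1 - t\<^sup>2 * m\<^sup>2 + t\<^sup>2 * (\<integral>x. p x * (f x)\<^sup>2 \<partial>lborel) \<le> exp (t\<^sup>2 * V)"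
      using exp_ge_add_one_self[of "t\<^sup>2 * V"] by linarith
  qed
  finally have one: "(\<integral>\<^sup>+x. ennreal (g x) * ennreal (p x / p0 x) \<partial>law p0) \<le> ennreal (exp (t\<^sup>2 * V))" .
  have "(\<integral>\<^sup>+\<omega>\<in>{\<omega>. (\<Sum>i<n. f (\<omega> i) - m) \<le> - y}. ennreal (lratio p0 n p \<omega>) \<partial>S) \<le>
      (\<integral>\<^sup>+\<omega>. ennreal (exp (- t * y)) * (\<Prod>i<n. ennreal (g (\<omega> i)) * ennreal (p (\<omega> i) / p0 (\<omega> i))) \<partial>S)"
  \<comment> \<open>On the event, \<open>exp (- t * y)\<close> times the product of the
    \<open>g (\<omega> i)\<close> is at least 1.\<close>
  proof (rule nn_integral_mono)
    fix \<omega> :: "nat \<Rightarrow> real"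
    show "ennreal (lratio p0 n p \<omega>) * indicator {\<omega>. (\<Sum>i<n. f (\<omega> i) - m) \<le> - y} \<omega> \<le>
      ennreal (exp (- t * y)) * (\<Prod>i<n. ennreal (g (\<omega> i)) * ennreal (p (\<omega> i) / p0 (\<omega> i)))"
    proof (cases "(\<Sum>i<n. f (\<omega> i) - m) \<le> - y")
      case True
      have L: "(\<Prod>i<n. ennreal (p (\<omega> i) / p0 (\<omega> i))) = ennreal (lratio p0 n p \<omega>)"
        using pd(2) p0d(2) by (simp add: lratio_def prod_ennreal)
      have "(\<Prod>i<n. g (\<omega> i)) = exp (- t * (\<Sum>i<n. f (\<omega> i) - m))"
        by (simp add: g_def exp_sum[symmetric] sum_distrib_left)
      then have G: "ennreal (exp (- t * y)) * (\<Prod>i<n. ennreal (g (\<omega> i))) = ennreal (exp (- t * ((\<Sum>i<n. f (\<omega> i) - m) + y)))"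
        by (simp add: prod_ennreal g_def ennreal_mult[symmetric] mult_exp_exp algebra_simps)
      have "0 \<le> - t * ((\<Sum>i<n. f (\<omega> i) - m) + y)" using True t by (intro mult_nonpos_nonpos) auto
      then have "1 \<le> ennreal (exp (- t * ((\<Sum>i<n. f (\<omega> i) - m) + y)))"
        by (subst ennreal_1[symmetric], intro ennreal_leI) simp
      then have "1 * ennreal (lratio p0 n p \<omega>) \<le> ennreal (exp (- t * ((\<Sum>i<n. f (\<omega> i) - m) + y))) * ennreal (lratio p0 n p \<omega>)"
        by (intro mult_right_mono) auto
      then show ?thesis using True unfolding prod.distrib L mult.assoc[symmetric] G by simp
    qed simp
  qed
  also have "\<dots> = ennreal (exp (- t * y)) * (\<integral>\<^sup>+x. ennreal (g x) * ennreal (p x / p0 x) \<partial>law p0) ^ n"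
    using nn_integral_prod_iid[of "\<lambda>x. ennreal (g x) * ennreal (p x / p0 x)" n]
    by (subst nn_integral_cmult) auto
  also have "\<dots> \<le> ennreal (exp (- t * y)) * ennreal (exp (t\<^sup>2 * V)) ^ n"
    by (intro mult_left_mono power_mono one) auto
  also have "\<dots> = ennreal (exp (real n * t\<^sup>2 * V - t * y))"
    by (simp add: ennreal_power ennreal_mult[symmetric] exp_of_nat_mult[symmetric] mult_exp_exp algebra_simps)
  finally show ?thesis by (simp add: m_def)
qed

section \<open>Cell counts and the chi-square statistic\<close>

definition cell_prob :: "(real \<Rightarrow> real) \<Rightarrow> nat \<Rightarrow> int \<Rightarrow> real" where
  "cell_prob p d k = (\<integral>x. indicat_real (cell d k) x * p x \<partial>lborel)"

text \<open>Unlike in Pearson's statistic, the squared deviations are not divided by expected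
  counts. The weights are left free; they are chosen later to grow with the distance of the cell
  from the origin.\<close>

definition chi_square :: "(int \<Rightarrow> real) \<Rightarrow> (real \<Rightarrow> real) \<Rightarrow> nat \<Rightarrow> nat \<Rightarrow> int set \<Rightarrow> (nat \<Rightarrow> real) \<Rightarrow> real" where
  "chi_square w p0 d n F \<omega> =
     (\<Sum>k\<in>F. w k * (\<Sum>i<n. indicat_real (cell d k) (\<omega> i) - cell_prob p0 d k)\<^sup>2)"

lemma integrable_cell:
  assumes "density_on T p" shows "integrable lborel (\<lambda>x. indicat_real (cell d k) x * p x)"
  using integrable_real_mult_indicator[OF _ density_onD(4)[OF assms], of "cell d k"] by (simp add: mult.commute)

lemma cell_prob_nonneg: "density_on T p \<Longrightarrow> 0 \<le> cell_prob p d k"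
  unfolding cell_prob_def using density_onD(2) by (auto intro!: integral_nonneg_AE)

lemma sum_indicator_cell:
  assumes "finite F"
  shows "(\<Sum>k\<in>F. g k * indicat_real (cell d k) x) = (if \<lfloor>real d * x\<rfloor> \<in> F then g \<lfloor>real d * x\<rfloor> else 0)"
proof -
  have "(\<Sum>k\<in>F. g k * indicat_real (cell d k) x) = (\<Sum>k\<in>F. if k = \<lfloor>real d * x\<rfloor> then g k else 0)"
    by (intro sum.cong) (auto simp: cell_def indicator_def)
  then show ?thesis using assms by simp
qed

lemma sum_cell_prob_le:
  assumes p: "density_on T p" and F: "finite F"
  shows "(\<Sum>k\<in>F. cell_prob p d k) \<le> 1"
proof -
  note pd = density_onD[OF p]
  have "(\<Sum>k\<in>F. cell_prob p d k) = (\<integral>x. (\<Sum>k\<in>F. indicat_real (cell d k) x * p x) \<partial>lborel)"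
    unfolding cell_prob_def by (intro Bochner_Integration.integral_sum[symmetric] integrable_cell[OF p])
  also have "\<dots> \<le> (\<integral>x. p x \<partial>lborel)"
  proof (intro integral_mono pd Bochner_Integration.integrable_sum integrable_cell[OF p])
    show "(\<Sum>k\<in>F. indicat_real (cell d k) x * p x) \<le> p x" for x
      using sum_indicator_cell[OF F, of "\<lambda>_. 1" d x] pd(2)[of x]
      by (simp add: sum_distrib_right[symmetric] split: if_splits)
  qed
  finally show ?thesis using pd by simp
qed

text \<open>
  The statistic is bounded below by the single linear functional of the cell counts with coefficients
  \<open>c\<close>, the norming functional of the vector \<open>D\<close> of differences in \<open>\<ell>\<^sup>r\<close>.
\<close>

lemma type_II_error:
  fixes p p0 :: "real \<Rightarrow> real" and w :: "int \<Rightarrow> real"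
  assumes p: "density_on T p" and p0: "density_on T p0" and F: "finite F" and n: "0 < n"
    and r: "1 < r" "r \<le> 2" and b: "0 < b" "\<And>k. k \<in> F \<Longrightarrow> cell_prob p d k \<le> b"
    and w: "\<And>k. k \<in> F \<Longrightarrow> 1 \<le> w k" "r < 2 \<Longrightarrow> (\<Sum>k\<in>F. (1 / w k) powr (r / (2 - r))) \<le> H" and H: "0 < H"
    and v: "0 < v" "v powr r \<le> (\<Sum>k\<in>F. \<bar>cell_prob p d k - cell_prob p0 d k\<bar> powr r)"
    and v1: "16 * R * b powr (2 - 2 / r) \<le> real n * v\<^sup>2" and v2: "8 * R \<le> real n * v"
    and v3: "4 * H powr (2 / r - 1) * m \<le> real n * v\<^sup>2" and m: "0 \<le> m"
  shows "(\<integral>\<^sup>+\<omega>\<in>{\<omega>. chi_square w p0 d n F \<omega> \<le> m * real n}. ennreal (lratio p0 n p \<omega>) \<partial>PiM UNIV (\<lambda>_. law p0)) \<le> ennreal (exp (- R))"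
proof -
  note pd = density_onD[OF p]
  note [measurable] = pd(1)
  define D where "D = (\<lambda>k. cell_prob p d k - cell_prob p0 d k)"
  define u where "u = (\<Sum>k\<in>F. \<bar>D k\<bar> powr r) powr (1 / r)"
  have ur: "u powr r = (\<Sum>k\<in>F. \<bar>D k\<bar> powr r)" using r by (simp add: u_def powr_powr sum_nonneg)
  have vu: "v \<le> u"
  proof -
    have "v = (v powr r) powr (1 / r)" using v r by (simp add: powr_powr)
    also have "\<dots> \<le> u" unfolding u_def using v r by (intro powr_mono2) (auto simp: D_def)
    finally show ?thesis .
  qed
  have u: "0 < u" using vu v by simp
  \<comment> \<open>The extremal coefficients in Hoelder's inequality: norm 1 in the dual exponent
    \<open>r / (r - 1)\<close>, and pairing with \<open>D\<close> gives its norm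
    \<open>u\<close>.\<close>
  define c where "c = (\<lambda>k. sgn (D k) * \<bar>D k\<bar> powr (r - 1) / u powr (r - 1))"
  have c_abs: "\<bar>c k\<bar> = \<bar>D k\<bar> powr (r - 1) / u powr (r - 1)" for k
    by (auto simp: c_def abs_mult sgn_if)
  have cr: "(\<Sum>k\<in>F. \<bar>c k\<bar> powr (r / (r - 1))) = 1"
  proof -
    have "\<bar>c k\<bar> powr (r / (r - 1)) = \<bar>D k\<bar> powr r / u powr r" for k
      unfolding c_abs using r u by (simp add: powr_divide powr_powr)
    then have "(\<Sum>k\<in>F. \<bar>c k\<bar> powr (r / (r - 1))) = (\<Sum>k\<in>F. \<bar>D k\<bar> powr r) / u powr r"
      by (simp add: sum_divide_distrib)
    then show ?thesis using u by (simp add: ur[symmetric])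
  qed
  have c1: "\<bar>c k\<bar> \<le> 1" if "k \<in> F" for k
  proof (rule ccontr)
    assume "\<not> \<bar>c k\<bar> \<le> 1"
    then have "1 powr (r / (r - 1)) < \<bar>c k\<bar> powr (r / (r - 1))" using r by (intro powr_less_mono2) auto
    also have "\<dots> \<le> (\<Sum>k\<in>F. \<bar>c k\<bar> powr (r / (r - 1)))"
      using F that by (intro member_le_sum) auto
    finally show False using cr by simp
  qed
  have cD: "(\<Sum>k\<in>F. c k * D k) = u"
  proof -
    have "c k * D k = \<bar>D k\<bar> powr r / u powr (r - 1)" for k
    proof (cases "D k = 0")
      case False
      have "c k * D k = (sgn (D k) * D k) * \<bar>D k\<bar> powr (r - 1) / u powr (r - 1)" by (simp add: c_def)
      also have "sgn (D k) * D k = \<bar>D k\<bar>" by (simp add: abs_sgn mult.commute)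
      also have "\<bar>D k\<bar> * \<bar>D k\<bar> powr (r - 1) = \<bar>D k\<bar> powr r" using False by (simp add: powr_diff)
      finally show ?thesis .
    qed simp
    then have "(\<Sum>k\<in>F. c k * D k) = u powr r / u powr (r - 1)" by (simp add: ur sum_divide_distrib)
    also have "\<dots> = u" using u by (simp add: powr_diff)
    finally show ?thesis .
  qed
  define V where "V = b powr (2 - 2 / r)"
  have V: "0 < V" using b by (simp add: V_def)
  define f where "f = (\<lambda>x. \<Sum>k\<in>F. c k * indicat_real (cell d k) x)"
  have [measurable]: "f \<in> borel_measurable borel" unfolding f_def by measurable
  have f_eq: "f x = (if \<lfloor>real d * x\<rfloor> \<in> F then c \<lfloor>real d * x\<rfloor> else 0)" for x
    unfolding f_def by (rule sum_indicator_cell[OF F])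
  have f1: "\<bar>f x\<bar> \<le> 1" for x using c1 by (simp add: f_eq)
  have mean: "(\<integral>x. p x * f x \<partial>lborel) = (\<Sum>k\<in>F. c k * cell_prob p d k)"
  proof -
    have "(\<integral>x. p x * f x \<partial>lborel) = (\<integral>x. (\<Sum>k\<in>F. c k * (indicat_real (cell d k) x * p x)) \<partial>lborel)"
      by (intro Bochner_Integration.integral_cong) (auto simp: f_def sum_distrib_left ac_simps)
    then show ?thesis by (simp add: Bochner_Integration.integral_sum integrable_cell[OF p] cell_prob_def)
  qed
  have var: "(\<integral>x. p x * (f x)\<^sup>2 \<partial>lborel) \<le> V"
  proof -
    have "(f x)\<^sup>2 = (\<Sum>k\<in>F. (c k)\<^sup>2 * indicat_real (cell d k) x)" for x
      unfolding sum_indicator_cell[OF F] f_eq by simp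
    then have "(\<integral>x. p x * (f x)\<^sup>2 \<partial>lborel) = (\<integral>x. (\<Sum>k\<in>F. (c k)\<^sup>2 * (indicat_real (cell d k) x * p x)) \<partial>lborel)"
      by (intro Bochner_Integration.integral_cong) (auto simp: sum_distrib_left ac_simps)
    also have "\<dots> = (\<Sum>k\<in>F. cell_prob p d k * (c k)\<^sup>2)"
      unfolding cell_prob_def
      by (subst Bochner_Integration.integral_sum) (auto simp: integrable_cell[OF p] intro!: sum.cong)
    also have "\<dots> \<le> V" unfolding V_def
      using r b cr by (intro sum_probability_square_le cell_prob_nonneg[OF p] sum_cell_prob_le[OF p F]) auto
    finally show ?thesis .
  qed
  have cw: "(\<Sum>k\<in>F. (1 / w k) * (c k)\<^sup>2) \<le> H powr (2 / r - 1)"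
  proof (cases "r = 2")
    case True
    have "(\<Sum>k\<in>F. (1 / w k) * (c k)\<^sup>2) \<le> (\<Sum>k\<in>F. 1 * (c k)\<^sup>2)"
      using w(1) by (intro sum_mono mult_right_mono) (auto simp: divide_le_eq_1)
    also have "\<dots> = 1" using cr True by simp
    finally show ?thesis using True H by simp
  next
    case False
    have "0 \<le> 1 / w k" if "k \<in> F" for k using w(1)[OF that] by simp
    then show ?thesis using r False H w(2) cr by (intro sum_mult_square_le) auto
  qed
  \<comment> \<open>Passing from the centring at \<open>p0\<close> to that at \<open>p\<close>
    shifts the functional by \<open>- n * u\<close>. By Cauchy-Schwarz, with the weights split as
    \<open>1 / w k\<close> and \<open>w k\<close>, a small statistic keeps the functional centred at
    \<open>p0\<close> below half of this shift.\<close>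
  have sub: "(\<Sum>i<n. f (\<omega> i) - (\<integral>x. p x * f x \<partial>lborel)) \<le> - (real n * u / 2)"
    if chi: "chi_square w p0 d n F \<omega> \<le> m * real n" for \<omega>
  proof -
    define Z where "Z = (\<lambda>k. \<Sum>i<n. indicat_real (cell d k) (\<omega> i) - cell_prob p0 d k)"
    have "(\<Sum>i<n. f (\<omega> i) - (\<integral>x. p x * f x \<partial>lborel)) = (\<Sum>i<n. f (\<omega> i)) - real n * (\<Sum>k\<in>F. c k * cell_prob p d k)"
      by (simp add: mean sum_subtractf)
    also have "(\<Sum>i<n. f (\<omega> i)) = (\<Sum>k\<in>F. c k * (Z k + real n * cell_prob p0 d k))"
    proof -
      have "(\<Sum>i<n. f (\<omega> i)) = (\<Sum>k\<in>F. \<Sum>i<n. c k * indicat_real (cell d k) (\<omega> i))"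
        unfolding f_def by (rule sum.swap)
      then show ?thesis by (simp add: Z_def sum_subtractf sum_distrib_left)
    qed
    also have "\<dots> - real n * (\<Sum>k\<in>F. c k * cell_prob p d k) = (\<Sum>k\<in>F. c k * Z k) - real n * (\<Sum>k\<in>F. c k * D k)"
      by (simp add: D_def sum_distrib_left sum.distrib[symmetric] sum_subtractf[symmetric] algebra_simps)
    also have "\<dots> = (\<Sum>k\<in>F. c k * Z k) - real n * u" by (simp add: cD)
    finally have 1: "(\<Sum>i<n. f (\<omega> i) - (\<integral>x. p x * f x \<partial>lborel)) = (\<Sum>k\<in>F. c k * Z k) - real n * u" .
    have "(\<Sum>k\<in>F. c k * Z k)\<^sup>2 = (\<Sum>k\<in>F. (c k / sqrt (w k)) * (sqrt (w k) * Z k))\<^sup>2"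
    proof -
      have "sqrt (w k) \<noteq> 0" if "k \<in> F" for k using w(1)[OF that] by auto
      then show ?thesis by (intro arg_cong[where f = "\<lambda>x. x\<^sup>2"] sum.cong) auto
    qed
    also have "\<dots> \<le> (\<Sum>k\<in>F. (c k / sqrt (w k))\<^sup>2) * (\<Sum>k\<in>F. (sqrt (w k) * Z k)\<^sup>2)"
      by (rule Cauchy_Schwarz_ineq_sum)
    also have "(\<Sum>k\<in>F. (c k / sqrt (w k))\<^sup>2) = (\<Sum>k\<in>F. (1 / w k) * (c k)\<^sup>2)"
      using w(1) by (intro sum.cong) (auto simp: power_divide abs_of_nonneg order_trans[OF zero_le_one])
    also have "(\<Sum>k\<in>F. (sqrt (w k) * Z k)\<^sup>2) = chi_square w p0 d n F \<omega>"
      unfolding chi_square_def Z_def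
      using w(1) by (intro sum.cong) (auto simp: power_mult_distrib abs_of_nonneg order_trans[OF zero_le_one])
    also have "(\<Sum>k\<in>F. (1 / w k) * (c k)\<^sup>2) * chi_square w p0 d n F \<omega> \<le> H powr (2 / r - 1) * (m * real n)"
    proof (intro mult_mono cw chi)
      have "0 \<le> w k" if "k \<in> F" for k using w(1)[OF that] by simp
      then show "0 \<le> chi_square w p0 d n F \<omega>" by (auto simp: chi_square_def intro!: sum_nonneg)
    qed simp
    also have "\<dots> = (4 * H powr (2 / r - 1) * m) * (real n / 4)" by simp
    also have "\<dots> \<le> (real n * v\<^sup>2) * (real n / 4)" using v3 by (intro mult_right_mono) auto
    also have "\<dots> = (real n * v / 2)\<^sup>2" by (simp add: power2_eq_square)
    also have "\<dots> \<le> (real n * u / 2)\<^sup>2" using vu v by (intro power_mono divide_right_mono mult_left_mono) auto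
    finally have "(\<Sum>k\<in>F. c k * Z k) \<le> real n * u / 2" 
      by (rule power2_le_imp_le) (use u in auto)
    then show ?thesis unfolding 1 by simp
  qed
  \<comment> \<open>\<open>u / (4 * V)\<close> minimises
    \<open>n * t\<^sup>2 * V - t * (n * u / 2)\<close>; the minimum with \<open>1 / 2\<close>
    respects the range of the Chernoff bound. The two cases are settled by \<open>v1\<close> and
    \<open>v2\<close>.\<close>
  define t where "t = min (1 / 2) (u / (4 * V))"
  have t: "0 \<le> t" "t \<le> 1 / 2" "t \<le> u / (4 * V)" using u V by (auto simp: t_def)
  have "(\<integral>\<^sup>+\<omega>\<in>{\<omega>. chi_square w p0 d n F \<omega> \<le> m * real n}. ennreal (lratio p0 n p \<omega>) \<partial>PiM UNIV (\<lambda>_. law p0)) \<le>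
     (\<integral>\<^sup>+\<omega>\<in>{\<omega>. (\<Sum>i<n. f (\<omega> i) - (\<integral>x. p x * f x \<partial>lborel)) \<le> - (real n * u / 2)}. ennreal (lratio p0 n p \<omega>) \<partial>PiM UNIV (\<lambda>_. law p0))"
    using sub by (intro nn_integral_mono mult_left_mono) (auto simp: indicator_def)
  also have "\<dots> \<le> ennreal (exp (real n * t\<^sup>2 * V - t * (real n * u / 2)))"
    by (rule chernoff_lower_tail[OF p p0 _ f1 var t(1,2)]) measurable
  also have "\<dots> \<le> ennreal (exp (- R))"
  proof (intro ennreal_leI, subst exp_le_cancel_iff)
    have "t * V \<le> u / (4 * V) * V" using t V by (intro mult_right_mono) auto
    then have "t * V \<le> u / 4" using V by simp
    then have "real n * t * (t * V) \<le> real n * t * (u / 4)" using t by (intro mult_left_mono) auto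
    then have 1: "real n * t\<^sup>2 * V - t * (real n * u / 2) \<le> - (real n * t * u / 4)"
      by (simp add: power2_eq_square algebra_simps)
    have "4 * R \<le> real n * t * u"
    proof (cases "u / (4 * V) \<le> 1 / 2")
      case True
      have "16 * R * V \<le> real n * u\<^sup>2"
        using v1 vu v by (intro order_trans[OF v1[folded V_def]] mult_left_mono power_mono) auto
      then have "16 * R * V / (4 * V) \<le> real n * u\<^sup>2 / (4 * V)" using V by (intro divide_right_mono) auto
      moreover have "t = u / (4 * V)" unfolding t_def using True by (rule min_absorb2)
      ultimately show ?thesis using V by (simp add: power2_eq_square)
    next
      case False
      have "8 * R \<le> real n * u" using v2 vu by (intro order_trans[OF v2] mult_left_mono) auto
      then show ?thesis using False by (simp add: t_def min_def)
    qed
    then show "real n * t\<^sup>2 * V - t * (real n * u / 2) \<le> - R" using 1 by linarith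
  qed
  finally show ?thesis .
qed

section \<open>Errors of the first kind\<close>

context sequence_space
begin

text \<open>Here the new observation is integrated first, with the others fixed, so that terms
  linear in a centred increment vanish in the inner integral.\<close>

lemma integral_sequence_Cons:
  fixes f :: "(nat \<Rightarrow> 'a) \<Rightarrow> real"
  assumes f [measurable]: "f \<in> borel_measurable S" and b: "\<And>\<omega>. \<bar>f \<omega>\<bar> \<le> b"
  shows "(\<integral>\<omega>. f \<omega> \<partial>S) = (\<integral>\<omega>. (\<integral>x. f (case_nat x \<omega>) \<partial>M) \<partial>S)"
    "integrable S (\<lambda>\<omega>. \<integral>x. f (case_nat x \<omega>) \<partial>M)"
proof -
  interpret MS: pair_prob_space M S ..
  have m [measurable]: "(\<lambda>(x, \<omega>). f (case_nat x \<omega>)) \<in> borel_measurable (M \<Otimes>\<^sub>M S)"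
    using measurable_compose[OF measurable_case_nat_pair f] by (simp add: split_beta')
  have "(\<integral>\<omega>. f \<omega> \<partial>S) = (\<integral>\<omega>. f \<omega> \<partial>distr (M \<Otimes>\<^sub>M S) S (\<lambda>(x, \<omega>). case_nat x \<omega>))"
    by (simp add: PiM_iter)
  also have "\<dots> = (\<integral>z. f (case z of (x, \<omega>) \<Rightarrow> case_nat x \<omega>) \<partial>(M \<Otimes>\<^sub>M S))"
    by (intro integral_distr measurable_case_nat_pair f)
  also have "\<dots> = (\<integral>z. (case z of (x, \<omega>) \<Rightarrow> f (case_nat x \<omega>)) \<partial>(M \<Otimes>\<^sub>M S))"
    by (intro Bochner_Integration.integral_cong) (auto simp: split_beta')
  finally have 1: "(\<integral>\<omega>. f \<omega> \<partial>S) = (\<integral>z. (case z of (x, \<omega>) \<Rightarrow> f (case_nat x \<omega>)) \<partial>(M \<Otimes>\<^sub>M S))" .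
  have int: "integrable (M \<Otimes>\<^sub>M S) (\<lambda>(x, \<omega>). f (case_nat x \<omega>))"
    by (rule MS.integrable_const_bound[where B = b]) (use b in \<open>auto simp: split_beta'\<close>)
  show "(\<integral>\<omega>. f \<omega> \<partial>S) = (\<integral>\<omega>. (\<integral>x. f (case_nat x \<omega>) \<partial>M) \<partial>S)"
    unfolding 1 by (rule MS.integral_snd[OF int, symmetric])
  show "integrable S (\<lambda>\<omega>. \<integral>x. f (case_nat x \<omega>) \<partial>M)"
    by (rule MS.integrable_snd[OF int])
qed

end

section \<open>Moments of the cell counts under p0\<close>

locale multinomial_cells =
  fixes T :: "real set" and p0 :: "real \<Rightarrow> real" and d :: nat
  assumes p0: "density_on T p0"
begin

sublocale sequence_space "law p0"
  using p0 by (rule sequence_space_law)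

lemmas integrable_law_const_bound =
  finite_measure.integrable_const_bound[OF prob_space.finite_measure[OF prob_space_law[OF p0]]]

lemma measure_law_UNIV: "measure (law p0) UNIV = 1"
  using prob_space.prob_space[OF prob_space_law[OF p0]] by simp

abbreviation "q k \<equiv> cell_prob p0 d k"

definition y :: "int \<Rightarrow> real \<Rightarrow> real" where "y k x = indicat_real (cell d k) x - q k"

definition Z :: "nat \<Rightarrow> int \<Rightarrow> (nat \<Rightarrow> real) \<Rightarrow> real" where "Z n k \<omega> = (\<Sum>i<n. y k (\<omega> i))"

lemma y_measurable [measurable]: "y k \<in> borel_measurable borel"
  unfolding y_def by measurable

lemma Z_measurable [measurable]: "Z n k \<in> borel_measurable S"
  unfolding Z_def by measurable

lemma q_nonneg: "0 \<le> q k" by (rule cell_prob_nonneg[OF p0])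

lemma q_le_1: "q k \<le> 1" using sum_cell_prob_le[OF p0, of "{k}"] by simp

lemma y_bounded: "\<bar>y k x\<bar> \<le> 1"
  using q_nonneg[of k] q_le_1[of k] by (auto simp: y_def indicator_def)

lemma Z_bounded: "\<bar>Z n k \<omega>\<bar> \<le> real n"
proof -
  have "\<bar>Z n k \<omega>\<bar> \<le> (\<Sum>i<n. 1)" unfolding Z_def by (rule order_trans[OF sum_abs sum_mono]) (rule y_bounded)
  then show ?thesis by simp
qed

lemma Z_Cons: "Z (Suc n) k (case_nat x \<omega>) = y k x + Z n k \<omega>"
  unfolding Z_def by (simp add: sum.lessThan_Suc_shift del: sum.lessThan_Suc)

lemma integrable_law_bounded:
  fixes f :: "real \<Rightarrow> real"
  assumes "f \<in> borel_measurable borel" "\<And>x. \<bar>f x\<bar> \<le> b"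
  shows "integrable (law p0) f"
  by (rule integrable_law_const_bound[where B = b]) (use assms in auto)

lemma integral_indicator_cell: "(\<integral>x. indicat_real (cell d k) x \<partial>law p0) = q k"
proof -
  have [measurable]: "p0 \<in> borel_measurable borel" by (rule density_onD(1)[OF p0])
  show ?thesis
    unfolding law_def cell_prob_def using density_onD(2)[OF p0]
    by (subst integral_density) (auto simp: mult.commute)
qed

lemma measure_law_cell: "measure (law p0) (cell d k) = q k"
  using integral_indicator_cell[of k] by simp

lemma integrable_indicator_cell: "integrable (law p0) (indicat_real (cell d k))"
  by (rule integrable_law_bounded[where b = 1]) auto

lemma integrable_y: "integrable (law p0) (y k)"
  by (rule integrable_law_bounded[OF _ y_bounded]) measurable

lemma integral_y: "(\<integral>x. y k x \<partial>law p0) = 0"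
  unfolding y_def using integrable_indicator_cell[of k] measure_law_cell[of k]
  by (subst Bochner_Integration.integral_diff) (auto simp: measure_law_UNIV)

lemma integrable_y2: "integrable (law p0) (\<lambda>x. (y k x)\<^sup>2)"
  by (rule integrable_law_bounded[where b = 1]) (use y_bounded in \<open>auto simp: abs_square_le_1\<close>)

definition sigma2 :: "int \<Rightarrow> real" where "sigma2 k = (\<integral>x. (y k x)\<^sup>2 \<partial>law p0)"

lemma sigma2_le: "sigma2 k \<le> q k" and sigma2_nonneg: "0 \<le> sigma2 k"
proof -
  have "(y k x)\<^sup>2 = (1 - 2 * q k) * indicat_real (cell d k) x + (q k)\<^sup>2" for x
    by (auto simp: y_def indicator_def power2_eq_square algebra_simps)
  then have "sigma2 k = (\<integral>x. (1 - 2 * q k) * indicat_real (cell d k) x + (q k)\<^sup>2 \<partial>law p0)"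
    unfolding sigma2_def by simp
  also have "\<dots> = (1 - 2 * q k) * q k + (q k)\<^sup>2"
    using integrable_indicator_cell[of k] measure_law_cell[of k]
    by (subst Bochner_Integration.integral_add) (auto simp: measure_law_UNIV)
  also have "\<dots> = q k - (q k)\<^sup>2" by (simp add: power2_eq_square algebra_simps)
  finally show "sigma2 k \<le> q k" by simp
  show "0 \<le> sigma2 k" unfolding sigma2_def by (intro integral_nonneg_AE) auto
qed

lemma integrable_S_bounded:
  fixes f :: "(nat \<Rightarrow> real) \<Rightarrow> real"
  assumes "f \<in> borel_measurable S" "\<And>x. \<bar>f x\<bar> \<le> b"
  shows "integrable S f"
  by (rule P.integrable_const_bound[where B = b]) (use assms in auto)

lemma Z2_bounded: "\<bar>(Z n k \<omega>)\<^sup>2\<bar> \<le> (real n)\<^sup>2"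
  using Z_bounded[of n k \<omega>] by (simp add: abs_le_square_iff[symmetric])

lemma integrable_Z2: "integrable S (\<lambda>\<omega>. (Z n k \<omega>)\<^sup>2)"
  by (rule integrable_S_bounded[OF _ Z2_bounded]) measurable

text \<open>Prepending an observation adds \<open>y k x\<close>, whose cross term with the remaining
  sum vanishes in the inner integral.\<close>

lemma expectation_Z2: "(\<integral>\<omega>. (Z n k \<omega>)\<^sup>2 \<partial>S) = real n * sigma2 k"
proof (induction n)
  case (Suc n)
  have "(\<integral>\<omega>. (Z (Suc n) k \<omega>)\<^sup>2 \<partial>S) = (\<integral>\<omega>. (\<integral>x. (Z (Suc n) k (case_nat x \<omega>))\<^sup>2 \<partial>law p0) \<partial>S)"
    by (rule integral_sequence_Cons(1)[OF _ Z2_bounded]) measurable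
  also have "\<dots> = (\<integral>\<omega>. sigma2 k + (Z n k \<omega>)\<^sup>2 \<partial>S)"
  proof (intro Bochner_Integration.integral_cong refl)
    fix \<omega> :: "nat \<Rightarrow> real"
    have "(\<integral>x. (Z (Suc n) k (case_nat x \<omega>))\<^sup>2 \<partial>law p0) =
        (\<integral>x. (y k x)\<^sup>2 + (2 * Z n k \<omega> * y k x + (Z n k \<omega>)\<^sup>2) \<partial>law p0)"
      unfolding Z_Cons by (simp add: power2_sum algebra_simps)
    also have "\<dots> = sigma2 k + (Z n k \<omega>)\<^sup>2"
      using integrable_y2[of k] integrable_y[of k] integral_y[of k]
      by (simp add: sigma2_def measure_law_UNIV)
    finally show "(\<integral>x. (Z (Suc n) k (case_nat x \<omega>))\<^sup>2 \<partial>law p0) = sigma2 k + (Z n k \<omega>)\<^sup>2" .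
  qed
  also have "\<dots> = real (Suc n) * sigma2 k"
    using integrable_Z2[of n k] by (simp add: Suc P.prob_space algebra_simps)
  finally show ?case .
qed (simp add: Z_def)

lemma chi_square_eq: "chi_square w p0 d n F \<omega> = (\<Sum>k\<in>F. w k * (Z n k \<omega>)\<^sup>2)"
  by (simp add: chi_square_def Z_def y_def)

lemma chi_square_measurable [measurable]: "chi_square w p0 d n F \<in> borel_measurable S"
  unfolding chi_square_eq[abs_def] by measurable

lemma expectation_chi_square: "(\<integral>\<omega>. chi_square w p0 d n F \<omega> \<partial>S) = real n * (\<Sum>k\<in>F. w k * sigma2 k)"
  unfolding chi_square_eq
  by (simp add: Bochner_Integration.integral_sum integrable_Z2 expectation_Z2 sum_distrib_left mult.left_commute)

lemma integrable_chi_square: "integrable S (chi_square w p0 d n F)"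
  unfolding chi_square_eq[abs_def] by (intro Bochner_Integration.integrable_sum integrable_mult_right integrable_Z2)

text \<open>Serves the far cells, where the weights have no uniform bound and only the mean of the
  statistic is controlled.\<close>

lemma prob_chi_square_markov:
  assumes F: "finite F" and w: "\<And>k. k \<in> F \<Longrightarrow> 0 \<le> w k" and n: "0 < n"
  shows "measure S {\<omega> \<in> space S. real n \<le> chi_square w p0 d n F \<omega>} \<le> (\<Sum>k\<in>F. w k * q k)"
proof -
  have "measure S {\<omega> \<in> space S. real n \<le> chi_square w p0 d n F \<omega>} \<le> (\<integral>\<omega>. chi_square w p0 d n F \<omega> \<partial>S) / real n"
    using n w by (intro integral_Markov_inequality_measure[where A = "space S"] integrable_chi_square)
      (auto simp: chi_square_def intro!: sum_nonneg)
  also have "\<dots> = (\<Sum>k\<in>F. w k * sigma2 k)" using n by (simp add: expectation_chi_square)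
  also have "\<dots> \<le> (\<Sum>k\<in>F. w k * q k)" by (intro sum_mono mult_left_mono sigma2_le w)
  finally show ?thesis .
qed

text \<open>An observation lies in at most one cell of \<open>F\<close>, and the cell probabilities
  add up to at most 1; each of these two contributes at most \<open>W\<close>.\<close>

lemma weighted_y2_le:
  assumes F: "finite F" and w: "\<And>k. k \<in> F \<Longrightarrow> 0 \<le> w k" "\<And>k. k \<in> F \<Longrightarrow> w k \<le> W" and W: "0 \<le> W"
  shows "(\<Sum>k\<in>F. w k * (y k x)\<^sup>2) \<le> 2 * W"
proof -
  have "(\<Sum>k\<in>F. w k * (y k x)\<^sup>2) \<le> (\<Sum>k\<in>F. W * (1 * indicat_real (cell d k) x + q k))"
  proof (intro sum_mono mult_mono w)
    fix k
    have "(q k)\<^sup>2 \<le> q k" using q_nonneg[of k] q_le_1[of k] by (simp add: power2_eq_square mult_left_le)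
    moreover have "(y k x)\<^sup>2 = indicat_real (cell d k) x * (1 - 2 * q k) + (q k)\<^sup>2"
      by (auto simp: y_def indicator_def power2_eq_square algebra_simps)
    moreover have "indicat_real (cell d k) x * (1 - 2 * q k) \<le> indicat_real (cell d k) x * 1"
      using q_nonneg[of k] by (intro mult_left_mono) auto
    ultimately show "(y k x)\<^sup>2 \<le> 1 * indicat_real (cell d k) x + q k" by simp
  qed (use W in auto)
  also have "\<dots> = W * ((\<Sum>k\<in>F. 1 * indicat_real (cell d k) x) + (\<Sum>k\<in>F. q k))"
    by (simp add: sum_distrib_left sum.distrib distrib_left)
  also have "\<dots> \<le> W * (1 + 1)"
    using sum_cell_prob_le[OF p0 F] W unfolding sum_indicator_cell[OF F, where g = "\<lambda>_. 1"]
    by (intro mult_left_mono add_mono) auto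
  finally show ?thesis by simp
qed

text \<open>The variance is at most the second moment, which has no cross terms since the cells are
  disjoint. Only one factor \<open>w k * q k\<close> is estimated by \<open>W * b\<close>; what
  remains has the shape of the statistic itself, and this closes the recursion for its
  variance.\<close>

lemma weighted_variance_le:
  assumes F: "finite F" and b: "\<And>k. k \<in> F \<Longrightarrow> q k \<le> b" and w: "\<And>k. k \<in> F \<Longrightarrow> 0 \<le> w k" "\<And>k. k \<in> F \<Longrightarrow> w k \<le> W"
    and W: "0 \<le> W"
  shows "(\<integral>x. (\<Sum>k\<in>F. w k * z k * y k x)\<^sup>2 \<partial>law p0) \<le> W * b * (\<Sum>k\<in>F. w k * (z k)\<^sup>2)"
proof -
  define g where "g = (\<lambda>x. \<Sum>k\<in>F. w k * z k * indicat_real (cell d k) x)"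
  define G where "G = (\<Sum>k\<in>F. \<bar>w k * z k\<bar>)"
  have [measurable]: "g \<in> borel_measurable borel" unfolding g_def by measurable
  have gb: "\<bar>g x\<bar> \<le> G" for x
    unfolding g_def G_def by (rule order_trans[OF sum_abs sum_mono]) (auto simp: abs_mult indicator_def)
  have gi: "integrable (law p0) g" by (rule integrable_law_bounded[OF _ gb]) measurable
  have g2: "integrable (law p0) (\<lambda>x. (g x)\<^sup>2)"
    by (rule integrable_law_bounded[where b = "G\<^sup>2"]) (use gb in \<open>auto simp: abs_le_square_iff[symmetric] intro: order_trans[OF gb abs_ge_self]\<close>)
  define m where "m = (\<Sum>k\<in>F. w k * z k * q k)"
  have gm: "(\<integral>x. g x \<partial>law p0) = m"
    unfolding g_def m_def
    by (subst Bochner_Integration.integral_sum) (auto simp: integrable_indicator_cell measure_law_cell intro!: sum.cong)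
  have "(\<integral>x. (\<Sum>k\<in>F. w k * z k * y k x)\<^sup>2 \<partial>law p0) = (\<integral>x. (g x)\<^sup>2 + (- 2 * m * g x + m\<^sup>2) \<partial>law p0)"
  proof (intro Bochner_Integration.integral_cong refl)
    fix x
    have "(\<Sum>k\<in>F. w k * z k * y k x) = g x - m"
      by (simp add: g_def m_def y_def right_diff_distrib sum_subtractf)
    then show "(\<Sum>k\<in>F. w k * z k * y k x)\<^sup>2 = (g x)\<^sup>2 + (- 2 * m * g x + m\<^sup>2)"
      by (simp add: power2_diff)
  qed
  also have "\<dots> = (\<integral>x. (g x)\<^sup>2 \<partial>law p0) - m\<^sup>2"
    using gi g2 by (simp add: gm measure_law_UNIV power2_eq_square)
  also have "\<dots> \<le> (\<integral>x. (g x)\<^sup>2 \<partial>law p0)" by simp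
  also have "\<dots> = (\<integral>x. (\<Sum>k\<in>F. (w k * z k)\<^sup>2 * indicat_real (cell d k) x) \<partial>law p0)"
    unfolding g_def sum_indicator_cell[OF F] by (intro Bochner_Integration.integral_cong) auto
  also have "\<dots> = (\<Sum>k\<in>F. (w k * z k)\<^sup>2 * q k)"
    by (subst Bochner_Integration.integral_sum) (auto simp: integrable_indicator_cell measure_law_cell intro!: sum.cong)
  also have "\<dots> \<le> (\<Sum>k\<in>F. W * b * (w k * (z k)\<^sup>2))"
  proof (intro sum_mono)
    fix k assume k: "k \<in> F"
    have "(w k * z k)\<^sup>2 * q k = (w k * q k) * (w k * (z k)\<^sup>2)" by (simp add: power2_eq_square)
    also have "\<dots> \<le> (W * b) * (w k * (z k)\<^sup>2)"
      using w(1)[OF k] w(2)[OF k] b[OF k] q_nonneg[of k] W by (intro mult_right_mono mult_mono) auto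
    finally show "(w k * z k)\<^sup>2 * q k \<le> W * b * (w k * (z k)\<^sup>2)" .
  qed
  finally show ?thesis by (simp add: sum_distrib_left)
qed

text \<open>
  Prepending an observation adds the increment \<open>G\<close> below, which has mean zero given the others, so
  that the second moments add up.
\<close>

lemma chi_square_variance:
  assumes F: "finite F" and b: "\<And>k. k \<in> F \<Longrightarrow> q k \<le> b" and w: "\<And>k. k \<in> F \<Longrightarrow> 0 \<le> w k" "\<And>k. k \<in> F \<Longrightarrow> w k \<le> W"
    and W: "0 \<le> W" and b0: "0 \<le> b"
  defines "\<mu> \<equiv> \<Sum>k\<in>F. w k * sigma2 k"
  shows "(\<integral>\<omega>. (chi_square w p0 d n F \<omega> - real n * \<mu>)\<^sup>2 \<partial>S) \<le> 8 * W * b * \<mu> * (real n)\<^sup>2 + 8 * W\<^sup>2 * real n"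
proof (induction n)
  case 0
  then show ?case by (simp add: chi_square_def)
next
  case (Suc n)
  let ?X = "\<lambda>n \<omega>. chi_square w p0 d n F \<omega>"
  have \<mu>0: "0 \<le> \<mu>" unfolding \<mu>_def by (intro sum_nonneg mult_nonneg_nonneg w sigma2_nonneg)
  define B where "B = (\<lambda>n. (\<Sum>k\<in>F. w k * (real n)\<^sup>2) + real n * \<mu>)"
  have Xb: "\<bar>?X n \<omega> - real n * \<mu>\<bar> \<le> B n" for n \<omega>
  proof -
    have "0 \<le> ?X n \<omega>" unfolding chi_square_eq by (intro sum_nonneg mult_nonneg_nonneg w) auto
    moreover have "?X n \<omega> \<le> (\<Sum>k\<in>F. w k * (real n)\<^sup>2)" unfolding chi_square_eq
      using Z2_bounded[of n _ \<omega>] by (intro sum_mono mult_left_mono w) auto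
    ultimately show ?thesis using \<mu>0 mult_nonneg_nonneg[of "real n" \<mu>] unfolding B_def by linarith
  qed
  have X2b: "\<bar>(?X n \<omega> - real n * \<mu>)\<^sup>2\<bar> \<le> (B n)\<^sup>2" for n \<omega>
    using Xb[of n \<omega>] by (simp add: abs_le_square_iff[symmetric])
  have inner: "(\<integral>x. (?X (Suc n) (case_nat x \<omega>) - real (Suc n) * \<mu>)\<^sup>2 \<partial>law p0) \<le>
      (?X n \<omega> - real n * \<mu>)\<^sup>2 + 8 * W * b * ?X n \<omega> + 8 * W\<^sup>2" for \<omega>
  proof -
    define D where "D = ?X n \<omega> - real n * \<mu>"
    define u where "u = (\<lambda>x. \<Sum>k\<in>F. w k * Z n k \<omega> * y k x)"
    define v where "v = (\<lambda>x. \<Sum>k\<in>F. w k * (y k x)\<^sup>2)"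
    have [measurable]: "u \<in> borel_measurable borel" "v \<in> borel_measurable borel"
      unfolding u_def v_def by measurable
    have vb: "\<bar>v x\<bar> \<le> 2 * W" for x
      using weighted_y2_le[OF F w W, where x = x] w(1) unfolding v_def by (subst abs_of_nonneg) (auto intro!: sum_nonneg)
    define U where "U = (\<Sum>k\<in>F. \<bar>w k * Z n k \<omega>\<bar>)"
    have ub: "\<bar>u x\<bar> \<le> U" for x unfolding u_def U_def
      by (rule order_trans[OF sum_abs sum_mono]) (use y_bounded in \<open>auto simp: abs_mult intro!: mult_left_le\<close>)
    have ui: "integrable (law p0) u" by (rule integrable_law_bounded[OF _ ub]) measurable
    have vi: "integrable (law p0) v" by (rule integrable_law_bounded[OF _ vb]) measurable
    have u2: "integrable (law p0) (\<lambda>x. (u x)\<^sup>2)"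
      by (rule integrable_law_bounded[where b = "U\<^sup>2"]) (use ub in \<open>auto simp: abs_le_square_iff[symmetric] intro: order_trans[OF ub abs_ge_self]\<close>)
    have v2b: "(v x)\<^sup>2 \<le> 4 * W\<^sup>2" for x
      using power_mono[OF vb[of x], of 2] by (simp add: power_mult_distrib)
    have v2: "integrable (law p0) (\<lambda>x. (v x)\<^sup>2)"
      by (rule integrable_law_bounded[where b = "4 * W\<^sup>2"]) (use v2b in auto)
    have uE: "(\<integral>x. u x \<partial>law p0) = 0" unfolding u_def
      by (simp add: Bochner_Integration.integral_sum integrable_y integral_y)
    have vE: "(\<integral>x. v x \<partial>law p0) = \<mu>" unfolding v_def \<mu>_def
      by (simp add: Bochner_Integration.integral_sum integrable_y2 sigma2_def)
    define G where "G = (\<lambda>x. 2 * u x + v x - \<mu>)"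
    \<comment> \<open>From \<open>(a + b)\<^sup>2 \<le> 2 * a\<^sup>2 + 2 * b\<^sup>2\<close> with
      \<open>a = 2 * u x\<close> and \<open>b = v x - \<mu>\<close>.\<close>
    have G2le: "(G x)\<^sup>2 \<le> 8 * (u x)\<^sup>2 + 2 * (v x - \<mu>)\<^sup>2" for x
    proof -
      have "0 \<le> (2 * u x - (v x - \<mu>))\<^sup>2" by simp
      then show ?thesis unfolding G_def by (simp add: power2_eq_square algebra_simps)
    qed
    have vv: "(v x - \<mu>)\<^sup>2 = (v x)\<^sup>2 + (- 2 * \<mu> * v x + \<mu>\<^sup>2)" for x by (simp add: power2_diff)
    have vvi: "integrable (law p0) (\<lambda>x. (v x - \<mu>)\<^sup>2)" unfolding vv using v2 vi by simp
    have Gb: "(G x)\<^sup>2 \<le> (2 * U + 2 * W + \<mu>)\<^sup>2" for x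
    proof -
      have "\<bar>G x\<bar> \<le> 2 * U + 2 * W + \<mu>" unfolding G_def using ub[of x] vb[of x] \<mu>0 by linarith
      then show ?thesis by (metis abs_le_square_iff abs_of_nonneg order_trans abs_ge_zero)
    qed
    have [measurable]: "G \<in> borel_measurable borel" unfolding G_def by measurable
    have G2: "integrable (law p0) (\<lambda>x. (G x)\<^sup>2)"
      by (rule integrable_law_bounded[where b = "(2 * U + 2 * W + \<mu>)\<^sup>2"]) (use Gb in auto)
    have GE: "(\<integral>x. G x \<partial>law p0) = 0" "integrable (law p0) G"
      unfolding G_def using ui vi uE vE by (auto simp: measure_law_UNIV)
    have "?X (Suc n) (case_nat x \<omega>) - real (Suc n) * \<mu> = D + G x" for x
    proof -
      have "?X (Suc n) (case_nat x \<omega>) = (\<Sum>k\<in>F. w k * (Z n k \<omega>)\<^sup>2 + 2 * (w k * Z n k \<omega> * y k x) + w k * (y k x)\<^sup>2)"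
        unfolding chi_square_eq Z_Cons by (intro sum.cong) (auto simp: power2_eq_square algebra_simps)
      also have "\<dots> = ?X n \<omega> + 2 * u x + v x"
        unfolding chi_square_eq u_def v_def by (simp add: sum.distrib sum_distrib_left)
      finally show ?thesis by (simp add: D_def G_def algebra_simps)
    qed
    then have "(\<integral>x. (?X (Suc n) (case_nat x \<omega>) - real (Suc n) * \<mu>)\<^sup>2 \<partial>law p0) = (\<integral>x. D\<^sup>2 + 2 * D * G x + (G x)\<^sup>2 \<partial>law p0)"
      by (simp add: power2_sum algebra_simps)
    also have "\<dots> = D\<^sup>2 + (\<integral>x. (G x)\<^sup>2 \<partial>law p0)"
      using G2 GE by (simp add: measure_law_UNIV)
    also have "(\<integral>x. (G x)\<^sup>2 \<partial>law p0) \<le> (\<integral>x. 8 * (u x)\<^sup>2 + 2 * (v x - \<mu>)\<^sup>2 \<partial>law p0)"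
      by (intro integral_mono G2 G2le Bochner_Integration.integrable_add integrable_mult_right u2 vvi)
    also have "\<dots> = 8 * (\<integral>x. (u x)\<^sup>2 \<partial>law p0) + 2 * (\<integral>x. (v x - \<mu>)\<^sup>2 \<partial>law p0)"
      using u2 vvi by simp
    also have "(\<integral>x. (v x - \<mu>)\<^sup>2 \<partial>law p0) = (\<integral>x. (v x)\<^sup>2 \<partial>law p0) - \<mu>\<^sup>2"
      unfolding vv using v2 vi vE by (simp add: measure_law_UNIV power2_eq_square)
    also have "(\<integral>x. (v x)\<^sup>2 \<partial>law p0) \<le> (\<integral>x. 4 * W\<^sup>2 \<partial>law p0)"
      by (intro integral_mono v2 v2b) simp
    also have "(\<integral>x. 4 * W\<^sup>2 \<partial>law p0) = 4 * W\<^sup>2" by (simp add: measure_law_UNIV)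
    also have "(\<integral>x. (u x)\<^sup>2 \<partial>law p0) \<le> W * b * ?X n \<omega>"
      unfolding u_def chi_square_eq by (rule weighted_variance_le[OF F b w W])
    finally show ?thesis unfolding D_def by (simp add: algebra_simps) (use zero_le_power2[of \<mu>] in linarith)
  qed
  have mX: "(\<lambda>\<omega>. (?X n \<omega> - real n * \<mu>)\<^sup>2) \<in> borel_measurable S" for n by measurable
  have "(\<integral>\<omega>. (?X (Suc n) \<omega> - real (Suc n) * \<mu>)\<^sup>2 \<partial>S) = (\<integral>\<omega>. (\<integral>x. (?X (Suc n) (case_nat x \<omega>) - real (Suc n) * \<mu>)\<^sup>2 \<partial>law p0) \<partial>S)"
    by (rule integral_sequence_Cons(1)[OF mX X2b])
  also have "\<dots> \<le> (\<integral>\<omega>. (?X n \<omega> - real n * \<mu>)\<^sup>2 + 8 * W * b * ?X n \<omega> + 8 * W\<^sup>2 \<partial>S)"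
    by (intro integral_mono inner integral_sequence_Cons(2)[OF mX X2b] Bochner_Integration.integrable_add
        integrable_mult_right integrable_chi_square integrable_S_bounded[OF mX X2b]) simp
  also have "\<dots> = (\<integral>\<omega>. (?X n \<omega> - real n * \<mu>)\<^sup>2 \<partial>S) + 8 * W * b * (real n * \<mu>) + 8 * W\<^sup>2"
    using integrable_S_bounded[OF mX X2b, of n] integrable_chi_square[of w n F]
    by (simp add: expectation_chi_square \<mu>_def[symmetric] P.prob_space)
  also have "\<dots> \<le> (8 * W * b * \<mu> * (real n)\<^sup>2 + 8 * W\<^sup>2 * real n) + 8 * W * b * (real n * \<mu>) + 8 * W\<^sup>2"
    using Suc by simp
  \<comment> \<open>The increment \<open>8 * W * b * \<mu> * n\<close> comes from the mean of the
    statistic and is absorbed by \<open>n\<^sup>2 + n \<le> (n + 1)\<^sup>2\<close>.\<close>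
  also have "\<dots> \<le> 8 * W * b * \<mu> * (real (Suc n))\<^sup>2 + 8 * W\<^sup>2 * real (Suc n)"
  proof -
    have "8 * W * b * \<mu> * ((real n)\<^sup>2 + real n) \<le> 8 * W * b * \<mu> * (real (Suc n))\<^sup>2"
      using W b0 \<mu>0 by (intro mult_left_mono) (auto simp: power2_eq_square algebra_simps)
    then show ?thesis by (simp add: algebra_simps)
  qed
  finally show ?case .
qed

text \<open>The mean is at most \<open>n * m\<close>, so exceeding \<open>n * (m + 1)\<close> is a
  deviation of at least \<open>n\<close>. For fixed \<open>W\<close> and \<open>m\<close> the bound
  vanishes as the cells shrink, which makes \<open>b\<close> small, and \<open>n\<close>
  grows.\<close>

lemma prob_chi_square_chebyshev:
  assumes F: "finite F" and b: "\<And>k. k \<in> F \<Longrightarrow> q k \<le> b" and w: "\<And>k. k \<in> F \<Longrightarrow> 0 \<le> w k" "\<And>k. k \<in> F \<Longrightarrow> w k \<le> W"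
    and W: "0 \<le> W" and b0: "0 \<le> b" and n: "0 < n" and m: "(\<Sum>k\<in>F. w k * q k) \<le> m"
  shows "measure S {\<omega> \<in> space S. real n * (m + 1) \<le> chi_square w p0 d n F \<omega>} \<le> 8 * W * b * m + 8 * W\<^sup>2 / real n"
proof -
  define \<mu> where "\<mu> = (\<Sum>k\<in>F. w k * sigma2 k)"
  have \<mu>: "0 \<le> \<mu>" "\<mu> \<le> m"
    unfolding \<mu>_def using w(1) sigma2_nonneg by (auto intro!: sum_nonneg order_trans[OF sum_mono m] mult_left_mono sigma2_le)
  have int: "integrable S (\<lambda>\<omega>. (chi_square w p0 d n F \<omega> - real n * \<mu>)\<^sup>2)"
  proof (rule integrable_S_bounded)
    fix \<omega>
    have "0 \<le> chi_square w p0 d n F \<omega>" unfolding chi_square_eq by (intro sum_nonneg mult_nonneg_nonneg w) auto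
    moreover have "chi_square w p0 d n F \<omega> \<le> (\<Sum>k\<in>F. w k * (real n)\<^sup>2)" unfolding chi_square_eq
      using Z2_bounded[of n _ \<omega>] by (intro sum_mono mult_left_mono w) auto
    ultimately have "\<bar>chi_square w p0 d n F \<omega> - real n * \<mu>\<bar> \<le> (\<Sum>k\<in>F. w k * (real n)\<^sup>2) + real n * \<mu>"
      using \<mu>(1) mult_nonneg_nonneg[of "real n" \<mu>] by linarith
    then show "\<bar>(chi_square w p0 d n F \<omega> - real n * \<mu>)\<^sup>2\<bar> \<le> ((\<Sum>k\<in>F. w k * (real n)\<^sup>2) + real n * \<mu>)\<^sup>2"
      by (simp add: abs_le_square_iff[symmetric])
  qed measurable
  have "measure S {\<omega> \<in> space S. real n * (m + 1) \<le> chi_square w p0 d n F \<omega>} \<le>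
      measure S {\<omega> \<in> space S. (real n)\<^sup>2 \<le> (chi_square w p0 d n F \<omega> - real n * \<mu>)\<^sup>2}"
  proof (intro P.finite_measure_mono subsetI CollectI conjI)
    fix \<omega> assume \<omega>: "\<omega> \<in> {\<omega> \<in> space S. real n * (m + 1) \<le> chi_square w p0 d n F \<omega>}"
    have "real n * \<mu> \<le> real n * m" using \<mu> by (intro mult_left_mono) auto
    then have "real n \<le> chi_square w p0 d n F \<omega> - real n * \<mu>" using \<omega> by (simp add: algebra_simps)
    then show "(real n)\<^sup>2 \<le> (chi_square w p0 d n F \<omega> - real n * \<mu>)\<^sup>2" by (intro power_mono) auto
  qed auto
  also have "\<dots> \<le> (\<integral>\<omega>. (chi_square w p0 d n F \<omega> - real n * \<mu>)\<^sup>2 \<partial>S) / (real n)\<^sup>2"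
    using n by (intro integral_Markov_inequality_measure[where A = "space S"] int) auto
  also have "\<dots> \<le> (8 * W * b * \<mu> * (real n)\<^sup>2 + 8 * W\<^sup>2 * real n) / (real n)\<^sup>2"
    unfolding \<mu>_def by (intro divide_right_mono chi_square_variance F b w W b0) auto
  also have "\<dots> = 8 * W * b * \<mu> + 8 * W\<^sup>2 / real n" using n by (simp add: field_simps power2_eq_square)
  also have "\<dots> \<le> 8 * W * b * m + 8 * W\<^sup>2 / real n"
    using \<mu> W b0 by (intro add_right_mono mult_left_mono) auto
  finally show ?thesis .
qed

text \<open>The rejection event is a union over all windows, because the finite set of cells that
  detects \<open>p\<close> depends on \<open>p\<close> while the event must not; the windows
  increase, so the bound for each of them passes to the union. In \<open>m + 2\<close> the cells of
  \<open>A\<close> are allowed \<open>m + 1\<close> and the others 1.\<close>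

lemma type_I_error:
  assumes A: "\<And>k. k \<in> A \<Longrightarrow> w k \<le> W" and W: "0 \<le> W" and w: "\<And>k. 0 \<le> w k" and b: "\<And>k. q k \<le> b" and n: "0 < n"
    and m: "\<And>F. finite F \<Longrightarrow> (\<Sum>k\<in>F. w k * q k) \<le> m"
    and tail: "\<And>F. finite F \<Longrightarrow> F \<inter> A = {} \<Longrightarrow> (\<Sum>k\<in>F. w k * q k) \<le> e"
  shows "measure S {\<omega> \<in> space S. \<exists>i::nat. (m + 2) * real n < chi_square w p0 d n {- int i..int i} \<omega>} \<le>
    8 * W * b * m + 8 * W\<^sup>2 / real n + e"
proof -
  let ?E = "\<lambda>i::nat. {\<omega> \<in> space S. (m + 2) * real n < chi_square w p0 d n {- int i..int i} \<omega>}"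
  have b0: "0 \<le> b" using b[of 0] q_nonneg[of 0] by linarith
  have bound: "measure S (?E i) \<le> 8 * W * b * m + 8 * W\<^sup>2 / real n + e" for i
  proof -
    let ?F = "{- int i..int i} \<inter> A" and ?G = "{- int i..int i} - A"
    have split: "chi_square w p0 d n {- int i..int i} \<omega> = chi_square w p0 d n ?F \<omega> + chi_square w p0 d n ?G \<omega>" for \<omega>
      unfolding chi_square_def by (subst sum.union_disjoint[symmetric]) (auto intro!: sum.cong)
    have "measure S (?E i) \<le> measure S ({\<omega> \<in> space S. real n * (m + 1) \<le> chi_square w p0 d n ?F \<omega>} \<union>
        {\<omega> \<in> space S. real n \<le> chi_square w p0 d n ?G \<omega>})"
      unfolding split by (intro P.finite_measure_mono) (auto simp: algebra_simps)
    also have "\<dots> \<le> measure S {\<omega> \<in> space S. real n * (m + 1) \<le> chi_square w p0 d n ?F \<omega>} +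
        measure S {\<omega> \<in> space S. real n \<le> chi_square w p0 d n ?G \<omega>}"
      by (intro measure_Un_le) auto
    also have "\<dots> \<le> (8 * W * b * m + 8 * W\<^sup>2 / real n) + (\<Sum>k\<in>?G. w k * q k)"
      using A w W b b0 n m by (intro add_mono prob_chi_square_chebyshev prob_chi_square_markov) auto
    also have "(\<Sum>k\<in>?G. w k * q k) \<le> e" by (intro tail) auto
    finally show ?thesis by simp
  qed
  have mono: "incseq ?E"
  proof (intro incseq_SucI subsetI)
    fix i \<omega> assume "\<omega> \<in> ?E i"
    moreover have "chi_square w p0 d n {- int i..int i} \<omega> \<le> chi_square w p0 d n {- int (Suc i)..int (Suc i)} \<omega>"
      unfolding chi_square_def by (intro sum_mono2) (auto simp: w)
    ultimately show "\<omega> \<in> ?E (Suc i)" by auto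
  qed
  have "(\<lambda>i. measure S (?E i)) \<longlonglongrightarrow> measure S (\<Union>i. ?E i)"
    by (rule P.finite_Lim_measure_incseq[OF _ mono]) auto
  then have "measure S (\<Union>i. ?E i) \<le> 8 * W * b * m + 8 * W\<^sup>2 / real n + e"
    by (rule LIMSEQ_le_const2) (use bound in auto)
  also have "(\<Union>i. ?E i) = {\<omega> \<in> space S. \<exists>i::nat. (m + 2) * real n < chi_square w p0 d n {- int i..int i} \<omega>}" by auto
  finally show ?thesis .
qed

end

section \<open>Posterior probabilities and tests\<close>

context sequence_space
begin

lemma nn_integral_sequence_Cons':
  assumes f [measurable]: "f \<in> borel_measurable S"
  shows "(\<integral>\<^sup>+\<omega>. f \<omega> \<partial>S) = (\<integral>\<^sup>+\<omega>. (\<integral>\<^sup>+x. f (case_nat x \<omega>) \<partial>M) \<partial>S)"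
proof -
  interpret MS: pair_prob_space M S ..
  have m: "(\<lambda>(x, \<omega>). f (case_nat x \<omega>)) \<in> borel_measurable (M \<Otimes>\<^sub>M S)"
    using measurable_compose[OF measurable_case_nat_pair f] by (simp add: split_beta')
  show ?thesis
    unfolding nn_integral_sequence_Cons[OF f] using MS.Fubini'[OF m] by simp
qed

text \<open>Log-likelihood ratios are square integrable but unbounded, so the induction runs in
  nonnegative integrals, where Fubini asks for measurability only.\<close>

lemma nn_integral_sum_square_le:
  fixes u :: "'a \<Rightarrow> real"
  assumes u: "integrable M u" "integrable M (\<lambda>x. (u x)\<^sup>2)" "(\<integral>x. u x \<partial>M) = 0"
  shows "(\<integral>\<^sup>+\<omega>. ennreal ((\<Sum>i<n. u (\<omega> i))\<^sup>2) \<partial>S) = ennreal (real n * (\<integral>x. (u x)\<^sup>2 \<partial>M))"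
proof (induction n)
  case (Suc n)
  have [measurable]: "u \<in> borel_measurable M" using u by auto
  have nn: "0 \<le> (\<integral>x. (u x)\<^sup>2 \<partial>M)" by (intro integral_nonneg_AE) auto
  have "(\<integral>\<^sup>+\<omega>. ennreal ((\<Sum>i<Suc n. u (\<omega> i))\<^sup>2) \<partial>S) = (\<integral>\<^sup>+\<omega>. (\<integral>\<^sup>+x. ennreal ((u x + (\<Sum>i<n. u (\<omega> i)))\<^sup>2) \<partial>M) \<partial>S)"
    by (subst nn_integral_sequence_Cons') (simp_all add: sum.lessThan_Suc_shift del: sum.lessThan_Suc)
  also have "\<dots> = (\<integral>\<^sup>+\<omega>. ennreal (\<integral>x. (u x)\<^sup>2 \<partial>M) + ennreal ((\<Sum>i<n. u (\<omega> i))\<^sup>2) \<partial>S)"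
  proof (rule nn_integral_cong)
    fix \<omega>
    define s where "s = (\<Sum>i<n. u (\<omega> i))"
    have eq: "(u x + s)\<^sup>2 = (u x)\<^sup>2 + (2 * s * u x + s\<^sup>2)" for x by (simp add: power2_sum)
    have "integrable M (\<lambda>x. (u x + s)\<^sup>2)" unfolding eq using u by simp
    then have "(\<integral>\<^sup>+x. ennreal ((u x + s)\<^sup>2) \<partial>M) = ennreal (\<integral>x. (u x)\<^sup>2 + (2 * s * u x + s\<^sup>2) \<partial>M)"
      unfolding eq[symmetric] by (intro nn_integral_eq_integral) auto
    also have "(\<integral>x. (u x)\<^sup>2 + (2 * s * u x + s\<^sup>2) \<partial>M) = (\<integral>x. (u x)\<^sup>2 \<partial>M) + s\<^sup>2"
      using u by (simp add: M.prob_space)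
    finally show "(\<integral>\<^sup>+x. ennreal ((u x + (\<Sum>i<n. u (\<omega> i)))\<^sup>2) \<partial>M) = ennreal (\<integral>x. (u x)\<^sup>2 \<partial>M) + ennreal ((\<Sum>i<n. u (\<omega> i))\<^sup>2)"
      using nn by (simp add: s_def)
  qed
  also have "\<dots> = ennreal (\<integral>x. (u x)\<^sup>2 \<partial>M) + ennreal (real n * (\<integral>x. (u x)\<^sup>2 \<partial>M))"
    by (subst nn_integral_add) (auto simp: Suc P.emeasure_space_1)
  also have "\<dots> = ennreal (real (Suc n) * (\<integral>x. (u x)\<^sup>2 \<partial>M))"
    using nn by (simp add: ennreal_plus[symmetric] algebra_simps del: ennreal_plus)
  finally show ?case .
qed simp

end

section \<open>The posterior at a fixed sample size\<close>

locale bayes_model =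
  fixes T :: "real set" and P :: "(real \<Rightarrow> real) set" and \<pi> :: "(real \<Rightarrow> real) measure"
    and p0 :: "real \<Rightarrow> real" and n :: nat
  assumes dens: "\<And>p. p \<in> P \<Longrightarrow> density_on T p" and p0: "density_on T p0"
    and prior: "prob_space \<pi>" "space \<pi> = P"
    and joint: "(\<lambda>(p, x). p x) \<in> borel_measurable (\<pi> \<Otimes>\<^sub>M borel)"
    and n: "0 < n"
begin

sublocale sequence_space "law p0"
  using p0 by (rule sequence_space_law)

sublocale Q: prob_space \<pi> by (rule prior)

sublocale QS: pair_sigma_finite \<pi> S ..

lemma component_measurable: "(\<lambda>\<omega>. \<omega> i) \<in> S \<rightarrow>\<^sub>M borel"
proof -
  have "(\<lambda>\<omega>. \<omega> i) \<in> S \<rightarrow>\<^sub>M law p0" by measurable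
  then show ?thesis by (simp cong: measurable_cong_sets)
qed

lemma joint_component: "(\<lambda>(p, \<omega>). p (\<omega> i)) \<in> borel_measurable (\<pi> \<Otimes>\<^sub>M S)"
proof -
  note [measurable] = component_measurable
  have "(\<lambda>(p, \<omega>). (p, \<omega> i)) \<in> \<pi> \<Otimes>\<^sub>M S \<rightarrow>\<^sub>M \<pi> \<Otimes>\<^sub>M borel" by measurable
  from measurable_compose[OF this joint] show ?thesis by (simp add: split_beta')
qed

lemma p0_measurable [measurable]: "p0 \<in> borel_measurable borel"
  by (rule density_onD(1)[OF p0])

abbreviation "lr \<equiv> lratio p0 n"

lemma lr_measurable [measurable]: "(\<lambda>(p, \<omega>). lr p \<omega>) \<in> borel_measurable (\<pi> \<Otimes>\<^sub>M S)"
  unfolding lratio_def using joint_component by (simp add: split_beta')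

lemma lr_measurable1 [measurable]: "p \<in> P \<Longrightarrow> lr p \<in> borel_measurable S"
  unfolding lratio_def[abs_def]
  by (intro borel_measurable_prod borel_measurable_divide measurable_compose[OF component_measurable]
      density_onD(1)[OF dens] p0_measurable)

lemma lr_measurable2 [measurable]: "(\<lambda>p. lr p \<omega>) \<in> borel_measurable \<pi>"
proof -
  have "(\<lambda>p. p (\<omega> i)) \<in> borel_measurable \<pi>" for i
    using measurable_compose[OF measurable_Pair2'[of "\<omega> i" borel \<pi>] joint] by simp
  then show ?thesis unfolding lratio_def by measurable
qed

lemma lr_nonneg: "p \<in> P \<Longrightarrow> 0 \<le> lr p \<omega>"
  unfolding lratio_def using density_onD(2)[OF dens] density_onD(2)[OF p0] by (intro prod_nonneg) auto

lemma nn_integral_lr_le: "p \<in> P \<Longrightarrow> (\<integral>\<^sup>+\<omega>. ennreal (lr p \<omega>) \<partial>S) \<le> 1"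
proof -
  assume p: "p \<in> P"
  note [measurable] = density_onD(1)[OF dens[OF p]]
  have "(\<integral>\<^sup>+\<omega>. ennreal (lr p \<omega>) \<partial>S) = (\<integral>\<^sup>+\<omega>. (\<Prod>i<n. ennreal (p (\<omega> i) / p0 (\<omega> i))) \<partial>S)"
    unfolding lratio_def using density_onD(2)[OF dens[OF p]] density_onD(2)[OF p0] by (simp add: prod_ennreal)
  also have "\<dots> = (\<integral>\<^sup>+x. ennreal (p x / p0 x) \<partial>law p0) ^ n"
    by (rule nn_integral_prod_iid[of "\<lambda>x. ennreal (p x / p0 x)"]) measurable
  also have "\<dots> \<le> 1 ^ n"
  proof (intro power_mono)
    have "(\<integral>\<^sup>+x. 1 * ennreal (p x / p0 x) \<partial>law p0) \<le> (\<integral>\<^sup>+x. 1 * ennreal (p x) \<partial>lborel)"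
      by (rule nn_integral_law_ratio_le[OF dens[OF p] p0]) simp
    also have "\<dots> = 1" using dens[OF p] by (simp add: density_on_def)
    finally show "(\<integral>\<^sup>+x. ennreal (p x / p0 x) \<partial>law p0) \<le> 1" by simp
  qed simp
  finally show ?thesis by simp
qed

lemma prob_le_of_emeasure_le: "emeasure S A \<le> ennreal a \<Longrightarrow> 0 \<le> a \<Longrightarrow> measure S A \<le> a"
  by (simp add: measure_def enn2real_leI)

lemma set_evidence_measurable [measurable]:
  assumes [measurable]: "A \<in> sets \<pi>"
  shows "(\<lambda>\<omega>. \<integral>\<^sup>+p\<in>A. ennreal (lr p \<omega>) \<partial>\<pi>) \<in> borel_measurable S"
proof -
  have "(\<lambda>(\<omega>, p). lr p \<omega>) \<in> borel_measurable (S \<Otimes>\<^sub>M \<pi>)"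
    using measurable_pair_swap[OF lr_measurable] by (simp add: split_beta')
  then show ?thesis by measurable
qed

text \<open>Markov's inequality after exchanging prior and observations. It is applied with the
  whole space and \<open>a = 1\<close> to a set of small prior mass, and with the acceptance event
  of the test and an exponentially small \<open>a\<close> to the densities that the test
  detects.\<close>

lemma prob_set_evidence_large:
  assumes A [measurable]: "A \<in> sets \<pi>" and E [measurable]: "E \<in> sets S" and s: "0 < s" and a: "0 \<le> a"
    and le: "\<And>p. p \<in> A \<Longrightarrow> (\<integral>\<^sup>+\<omega>\<in>E. ennreal (lr p \<omega>) \<partial>S) \<le> ennreal a"
  shows "measure S {\<omega> \<in> space S. \<omega> \<in> E \<and> ennreal s \<le> (\<integral>\<^sup>+p\<in>A. ennreal (lr p \<omega>) \<partial>\<pi>)} \<le> a * measure \<pi> A / s"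
proof (rule prob_le_of_emeasure_le)
  let ?f = "\<lambda>\<omega>. (\<integral>\<^sup>+p\<in>A. ennreal (lr p \<omega>) \<partial>\<pi>) * indicator E \<omega>"
  have "emeasure S {\<omega> \<in> space S. \<omega> \<in> E \<and> ennreal s \<le> (\<integral>\<^sup>+p\<in>A. ennreal (lr p \<omega>) \<partial>\<pi>)} =
      emeasure S ({\<omega> \<in> space S. 1 \<le> ennreal (1 / s) * ?f \<omega>})"
  proof (rule arg_cong[where f = "emeasure S"])
    have "1 \<le> ennreal (1 / s) * x \<longleftrightarrow> ennreal s \<le> x" for x
      using s by (cases x) (auto simp: ennreal_mult[symmetric] field_simps ennreal_mult_top simp flip: ennreal_1)
    then show "{\<omega> \<in> space S. \<omega> \<in> E \<and> ennreal s \<le> (\<integral>\<^sup>+p\<in>A. ennreal (lr p \<omega>) \<partial>\<pi>)} =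
      {\<omega> \<in> space S. 1 \<le> ennreal (1 / s) * ?f \<omega>}"
      using s by (auto simp: indicator_def)
  qed
  also have "\<dots> \<le> ennreal (1 / s) * (\<integral>\<^sup>+\<omega>. ?f \<omega> * indicator (space S) \<omega> \<partial>S)"
    by (rule nn_integral_Markov_inequality[where u = ?f and M = S and A = "space S" and c = "ennreal (1 / s)"]) measurable
  also have "(\<integral>\<^sup>+\<omega>. ?f \<omega> * indicator (space S) \<omega> \<partial>S) = (\<integral>\<^sup>+\<omega>. (\<integral>\<^sup>+p. ennreal (lr p \<omega>) * indicator E \<omega> * indicator A p \<partial>\<pi>) \<partial>S)"
    by (intro nn_integral_cong, subst nn_integral_multc[symmetric]) (auto intro!: nn_integral_cong simp: ac_simps)
  also have "\<dots> = (\<integral>\<^sup>+p. (\<integral>\<^sup>+\<omega>. ennreal (lr p \<omega>) * indicator E \<omega> * indicator A p \<partial>S) \<partial>\<pi>)"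
  proof -
    have "(\<lambda>(p, \<omega>). ennreal (lr p \<omega>) * indicator E \<omega> * indicator A p) \<in> borel_measurable (\<pi> \<Otimes>\<^sub>M S)"
      by measurable
    from QS.Fubini'[OF this] show ?thesis .
  qed
  also have "\<dots> \<le> (\<integral>\<^sup>+p. ennreal a * indicator A p \<partial>\<pi>)"
  proof (rule nn_integral_mono)
    fix p assume "p \<in> space \<pi>"
    then have "p \<in> P" by (simp add: prior)
    then show "(\<integral>\<^sup>+\<omega>. ennreal (lr p \<omega>) * indicator E \<omega> * indicator A p \<partial>S) \<le> ennreal a * indicator A p"
      using le[of p] by (cases "p \<in> A") auto
  qed
  also have "\<dots> = ennreal (a * measure \<pi> A)"
    using a by (simp add: nn_integral_cmult Q.emeasure_eq_measure ennreal_mult)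
  also have "ennreal (1 / s) * ennreal (a * measure \<pi> A) = ennreal (a * measure \<pi> A / s)"
    using s a by (simp flip: ennreal_mult)
  finally show "emeasure S {\<omega> \<in> space S. \<omega> \<in> E \<and> ennreal s \<le> (\<integral>\<^sup>+p\<in>A. ennreal (lr p \<omega>) \<partial>\<pi>)} \<le> ennreal (a * measure \<pi> A / s)"
    by (simp add: mult_left_mono)
qed (use s a in auto)

lemma AE_component:
  assumes "AE x in law p0. R x" shows "AE \<omega> in S. \<forall>i<n. R (\<omega> i)"
proof -
  have "AE \<omega> in S. R (\<omega> i)" for i
    using assms by (intro AE_PiM_component) (auto intro: prob_space_law[OF p0])
  then show ?thesis by (simp add: AE_all_countable)
qed

lemma AE_p0_pos: "AE \<omega> in S. \<forall>i<n. 0 < p0 (\<omega> i)"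
proof (rule AE_component)
  show "AE x in law p0. 0 < p0 x"
    unfolding law_def using density_onD(2)[OF p0] by (subst AE_density) auto
qed

text \<open>The log-likelihood ratio has mean at least \<open>- n * \<epsilon>\<^sup>2\<close> and
  variance at most \<open>n * \<epsilon>\<^sup>2\<close>. Falling below
  \<open>- 2 * n * \<epsilon>\<^sup>2\<close> is a deviation of
  \<open>n * \<epsilon>\<^sup>2\<close>, to which Chebyshev's inequality gives the reciprocal as
  probability.\<close>

lemma prob_lr_small:
  assumes p: "p \<in> kl_neighbourhood P p0 \<epsilon>" and \<epsilon>: "0 < \<epsilon>"
  shows "emeasure S {\<omega> \<in> space S. lr p \<omega> < exp (- 2 * (real n * \<epsilon>\<^sup>2))} \<le> ennreal (1 / (real n * \<epsilon>\<^sup>2))"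
proof -
  have pP: "p \<in> P" and pos: "AE x in law p0. 0 < p x" and int2: "integrable (law p0) (\<lambda>x. (ln (p x / p0 x))\<^sup>2)"
    and E1: "- (\<integral>x. ln (p x / p0 x) \<partial>law p0) \<le> \<epsilon>\<^sup>2" and E2: "(\<integral>x. (ln (p x / p0 x))\<^sup>2 \<partial>law p0) \<le> \<epsilon>\<^sup>2"
    using p by (auto simp: kl_neighbourhood_def)
  note [measurable] = density_onD(1)[OF dens[OF pP]]
  define \<tau> where "\<tau> = real n * \<epsilon>\<^sup>2"
  have \<tau>: "0 < \<tau>" using n \<epsilon> by (simp add: \<tau>_def)
  let ?X = "\<lambda>x. ln (p x / p0 x)"
  have fin: "finite_measure (law p0)" using prob_space_law[OF p0] by (simp add: prob_space.finite_measure)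
  have int1: "integrable (law p0) ?X"
    by (rule finite_measure.square_integrable_imp_integrable[OF fin _ int2]) measurable
  have one: "measure (law p0) UNIV = 1" using prob_space.prob_space[OF prob_space_law[OF p0]] by simp
  define m where "m = (\<integral>x. ?X x \<partial>law p0)"
  define u where "u = (\<lambda>x. ?X x - m)"
  have const: "integrable (law p0) (\<lambda>x. c)" for c :: real using fin by (rule finite_measure.integrable_const)
  have u1: "integrable (law p0) u" unfolding u_def using int1 const by simp
  have u0: "(\<integral>x. u x \<partial>law p0) = 0" unfolding u_def using int1 const by (simp add: m_def one)
  have ueq: "(u x)\<^sup>2 = (?X x)\<^sup>2 + (- 2 * m * ?X x + m\<^sup>2)" for x by (simp add: u_def power2_diff)
  have u2: "integrable (law p0) (\<lambda>x. (u x)\<^sup>2)" unfolding ueq using int1 int2 const by simp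
  have "(\<integral>x. (u x)\<^sup>2 \<partial>law p0) = (\<integral>x. (?X x)\<^sup>2 \<partial>law p0) - m\<^sup>2"
    unfolding ueq using int1 int2 const by (simp add: m_def one power2_eq_square)
  then have uv: "(\<integral>x. (u x)\<^sup>2 \<partial>law p0) \<le> \<epsilon>\<^sup>2" using E2 zero_le_power2[of m] by linarith
  have [measurable]: "u \<in> borel_measurable borel" unfolding u_def by measurable
  have "emeasure S {\<omega> \<in> space S. lr p \<omega> < exp (- 2 * \<tau>)} \<le>
      emeasure S ({\<omega> \<in> space S. 1 \<le> ennreal (1 / \<tau>\<^sup>2) * ennreal ((\<Sum>i<n. u (\<omega> i))\<^sup>2)})"
  proof (rule emeasure_mono_AE)
    show "AE \<omega> in S. \<omega> \<in> {\<omega> \<in> space S. lr p \<omega> < exp (- 2 * \<tau>)} \<longrightarrow>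
      \<omega> \<in> {\<omega> \<in> space S. 1 \<le> ennreal (1 / \<tau>\<^sup>2) * ennreal ((\<Sum>i<n. u (\<omega> i))\<^sup>2)}"
      using AE_p0_pos AE_component[OF pos]
    proof (eventually_elim, intro impI)
      case (elim \<omega>)
      assume \<omega>: "\<omega> \<in> {\<omega> \<in> space S. lr p \<omega> < exp (- 2 * \<tau>)}"
      have "lr p \<omega> = exp (\<Sum>i<n. ?X (\<omega> i))"
        unfolding lratio_def using elim by (simp add: exp_sum)
      then have "(\<Sum>i<n. ?X (\<omega> i)) < - 2 * \<tau>" using \<omega> by simp
      moreover have "(\<Sum>i<n. u (\<omega> i)) = (\<Sum>i<n. ?X (\<omega> i)) - real n * m" by (simp add: u_def sum_subtractf)
      moreover have "- (real n * m) \<le> \<tau>"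
        using mult_left_mono[OF E1, of "real n"] by (simp add: \<tau>_def m_def)
      ultimately have "\<tau> \<le> - (\<Sum>i<n. u (\<omega> i))" by linarith
      then have "\<tau>\<^sup>2 \<le> (- (\<Sum>i<n. u (\<omega> i)))\<^sup>2" using \<tau> by (intro power_mono) auto
      then have "1 \<le> 1 / \<tau>\<^sup>2 * (\<Sum>i<n. u (\<omega> i))\<^sup>2" using \<tau> by simp
      then have "ennreal 1 \<le> ennreal (1 / \<tau>\<^sup>2 * (\<Sum>i<n. u (\<omega> i))\<^sup>2)" by (rule ennreal_leI)
      then show "\<omega> \<in> {\<omega> \<in> space S. 1 \<le> ennreal (1 / \<tau>\<^sup>2) * ennreal ((\<Sum>i<n. u (\<omega> i))\<^sup>2)}"
        using \<omega> by (simp add: ennreal_mult'[symmetric])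
    qed
  qed measurable
  also have "\<dots> \<le> ennreal (1 / \<tau>\<^sup>2) * (\<integral>\<^sup>+\<omega>. ennreal ((\<Sum>i<n. u (\<omega> i))\<^sup>2) * indicator (space S) \<omega> \<partial>S)"
    by (rule nn_integral_Markov_inequality[where u = "\<lambda>\<omega>. ennreal ((\<Sum>i<n. u (\<omega> i))\<^sup>2)" and M = S
        and A = "space S" and c = "ennreal (1 / \<tau>\<^sup>2)"]) measurable
  also have "(\<integral>\<^sup>+\<omega>. ennreal ((\<Sum>i<n. u (\<omega> i))\<^sup>2) * indicator (space S) \<omega> \<partial>S) = ennreal (real n * (\<integral>x. (u x)\<^sup>2 \<partial>law p0))"
    unfolding nn_integral_sum_square_le[OF u1 u2 u0, symmetric] by (intro nn_integral_cong) auto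
  also have "\<dots> \<le> ennreal \<tau>" unfolding \<tau>_def by (intro ennreal_leI mult_left_mono uv) auto
  also have "ennreal (1 / \<tau>\<^sup>2) * ennreal \<tau> = ennreal (1 / \<tau>)"
    using \<tau> by (simp add: power2_eq_square flip: ennreal_mult)
  finally show ?thesis unfolding \<tau>_def by (simp add: mult_left_mono)
qed

text \<open>
  Chebyshev's inequality for each single \<open>p\<close>, followed by Markov's inequality for the prior mass of
  the exceptional densities; this avoids integrating the log-likelihood over the prior.
\<close>

lemma prob_evidence_small:
  assumes G: "G = kl_neighbourhood P p0 \<epsilon>" and \<epsilon>: "0 < \<epsilon>" and g: "0 < g" "g \<le> measure \<pi> G"
  shows "measure S {\<omega> \<in> space S. (\<integral>\<^sup>+p. ennreal (lr p \<omega>) \<partial>\<pi>) < ennreal (g / 2 * exp (- 2 * (real n * \<epsilon>\<^sup>2)))}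
    \<le> 2 / (real n * \<epsilon>\<^sup>2)"
proof (rule prob_le_of_emeasure_le)
  \<comment> \<open>A set outside the sigma-algebra has measure 0 by convention, which the positive
    lower bound \<open>g\<close> excludes.\<close>
  have Gs [measurable]: "G \<in> sets \<pi>" using g measure_notin_sets[of G \<pi>] by (cases "G \<in> sets \<pi>") auto
  define \<tau> where "\<tau> = real n * \<epsilon>\<^sup>2"
  have \<tau>: "0 < \<tau>" using n \<epsilon> by (simp add: \<tau>_def)
  define B :: "(real \<Rightarrow> real) \<Rightarrow> (nat \<Rightarrow> real) \<Rightarrow> ennreal" where
    "B = (\<lambda>p \<omega>. indicator {..<exp (- 2 * \<tau>)} (lr p \<omega>) * indicator G p)"
  have Bm [measurable]: "(\<lambda>(p, \<omega>). B p \<omega>) \<in> borel_measurable (\<pi> \<Otimes>\<^sub>M S)" unfolding B_def by measurable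
  have Bm' [measurable]: "(\<lambda>(\<omega>, p). B p \<omega>) \<in> borel_measurable (S \<Otimes>\<^sub>M \<pi>)"
    using measurable_pair_swap[OF Bm] by (simp add: split_beta')
  have g0: "0 < measure \<pi> G" using g by simp
  have "emeasure S {\<omega> \<in> space S. (\<integral>\<^sup>+p. ennreal (lr p \<omega>) \<partial>\<pi>) < ennreal (g / 2 * exp (- 2 * \<tau>))} \<le>
      emeasure S ({\<omega> \<in> space S. 1 \<le> ennreal (2 / measure \<pi> G) * (\<integral>\<^sup>+p. B p \<omega> \<partial>\<pi>)})"
  proof (rule emeasure_mono)
    show "{\<omega> \<in> space S. (\<integral>\<^sup>+p. ennreal (lr p \<omega>) \<partial>\<pi>) < ennreal (g / 2 * exp (- 2 * \<tau>))} \<subseteq>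
      {\<omega> \<in> space S. 1 \<le> ennreal (2 / measure \<pi> G) * (\<integral>\<^sup>+p. B p \<omega> \<partial>\<pi>)}"
    proof (intro subsetI, rule ccontr)
      fix \<omega> assume \<omega>: "\<omega> \<in> {\<omega> \<in> space S. (\<integral>\<^sup>+p. ennreal (lr p \<omega>) \<partial>\<pi>) < ennreal (g / 2 * exp (- 2 * \<tau>))}"
        and "\<omega> \<notin> {\<omega> \<in> space S. 1 \<le> ennreal (2 / measure \<pi> G) * (\<integral>\<^sup>+p. B p \<omega> \<partial>\<pi>)}"
      then have small: "ennreal (2 / measure \<pi> G) * (\<integral>\<^sup>+p. B p \<omega> \<partial>\<pi>) < 1" by auto
      \<comment> \<open>If the exceptional densities carry less than half of the prior mass of
        \<open>G\<close>, the others alone contribute \<open>g / 2 * exp (- 2 * \<tau>)\<close> to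
        the evidence.\<close>
      define bad where "bad = {p \<in> space \<pi>. p \<in> G \<and> lr p \<omega> < exp (- 2 * \<tau>)}"
      have [measurable]: "bad \<in> sets \<pi>" unfolding bad_def by measurable
      have "(\<integral>\<^sup>+p. B p \<omega> \<partial>\<pi>) = (\<integral>\<^sup>+p. indicator bad p \<partial>\<pi>)"
        by (intro nn_integral_cong) (auto simp: B_def bad_def indicator_def)
      also have "\<dots> = ennreal (measure \<pi> bad)" by (simp add: Q.emeasure_eq_measure)
      finally have "ennreal (2 / measure \<pi> G) * ennreal (measure \<pi> bad) < ennreal 1"
        using small by (simp only: ennreal_1)
      then have "ennreal (2 / measure \<pi> G * measure \<pi> bad) < ennreal 1"
        by (subst ennreal_mult) auto
      then have "2 / measure \<pi> G * measure \<pi> bad < 1" by (subst (asm) ennreal_less_iff) auto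
      then have bad: "measure \<pi> bad < measure \<pi> G / 2" using g0 by (simp add: field_simps)
      have "bad \<subseteq> G" by (auto simp: bad_def)
      then have "measure \<pi> (G - bad) = measure \<pi> G - measure \<pi> bad" by (intro Q.finite_measure_Diff) auto
      then have good: "g / 2 \<le> measure \<pi> (G - bad)" using bad g by linarith
      have "ennreal (g / 2 * exp (- 2 * \<tau>)) \<le> ennreal (exp (- 2 * \<tau>) * measure \<pi> (G - bad))"
        using good by (intro ennreal_leI) (simp add: mult.commute)
      also have "\<dots> = (\<integral>\<^sup>+p. ennreal (exp (- 2 * \<tau>)) * indicator (G - bad) p \<partial>\<pi>)"
        by (simp add: nn_integral_cmult Q.emeasure_eq_measure ennreal_mult)
      also have "\<dots> \<le> (\<integral>\<^sup>+p. ennreal (lr p \<omega>) \<partial>\<pi>)"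
        by (intro nn_integral_mono) (auto simp: indicator_def bad_def intro!: ennreal_leI)
      finally show False using \<omega> by auto
    qed
  qed measurable
  also have "\<dots> \<le> ennreal (2 / measure \<pi> G) * (\<integral>\<^sup>+\<omega>. (\<integral>\<^sup>+p. B p \<omega> \<partial>\<pi>) * indicator (space S) \<omega> \<partial>S)"
    by (rule nn_integral_Markov_inequality[where u = "\<lambda>\<omega>. \<integral>\<^sup>+p. B p \<omega> \<partial>\<pi>" and M = S
        and A = "space S" and c = "ennreal (2 / measure \<pi> G)"]) measurable
  also have "(\<integral>\<^sup>+\<omega>. (\<integral>\<^sup>+p. B p \<omega> \<partial>\<pi>) * indicator (space S) \<omega> \<partial>S) = (\<integral>\<^sup>+\<omega>. (\<integral>\<^sup>+p. B p \<omega> \<partial>\<pi>) \<partial>S)"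
    by (intro nn_integral_cong) auto
  also have "\<dots> = (\<integral>\<^sup>+p. (\<integral>\<^sup>+\<omega>. B p \<omega> \<partial>S) \<partial>\<pi>)" by (rule QS.Fubini'[OF Bm])
  also have "\<dots> \<le> (\<integral>\<^sup>+p. ennreal (1 / \<tau>) * indicator G p \<partial>\<pi>)"
  proof (rule nn_integral_mono)
    fix p assume "p \<in> space \<pi>"
    then have pP: "p \<in> P" by (simp add: prior)
    show "(\<integral>\<^sup>+\<omega>. B p \<omega> \<partial>S) \<le> ennreal (1 / \<tau>) * indicator G p"
    proof (cases "p \<in> G")
      case True
      have [measurable]: "lr p \<in> borel_measurable S" by (rule lr_measurable1[OF pP])
      have "(\<integral>\<^sup>+\<omega>. B p \<omega> \<partial>S) = (\<integral>\<^sup>+\<omega>. indicator {\<omega> \<in> space S. lr p \<omega> < exp (- 2 * \<tau>)} \<omega> \<partial>S)"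
        using True by (intro nn_integral_cong) (auto simp: B_def indicator_def)
      also have "\<dots> = emeasure S {\<omega> \<in> space S. lr p \<omega> < exp (- 2 * \<tau>)}" by simp
      also have "\<dots> \<le> ennreal (1 / \<tau>)" unfolding \<tau>_def
        using True by (intro prob_lr_small \<epsilon>) (simp add: G)
      finally show ?thesis using True by simp
    qed (simp add: B_def)
  qed
  also have "\<dots> = ennreal (1 / \<tau> * measure \<pi> G)"
    using \<tau> by (simp add: nn_integral_cmult Q.emeasure_eq_measure flip: ennreal_mult)
  also have "ennreal (2 / measure \<pi> G) * ennreal (1 / \<tau> * measure \<pi> G) = ennreal (2 / \<tau>)"
    using g0 \<tau> by (simp flip: ennreal_mult)
  finally show "emeasure S {\<omega> \<in> space S. (\<integral>\<^sup>+p. ennreal (lr p \<omega>) \<partial>\<pi>) < ennreal (g / 2 * exp (- 2 * (real n * \<epsilon>\<^sup>2)))} \<le> ennreal (2 / (real n * \<epsilon>\<^sup>2))"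
    unfolding \<tau>_def by (simp add: mult_left_mono)
qed auto

lemma posterior_measurable [measurable]:
  assumes [measurable]: "A \<in> sets \<pi>"
  shows "(\<lambda>\<omega>. posterior \<pi> n \<omega> A) \<in> borel_measurable S"
proof -
  have "(\<lambda>(p, \<omega>). \<Prod>i<n. p (\<omega> i)) \<in> borel_measurable (\<pi> \<Otimes>\<^sub>M S)"
    using joint_component by (simp add: split_beta')
  from measurable_pair_swap[OF this]
  have "(\<lambda>(\<omega>, p). \<Prod>i<n. p (\<omega> i)) \<in> borel_measurable (S \<Otimes>\<^sub>M \<pi>)" by (simp add: split_beta')
  then show ?thesis unfolding posterior_def set_lebesgue_integral_def by measurable
qed

lemma posterior_eq_lr:
  assumes "\<forall>i<n. 0 < p0 (\<omega> i)"
  shows "posterior \<pi> n \<omega> A = (LINT p:A|\<pi>. lr p \<omega>) / (LINT p|\<pi>. lr p \<omega>)"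
proof -
  define c where "c = (\<Prod>i<n. p0 (\<omega> i))"
  have c: "0 < c" unfolding c_def using assms by (intro prod_pos) auto
  have eq: "(\<Prod>i<n. p (\<omega> i)) = c * lr p \<omega>" for p
    unfolding c_def lratio_def prod.distrib[symmetric] using assms by (intro prod.cong) auto
  show ?thesis unfolding posterior_def eq using c by (simp add: set_lebesgue_integral_def mult.left_commute)
qed

lemma posterior_nonneg: "0 \<le> posterior \<pi> n \<omega> A"
proof -
  have nn: "0 \<le> (\<Prod>i<n. p (\<omega> i))" if "p \<in> space \<pi>" for p
    using that density_onD(2)[OF dens] by (intro prod_nonneg) (auto simp: prior)
  then show ?thesis unfolding posterior_def set_lebesgue_integral_def
    by (intro divide_nonneg_nonneg integral_nonneg_AE) auto
qed

lemma posterior_le: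
  assumes U: "U \<in> sets \<pi>" "B \<in> sets \<pi>" "V \<in> sets \<pi>" "W \<in> sets \<pi>" and sub: "U \<subseteq> B \<union> V \<union> W"
    and pos: "\<forall>i<n. 0 < p0 (\<omega> i)" and x: "0 < x" and s: "0 \<le> s"
    and ev: "ennreal x \<le> (\<integral>\<^sup>+p. ennreal (lr p \<omega>) \<partial>\<pi>)"
    and V: "(\<integral>\<^sup>+p\<in>V. ennreal (lr p \<omega>) \<partial>\<pi>) \<le> ennreal s"
    and W: "(\<integral>\<^sup>+p\<in>W. ennreal (lr p \<omega>) \<partial>\<pi>) \<le> ennreal s"
  shows "posterior \<pi> n \<omega> U \<le> posterior \<pi> n \<omega> B + 2 * s / x"
proof (cases "integrable \<pi> (\<lambda>p. lr p \<omega>)")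
  \<comment> \<open>The evidence is then 0 as a Bochner integral, and division by 0 makes the
    posterior probability 0.\<close>
  case False
  then have "posterior \<pi> n \<omega> U = 0" unfolding posterior_eq_lr[OF pos] by (simp add: not_integrable_integral_eq)
  then show ?thesis using posterior_nonneg[of \<omega> B] x s by simp
next
  case True
  have nn: "0 \<le> lr p \<omega>" if "p \<in> space \<pi>" for p using that by (intro lr_nonneg) (simp add: prior)
  have si: "integrable \<pi> (\<lambda>p. indicat_real A p * lr p \<omega>)" if "A \<in> sets \<pi>" for A
    using integrable_real_mult_indicator[OF that True] by (simp add: mult.commute)
  let ?I = "\<lambda>A. \<integral>p. indicat_real A p * lr p \<omega> \<partial>\<pi>"
  have small: "?I A \<le> s" if A: "A \<in> sets \<pi>" and le: "(\<integral>\<^sup>+p\<in>A. ennreal (lr p \<omega>) \<partial>\<pi>) \<le> ennreal s" for A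
  proof -
    have "ennreal (?I A) = (\<integral>\<^sup>+p. ennreal (indicat_real A p * lr p \<omega>) \<partial>\<pi>)"
      using si[OF A] nn by (intro nn_integral_eq_integral[symmetric]) auto
    also have "\<dots> = (\<integral>\<^sup>+p\<in>A. ennreal (lr p \<omega>) \<partial>\<pi>)" by (intro nn_integral_cong) (auto simp: indicator_def)
    finally have "ennreal (?I A) \<le> ennreal s" using le by simp
    then show ?thesis using s by (subst (asm) ennreal_le_iff)
  qed
  have D: "x \<le> (LINT p|\<pi>. lr p \<omega>)"
  proof -
    have "(\<integral>\<^sup>+p. ennreal (lr p \<omega>) \<partial>\<pi>) = ennreal (LINT p|\<pi>. lr p \<omega>)"
      using True nn by (intro nn_integral_eq_integral) auto
    then have "ennreal x \<le> ennreal (LINT p|\<pi>. lr p \<omega>)" using ev by simp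
    moreover have "0 \<le> (LINT p|\<pi>. lr p \<omega>)" using nn by (intro integral_nonneg_AE) auto
    ultimately show ?thesis by (subst (asm) ennreal_le_iff)
  qed
  have "?I U \<le> (\<integral>p. indicat_real B p * lr p \<omega> + (indicat_real V p * lr p \<omega> + indicat_real W p * lr p \<omega>) \<partial>\<pi>)"
  proof (intro integral_mono si U Bochner_Integration.integrable_add)
    fix p assume "p \<in> space \<pi>"
    then have "0 \<le> lr p \<omega>" by (rule nn)
    moreover have "indicat_real U p \<le> indicat_real B p + (indicat_real V p + indicat_real W p)"
      using sub by (auto simp: indicator_def)
    ultimately show "indicat_real U p * lr p \<omega> \<le> indicat_real B p * lr p \<omega> + (indicat_real V p * lr p \<omega> + indicat_real W p * lr p \<omega>)"
      by (simp only: distrib_right[symmetric] mult_right_mono)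
  qed
  also have "\<dots> = ?I B + (?I V + ?I W)" using si U by simp
  also have "\<dots> \<le> ?I B + (s + s)" by (intro add_left_mono add_mono small U V W)
  finally have "?I U / (LINT p|\<pi>. lr p \<omega>) \<le> (?I B + 2 * s) / (LINT p|\<pi>. lr p \<omega>)"
    using D x by (intro divide_right_mono) auto
  also have "\<dots> = ?I B / (LINT p|\<pi>. lr p \<omega>) + 2 * s / (LINT p|\<pi>. lr p \<omega>)" by (rule add_divide_distrib)
  also have "\<dots> \<le> ?I B / (LINT p|\<pi>. lr p \<omega>) + 2 * s / x"
    using D x s by (intro add_left_mono divide_left_mono) auto
  finally show ?thesis unfolding posterior_eq_lr[OF pos] by (simp add: set_lebesgue_integral_def)
qed

text \<open>The budget behind \<open>C + 4\<close>, with \<tau> = n \<epsilon>^2: the evidence is at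
  least \<open>exp (- (C + 2) * \<tau>) / 2\<close> outside a set of probability
  \<open>2 / \<tau>\<close>, and the parts of the numerator over \<open>V\<close> and, on
  \<open>E\<close>, over \<open>W\<close> are below \<open>exp (- (C + 3) * \<tau>)\<close>, each up
  to probability \<open>exp (- \<tau>)\<close>. Their share of the posterior is
  \<open>4 * exp (- \<tau>)\<close>.\<close>

lemma posterior_contraction:
  assumes U: "U \<in> sets \<pi>" "B \<in> sets \<pi>" "V \<in> sets \<pi>" "W \<in> sets \<pi>" and sub: "U \<subseteq> B \<union> V \<union> W"
    and E [measurable]: "E \<in> sets S" and \<epsilon>: "0 < \<epsilon>" and C: "0 < C"
    and V: "measure \<pi> V \<le> exp (- (C + 4) * real n * \<epsilon>\<^sup>2)"
    and kl: "exp (- C * real n * \<epsilon>\<^sup>2) \<le> measure \<pi> (kl_neighbourhood P p0 \<epsilon>)"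
    and W: "\<And>p. p \<in> W \<Longrightarrow> (\<integral>\<^sup>+\<omega>\<in>E. ennreal (lr p \<omega>) \<partial>S) \<le> ennreal (exp (- (C + 4) * real n * \<epsilon>\<^sup>2))"
    and \<eta>: "4 * exp (- (real n * \<epsilon>\<^sup>2)) \<le> \<eta> / 2"
  shows "measure S {\<omega> \<in> space S. \<bar>posterior \<pi> n \<omega> U - 0\<bar> > \<eta>} \<le>
    2 / (real n * \<epsilon>\<^sup>2) + 2 * exp (- (real n * \<epsilon>\<^sup>2)) + measure S (space S - E)
    + measure S {\<omega> \<in> space S. \<bar>posterior \<pi> n \<omega> B - 0\<bar> > \<eta> / 2}"
proof -
  note [measurable] = U
  define \<tau> where "\<tau> = real n * \<epsilon>\<^sup>2"
  have \<tau>: "0 < \<tau>" using n \<epsilon> by (simp add: \<tau>_def)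
  define x where "x = exp (- C * \<tau>) / 2 * exp (- 2 * \<tau>)"
  define s where "s = exp (- (C + 3) * \<tau>)"
  have x: "0 < x" and s: "0 < s" by (auto simp: x_def s_def)
  have sx: "2 * s / x = 4 * exp (- \<tau>)"
  proof -
    have "x * exp (- \<tau>) * 2 = s" unfolding x_def s_def by (simp add: mult_exp_exp algebra_simps)
    then show ?thesis using x by (simp add: field_simps)
  qed
  let ?N = "{\<omega> \<in> space S. \<not> (\<forall>i<n. 0 < p0 (\<omega> i))}"
  let ?A1 = "{\<omega> \<in> space S. (\<integral>\<^sup>+p. ennreal (lr p \<omega>) \<partial>\<pi>) < ennreal x}"
  let ?A2 = "{\<omega> \<in> space S. \<omega> \<in> space S \<and> ennreal s \<le> (\<integral>\<^sup>+p\<in>V. ennreal (lr p \<omega>) \<partial>\<pi>)}"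
  let ?A3 = "{\<omega> \<in> space S. \<omega> \<in> E \<and> ennreal s \<le> (\<integral>\<^sup>+p\<in>W. ennreal (lr p \<omega>) \<partial>\<pi>)}"
  let ?A4 = "space S - E"
  let ?A5 = "{\<omega> \<in> space S. \<bar>posterior \<pi> n \<omega> B - 0\<bar> > \<eta> / 2}"
  have [measurable]: "?A1 \<in> sets S"
  proof -
    have "(\<lambda>\<omega>. \<integral>\<^sup>+p\<in>space \<pi>. ennreal (lr p \<omega>) \<partial>\<pi>) \<in> borel_measurable S" by (rule set_evidence_measurable) auto
    moreover have "(\<integral>\<^sup>+p\<in>space \<pi>. ennreal (lr p \<omega>) \<partial>\<pi>) = (\<integral>\<^sup>+p. ennreal (lr p \<omega>) \<partial>\<pi>)" for \<omega>
      by (intro nn_integral_cong) auto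
    ultimately have [measurable]: "(\<lambda>\<omega>. \<integral>\<^sup>+p. ennreal (lr p \<omega>) \<partial>\<pi>) \<in> borel_measurable S" by simp
    show ?thesis by measurable
  qed
  have [measurable]: "?N \<in> sets S" "?A2 \<in> sets S" "?A3 \<in> sets S" "?A5 \<in> sets S" by measurable
  have N: "measure S ?N = 0"
    using AE_p0_pos by (simp add: AE_iff_measurable[OF \<open>?N \<in> sets S\<close> refl] measure_def)
  have "{\<omega> \<in> space S. \<bar>posterior \<pi> n \<omega> U - 0\<bar> > \<eta>} \<subseteq> ?N \<union> ?A1 \<union> ?A2 \<union> ?A3 \<union> ?A4 \<union> ?A5"
  proof (intro subsetI, rule ccontr)
    fix \<omega> assume \<omega>: "\<omega> \<in> {\<omega> \<in> space S. \<bar>posterior \<pi> n \<omega> U - 0\<bar> > \<eta>}"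
      and not: "\<omega> \<notin> ?N \<union> ?A1 \<union> ?A2 \<union> ?A3 \<union> ?A4 \<union> ?A5"
    have "posterior \<pi> n \<omega> U \<le> posterior \<pi> n \<omega> B + 2 * s / x"
      by (rule posterior_le[OF U sub]) (use \<omega> not x s in auto)
    moreover have "posterior \<pi> n \<omega> B \<le> \<eta> / 2" using \<omega> not by auto
    moreover have "2 * s / x \<le> \<eta> / 2" unfolding sx using \<eta> by (simp add: \<tau>_def)
    ultimately have "posterior \<pi> n \<omega> U \<le> \<eta>" by linarith
    then show False using \<omega> posterior_nonneg[of \<omega> U] by auto
  qed
  then have "measure S {\<omega> \<in> space S. \<bar>posterior \<pi> n \<omega> U - 0\<bar> > \<eta>} \<le> measure S (?N \<union> ?A1 \<union> ?A2 \<union> ?A3 \<union> ?A4 \<union> ?A5)"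
    by (intro P.finite_measure_mono) auto
  also have "\<dots> \<le> measure S ?N + measure S ?A1 + measure S ?A2 + measure S ?A3 + measure S ?A4 + measure S ?A5"
    by (intro order_trans[OF measure_Un_le] add_right_mono) auto
  also have "measure S ?A1 \<le> 2 / \<tau>"
    unfolding x_def \<tau>_def using kl
    by (intro prob_evidence_small[OF refl \<epsilon>]) (auto simp: mult.assoc)
  also have "measure S ?A2 \<le> 1 * measure \<pi> V / s"
  proof (rule prob_set_evidence_large)
    fix p assume "p \<in> V"
    then have "p \<in> P" using sets.sets_into_space[OF U(3)] by (auto simp: prior)
    moreover have "(\<integral>\<^sup>+\<omega>\<in>space S. ennreal (lr p \<omega>) \<partial>S) = (\<integral>\<^sup>+\<omega>. ennreal (lr p \<omega>) \<partial>S)"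
      by (intro nn_integral_cong) auto
    ultimately show "(\<integral>\<^sup>+\<omega>\<in>space S. ennreal (lr p \<omega>) \<partial>S) \<le> ennreal 1"
      using nn_integral_lr_le[of p] by simp
  qed (use s in auto)
  also have "\<dots> \<le> exp (- \<tau>)"
  proof -
    have "exp (- \<tau>) * s = exp (- (C + 4) * real n * \<epsilon>\<^sup>2)"
      by (simp add: s_def \<tau>_def mult_exp_exp algebra_simps)
    then show ?thesis using V s by (simp add: field_simps)
  qed
  also have "measure S ?A3 \<le> exp (- (C + 4) * real n * \<epsilon>\<^sup>2) * measure \<pi> W / s"
    by (rule prob_set_evidence_large) (use s W in auto)
  also have "\<dots> \<le> exp (- \<tau>)"
  proof -
    have "exp (- (C + 4) * real n * \<epsilon>\<^sup>2) * measure \<pi> W \<le> exp (- (C + 4) * real n * \<epsilon>\<^sup>2) * 1"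
      by (intro mult_left_mono) auto
    moreover have "exp (- \<tau>) * s = exp (- (C + 4) * real n * \<epsilon>\<^sup>2)"
      by (simp add: s_def \<tau>_def mult_exp_exp algebra_simps)
    ultimately show ?thesis using s by (simp add: field_simps)
  qed
  finally show ?thesis using N unfolding \<tau>_def by (simp add: algebra_simps)
qed

end

section \<open>Cell weights and rates\<close>

text \<open>At most \<open>2 * d\<close> indices share the same quotient of
  \<open>\<bar>k\<bar>\<close> by \<open>d\<close>, and on such a block the weight is bounded by a
  term of a convergent series in the quotient.\<close>

lemma sum_weights_le:
  assumes \<beta>: "1 < \<beta>"
  obtains C where "0 < C" "\<And>d F. 0 < d \<Longrightarrow> finite F \<Longrightarrow>
    (\<Sum>k\<in>F. (1 + \<bar>real_of_int k\<bar> / real d) powr - \<beta>) \<le> C * real d"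
proof -
  have sm: "summable (\<lambda>j. real (Suc j) powr - \<beta>)"
    using \<beta> summable_Suc_iff[of "\<lambda>j. real j powr - \<beta>"] summable_real_powr_iff[of "- \<beta>"] by simp
  define C where "C = 2 * (\<Sum>j. real (Suc j) powr - \<beta>)"
  have "0 < (\<Sum>j. real (Suc j) powr - \<beta>)"
    by (intro suminf_pos sm) auto
  then have C: "0 < C" by (simp add: C_def)
  show ?thesis
  proof (rule that[OF C])
    fix d :: nat and F :: "int set"
    assume d: "0 < d" and F: "finite F"
    define g where "g = (\<lambda>k::int. nat \<bar>k\<bar> div d)"
    have "(\<Sum>k\<in>F. (1 + \<bar>real_of_int k\<bar> / real d) powr - \<beta>) \<le> (\<Sum>k\<in>F. real (Suc (g k)) powr - \<beta>)"
    proof (intro sum_mono powr_mono2')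
      fix k :: int
      have "real (g k) \<le> real (nat \<bar>k\<bar>) / real d" 
        using of_nat_mono[OF div_times_less_eq_dividend[of "nat \<bar>k\<bar>" d], where 'a = real] d
        unfolding g_def by (simp add: pos_le_divide_eq)
      then show "real (Suc (g k)) \<le> 1 + \<bar>real_of_int k\<bar> / real d" by simp
    qed (use \<beta> in auto)
    also have "\<dots> = (\<Sum>j\<in>g ` F. \<Sum>k\<in>{k\<in>F. g k = j}. real (Suc (g k)) powr - \<beta>)"
      by (rule sum.image_gen[OF F])
    also have "\<dots> \<le> (\<Sum>j\<in>g ` F. real (2 * d) * real (Suc j) powr - \<beta>)"
    proof (intro sum_mono)
      fix j
      have sub: "{k\<in>F. g k = j} \<subseteq> (\<lambda>i. int i) ` {j * d..<Suc j * d} \<union> (\<lambda>i. - int i) ` {j * d..<Suc j * d}"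
      proof
        fix k assume "k \<in> {k\<in>F. g k = j}"
        then have j: "nat \<bar>k\<bar> div d = j" by (simp add: g_def)
        have "j * d \<le> nat \<bar>k\<bar>" using j by (metis div_times_less_eq_dividend)
        moreover have "nat \<bar>k\<bar> < Suc j * d" using j d dividend_less_div_times[of d "nat \<bar>k\<bar>"] by simp
        ultimately have "nat \<bar>k\<bar> \<in> {j * d..<Suc j * d}" by simp
        moreover have "k = int (nat \<bar>k\<bar>) \<or> k = - int (nat \<bar>k\<bar>)" by linarith
        ultimately show "k \<in> (\<lambda>i. int i) ` {j * d..<Suc j * d} \<union> (\<lambda>i. - int i) ` {j * d..<Suc j * d}" by blast
      qed
      have "card {k\<in>F. g k = j} \<le> card ((\<lambda>i. int i) ` {j * d..<Suc j * d} \<union> (\<lambda>i. - int i) ` {j * d..<Suc j * d})"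
        by (rule card_mono[OF _ sub]) auto
      also have "\<dots> \<le> card ((\<lambda>i. int i) ` {j * d..<Suc j * d}) + card ((\<lambda>i. - int i) ` {j * d..<Suc j * d})"
        by (rule card_Un_le)
      also have "\<dots> \<le> card {j * d..<Suc j * d} + card {j * d..<Suc j * d}"
        by (intro add_mono card_image_le) auto
      also have "\<dots> = 2 * d" by simp
      finally have "real (card {k\<in>F. g k = j}) * real (Suc j) powr - \<beta> \<le> real (2 * d) * real (Suc j) powr - \<beta>"
        by (intro mult_right_mono) auto
      then show "(\<Sum>k\<in>{k\<in>F. g k = j}. real (Suc (g k)) powr - \<beta>) \<le> real (2 * d) * real (Suc j) powr - \<beta>" by simp
    qed
    also have "\<dots> = real (2 * d) * (\<Sum>j\<in>g ` F. real (Suc j) powr - \<beta>)" by (simp add: sum_distrib_left)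
    also have "\<dots> \<le> real (2 * d) * (\<Sum>j. real (Suc j) powr - \<beta>)"
      using F by (intro mult_left_mono sum_le_suminf[OF sm]) auto
    finally show "(\<Sum>k\<in>F. (1 + \<bar>real_of_int k\<bar> / real d) powr - \<beta>) \<le> C * real d" by (simp add: C_def mult_ac)
  qed
qed

text \<open>Each \<open>\<bar>a k\<bar> powr 2\<close> is at most the whole sum \<open>Q\<close>, so
  the surplus power \<open>r / 2 - 1\<close> can be spent on \<open>Q\<close>.\<close>

lemma sum_abs_powr_le:
  fixes a :: "'a \<Rightarrow> real"
  assumes r: "2 \<le> r" and F: "finite F"
  shows "(\<Sum>k\<in>F. \<bar>a k\<bar> powr r) \<le> (\<Sum>k\<in>F. \<bar>a k\<bar> powr 2) powr (r / 2)"
proof -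
  define Q where "Q = (\<Sum>k\<in>F. \<bar>a k\<bar> powr 2)"
  have Q: "0 \<le> Q" by (simp add: Q_def sum_nonneg)
  have "(\<Sum>k\<in>F. \<bar>a k\<bar> powr r) \<le> (\<Sum>k\<in>F. Q powr (r / 2 - 1) * \<bar>a k\<bar> powr 2)"
  proof (intro sum_mono)
    fix k assume k: "k \<in> F"
    have "\<bar>a k\<bar> powr 2 \<le> Q" unfolding Q_def using F k by (intro member_le_sum) auto
    then have "(\<bar>a k\<bar> powr 2) powr (r / 2 - 1) \<le> Q powr (r / 2 - 1)" using r by (intro powr_mono2) auto
    then have "(\<bar>a k\<bar> powr 2) powr (r / 2 - 1) * \<bar>a k\<bar> powr 2 \<le> Q powr (r / 2 - 1) * \<bar>a k\<bar> powr 2"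
      by (intro mult_right_mono) auto
    moreover have "(\<bar>a k\<bar> powr 2) powr (r / 2 - 1) * \<bar>a k\<bar> powr 2 = \<bar>a k\<bar> powr r"
      unfolding powr_powr powr_add[symmetric] by (simp add: algebra_simps)
    ultimately show "\<bar>a k\<bar> powr r \<le> Q powr (r / 2 - 1) * \<bar>a k\<bar> powr 2" by simp
  qed
  also have "\<dots> = Q powr (r / 2 - 1) * Q" by (simp add: Q_def sum_distrib_left)
  also have "\<dots> = Q powr (r / 2)" using Q by (cases "Q = 0") (auto simp: powr_diff)
  finally show ?thesis by (simp add: Q_def)
qed

lemma cell_prob_le:
  assumes p: "density_on T p" and b: "AE x in lborel. \<bar>p x\<bar> \<le> b" and d: "0 < d"
  shows "cell_prob p d k \<le> b / real d"
proof -
  have "integrable lborel (\<lambda>x. b * indicat_real (cell d k) x)"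
    using emeasure_cell[OF d, of k] by (intro integrable_mult_right integrable_real_indicator) auto
  then have "cell_prob p d k \<le> (\<integral>x. b * indicat_real (cell d k) x \<partial>lborel)"
    unfolding cell_prob_def using b
    by (intro integral_mono_AE integrable_cell[OF p]) (auto simp: indicator_def)
  also have "\<dots> = b / real d" using emeasure_cell[OF d, of k] by (simp add: measure_def)
  finally show ?thesis .
qed

text \<open>\<open>max b 0\<close> appears because \<open>ennreal\<close> truncates negative reals,
  and constants such as \<open>C_K\<close> come without a sign.\<close>

lemma Lr_norm_le_imp:
  assumes "Lr_norm T r f \<le> ennreal b" and r: "0 < r"
  shows "(\<integral>\<^sup>+x\<in>T. ennreal (\<bar>f x\<bar> powr r) \<partial>lborel) \<le> ennreal (max b 0 powr r)"
proof -
  let ?I = "\<integral>\<^sup>+x\<in>T. ennreal (\<bar>f x\<bar> powr r) \<partial>lborel"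
  have fin: "?I \<noteq> \<infinity>"
  proof
    assume "?I = \<infinity>"
    then have "Lr_norm T r f = \<infinity>" unfolding Lr_norm_def Let_def by simp
    then show False using assms(1) by (simp add: top_unique)
  qed
  then obtain i where i: "?I = ennreal i" "0 \<le> i" by (cases ?I) auto
  have "ennreal (i powr (1 / r)) \<le> ennreal b" using assms(1) fin i by (simp add: Lr_norm_def Let_def)
  also have "ennreal b = ennreal (max b 0)" by (simp add: max_def ennreal_neg)
  finally have "i powr (1 / r) \<le> max b 0" by (subst (asm) ennreal_le_iff) auto
  then have "(i powr (1 / r)) powr r \<le> max b 0 powr r" using r by (intro powr_mono2) auto
  then show ?thesis using i r by (simp add: powr_powr ennreal_leI)
qed

lemma Lr_norm_ge_imp:
  assumes "ennreal b \<le> Lr_norm T r f" and r: "0 < r" and b: "0 \<le> b"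
    and I: "(\<integral>\<^sup>+x\<in>T. ennreal (\<bar>f x\<bar> powr r) \<partial>lborel) = ennreal I" "0 \<le> I"
  shows "b powr r \<le> I"
proof -
  have "ennreal b \<le> ennreal (I powr (1 / r))" using assms(1) I by (simp add: Lr_norm_def Let_def)
  then have "b \<le> I powr (1 / r)" by (simp add: ennreal_le_iff)
  then have "b powr r \<le> (I powr (1 / r)) powr r" using r b by (intro powr_mono2) auto
  then show ?thesis using I r by (simp add: powr_powr)
qed

text \<open>Linearity of the Bochner integral needs both integrands to be integrable: the rows of
  the kernel are, and the densities are essentially bounded.\<close>

lemma kernel_op_diff:
  assumes T: "T = {0..1} \<or> T = UNIV" and K: "translation_regular T J0 K" and j: "J0 \<le> j" and x: "x \<in> T"
    and p: "density_on T p" "AE x in lborel. \<bar>p x\<bar> \<le> b" and p0: "density_on T p0" "AE x in lborel. \<bar>p0 x\<bar> \<le> b"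
  shows "kernel_op T (K j) (\<lambda>y. p y - p0 y) x = kernel_op T (K j) p x - kernel_op T (K j) p0 x"
proof -
  have [measurable]: "T \<in> sets borel" using T by auto
  define k where "k = (\<lambda>y. indicat_real T x * indicat_real T y * K j x y)"
  have km: "(\<lambda>(x, y). indicat_real T x * indicat_real T y * K j x y) \<in> borel_measurable (borel \<Otimes>\<^sub>M borel)"
    using K j unfolding translation_regular_def by auto
  have [measurable]: "k \<in> borel_measurable borel"
    using measurable_compose[OF measurable_Pair1' km, of x] by (simp add: k_def)
  obtain C where C: "(\<integral>\<^sup>+y\<in>T. ennreal \<bar>K j x y\<bar> \<partial>lborel) \<le> ennreal C"
    using K j x unfolding translation_regular_def by blast
  have "(\<integral>\<^sup>+y. ennreal (norm (k y)) \<partial>lborel) = (\<integral>\<^sup>+y\<in>T. ennreal \<bar>K j x y\<bar> \<partial>lborel)"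
    using x by (intro nn_integral_cong) (auto simp: k_def indicator_def)
  then have ki: "integrable lborel k"
    using C by (intro integrableI_bounded) (auto intro: le_less_trans)
  have int: "set_integrable lborel T (\<lambda>y. K j x y * f y)" if f: "density_on T f" "AE x in lborel. \<bar>f x\<bar> \<le> b" for f
  proof -
    note [measurable] = density_onD(1)[OF f(1)]
    have "integrable lborel (\<lambda>y. k y * f y)"
    proof (rule Bochner_Integration.integrable_bound[where f = "\<lambda>y. b * \<bar>k y\<bar>"])
      show "AE y in lborel. norm (k y * f y) \<le> norm (b * \<bar>k y\<bar>)"
        using f(2)
      proof eventually_elim
        case (elim y)
        then have "\<bar>k y\<bar> * \<bar>f y\<bar> \<le> \<bar>k y\<bar> * \<bar>b\<bar>" by (intro mult_left_mono) auto
        then show ?case by (simp add: abs_mult mult.commute)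
      qed
    qed (use ki in auto)
    moreover have "(\<lambda>y. k y * f y) = (\<lambda>y. indicat_real T y *\<^sub>R (K j x y * f y))"
      using x by (auto simp: k_def fun_eq_iff)
    ultimately show ?thesis unfolding set_integrable_def by simp
  qed
  show ?thesis
    unfolding kernel_op_def
    by (subst set_integral_diff(2)[OF int[OF p] int[OF p0], symmetric]) (simp add: right_diff_distrib)
qed

text \<open>For \<open>x\<close> in the cell \<open>k\<close> one has
  \<open>1 + \<bar>k\<bar> / d \<le> 2 * (1 + \<bar>x\<bar>)\<close>, hence the factor
  \<open>2 powr a\<close>. The set \<open>G\<close> is the whole line when the mean of the statistic
  is bounded, and \<open>{x. R \<le> \<bar>x\<bar>}\<close> when its tail is.\<close>

lemma weighted_cell_prob_le:
  assumes p0: "density_on T p0" and a: "0 \<le> a" and d: "0 < d" and F: "finite F"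
    and g: "integrable lborel (\<lambda>x. p0 x * (1 + \<bar>x\<bar>) powr a)"
    and G [measurable]: "G \<in> sets borel" and FG: "\<And>k. k \<in> F \<Longrightarrow> cell d k \<subseteq> G"
  shows "(\<Sum>k\<in>F. (1 + \<bar>real_of_int k\<bar> / real d) powr a * cell_prob p0 d k) \<le>
    2 powr a * (\<integral>x. indicat_real G x * (p0 x * (1 + \<bar>x\<bar>) powr a) \<partial>lborel)"
proof -
  note pd = density_onD[OF p0]
  let ?w = "\<lambda>k. (1 + \<bar>real_of_int k\<bar> / real d) powr a"
  have gi: "integrable lborel (\<lambda>x. indicat_real G x * (p0 x * (1 + \<bar>x\<bar>) powr a))"
    using integrable_real_mult_indicator[OF _ g, of G] by (simp add: mult.commute)
  have "(\<Sum>k\<in>F. ?w k * cell_prob p0 d k) = (\<integral>x. (\<Sum>k\<in>F. ?w k * (indicat_real (cell d k) x * p0 x)) \<partial>lborel)"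
    by (simp add: Bochner_Integration.integral_sum integrable_cell[OF p0] cell_prob_def)
  also have "\<dots> \<le> (\<integral>x. 2 powr a * (indicat_real G x * (p0 x * (1 + \<bar>x\<bar>) powr a)) \<partial>lborel)"
  proof (intro integral_mono Bochner_Integration.integrable_sum integrable_mult_right integrable_cell[OF p0] gi)
    fix x :: real
    have "(\<Sum>k\<in>F. ?w k * (indicat_real (cell d k) x * p0 x)) = (\<Sum>k\<in>F. ?w k * indicat_real (cell d k) x) * p0 x"
      by (simp add: sum_distrib_right mult.assoc)
    also have "\<dots> = (if \<lfloor>real d * x\<rfloor> \<in> F then ?w \<lfloor>real d * x\<rfloor> else 0) * p0 x"
      unfolding sum_indicator_cell[OF F] ..
    also have "\<dots> \<le> 2 powr a * (indicat_real G x * (p0 x * (1 + \<bar>x\<bar>) powr a))"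
    proof (cases "\<lfloor>real d * x\<rfloor> \<in> F")
      case True
      have "x \<in> G" using FG[OF True] by (auto simp: cell_def)
      have "\<bar>real_of_int \<lfloor>real d * x\<rfloor>\<bar> \<le> \<bar>real d * x\<bar> + 1" by linarith
      also have "\<dots> \<le> (1 + 2 * \<bar>x\<bar>) * real d"
      proof -
        have "\<bar>real d * x\<bar> = \<bar>x\<bar> * real d" "0 \<le> \<bar>x\<bar> * real d" "1 \<le> real d"
          using d by (simp_all add: abs_mult)
        then show ?thesis unfolding distrib_right mult.assoc by linarith
      qed
      finally have "\<bar>real_of_int \<lfloor>real d * x\<rfloor>\<bar> / real d \<le> 1 + 2 * \<bar>x\<bar>"
        using d by (subst pos_divide_le_eq) auto
      then have "1 + \<bar>real_of_int \<lfloor>real d * x\<rfloor>\<bar> / real d \<le> 2 * (1 + \<bar>x\<bar>)" by simp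
      then have "?w \<lfloor>real d * x\<rfloor> \<le> (2 * (1 + \<bar>x\<bar>)) powr a" using a by (intro powr_mono2) auto
      also have "\<dots> = 2 powr a * (1 + \<bar>x\<bar>) powr a" by (rule powr_mult)
      finally have "?w \<lfloor>real d * x\<rfloor> * p0 x \<le> 2 powr a * (1 + \<bar>x\<bar>) powr a * p0 x"
        using pd(2) by (intro mult_right_mono) auto
      then show ?thesis using True \<open>x \<in> G\<close> by (simp add: mult_ac)
    qed (use pd(2) in auto)
    finally show "(\<Sum>k\<in>F. ?w k * (indicat_real (cell d k) x * p0 x)) \<le> 2 powr a * (indicat_real G x * (p0 x * (1 + \<bar>x\<bar>) powr a))" .
  qed
  finally show ?thesis by simp
qed

lemma tail_integral_small:
  fixes g :: "real \<Rightarrow> real"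
  assumes g: "integrable lborel g" and e: "0 < e"
  obtains R :: nat where "(\<integral>x. indicat_real {x. real R \<le> \<bar>x\<bar>} x * g x \<partial>lborel) \<le> e"
proof -
  have "(\<lambda>R::nat. \<integral>x. indicat_real {x. real R \<le> \<bar>x\<bar>} x * g x \<partial>lborel) \<longlonglongrightarrow> (\<integral>x. 0 \<partial>(lborel :: real measure))"
  proof (rule integral_dominated_convergence[where w = "\<lambda>x. \<bar>g x\<bar>"])
    have "(\<lambda>R::nat. indicat_real {x. real R \<le> \<bar>x\<bar>} x * g x) \<longlonglongrightarrow> 0" for x
    proof -
      have "\<forall>\<^sub>F R in sequentially. \<bar>x\<bar> < real R"
        using filterlim_real_sequentially by (simp add: filterlim_at_top_dense)
      then have "\<forall>\<^sub>F R in sequentially. indicat_real {x. real R \<le> \<bar>x\<bar>} x * g x = 0"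
        by eventually_elim simp
      then show ?thesis by (rule tendsto_eventually)
    qed
    then show "AE x in lborel. (\<lambda>R::nat. indicat_real {x. real R \<le> \<bar>x\<bar>} x * g x) \<longlonglongrightarrow> 0" by simp
  qed (use g in \<open>auto simp: indicator_def\<close>)
  then have "\<forall>\<^sub>F R::nat in sequentially. (\<integral>x. indicat_real {x. real R \<le> \<bar>x\<bar>} x * g x \<partial>lborel) < e"
    using e by (intro order_tendstoD(2)) auto
  then show ?thesis using that by (auto simp: eventually_sequentially intro: less_imp_le)
qed

text \<open>Converts the rates into the numerical hypotheses of \<open>type_II_error\<close>,
  applied with exponent \<open>s\<close>, with \<open>b = B / d\<close> and with
  \<open>(C + 4) * \<tau>\<close> for \<open>R\<close>. In each of them the powers of
  \<open>\<tau>\<close> balance, which leaves the three conditions on \<open>M\<close>.\<close>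

lemma type_II_error_rate:
  fixes p p0 :: "real \<Rightarrow> real" and w :: "int \<Rightarrow> real"
  assumes p: "density_on T p" and p0: "density_on T p0" and F: "finite F" and n: "0 < n"
    and r: "1 < r" and B: "0 < B" "\<And>k. cell_prob p d k \<le> B / real d"
    and w: "\<And>k. 1 \<le> w k" "r < 2 \<Longrightarrow> (\<Sum>k\<in>F. (1 / w k) powr (r / (2 - r))) \<le> H * real d" and H: "0 < H"
    and \<epsilon>: "0 < \<epsilon>" and \<gamma>: "1 \<le> \<gamma>" and \<tau>: "\<tau> = real n * \<epsilon>\<^sup>2" "1 \<le> \<tau>"
    and \<delta>: "\<delta> = \<epsilon> * \<tau> powr (1 / 2 - 1 / max r 2) * \<gamma>"
    and rate: "\<epsilon> \<le> C0 * (\<gamma> * \<tau> powr (1 / min r 2 - 1))"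
    and L: "0 < L" and d: "L * \<tau> \<le> real d" "real d \<le> (L + 1) * \<tau>" and C: "0 < C" and m: "0 \<le> m"
    and M: "0 < M" "16 * (C + 4) * (B / L) powr (2 - 2 / min r 2) \<le> (M * ((L + 1) powr (1 / r - 1) / 32))\<^sup>2"
      "8 * (C + 4) * C0 \<le> M * ((L + 1) powr (1 / r - 1) / 32)"
      "4 * (H * (L + 1)) powr (2 / min r 2 - 1) * m \<le> (M * ((L + 1) powr (1 / r - 1) / 32))\<^sup>2"
    and sep: "(real d powr (1 / r - 1) * (M * \<delta>) / 32) powr r \<le> (\<Sum>k\<in>F. \<bar>cell_prob p d k - cell_prob p0 d k\<bar> powr r)"
  shows "(\<integral>\<^sup>+\<omega>\<in>{\<omega>. chi_square w p0 d n F \<omega> \<le> m * real n}. ennreal (lratio p0 n p \<omega>) \<partial>PiM UNIV (\<lambda>_. law p0))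
    \<le> ennreal (exp (- (C + 4) * real n * \<epsilon>\<^sup>2))"
proof -
  define s where "s = min r 2"
  have s: "1 < s" "s \<le> 2" "s \<le> r" using r by (auto simp: s_def)
  have \<tau>0: "0 < \<tau>" using \<tau> by simp
  have d0: "0 < real d" using mult_pos_pos[OF L \<tau>0] d(1) by linarith
  define c where "c = M * ((L + 1) powr (1 / r - 1) / 32)"
  have c: "0 < c" using M L by (simp add: c_def)
  \<comment> \<open>The separation in \<open>sep\<close> with \<open>\<delta>\<close> expanded and
    \<open>d\<close>, which occurs with a negative power, replaced by its upper bound
    \<open>(L + 1) * \<tau>\<close>.\<close>
  define v where "v = c * (\<epsilon> * \<gamma> * \<tau> powr (1 / s - 1))"
  have v: "0 < v" using c \<epsilon> \<gamma> \<tau>0 by (simp add: v_def)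
  have v_le: "v \<le> real d powr (1 / r - 1) * (M * \<delta>) / 32"
  proof -
    have "1 / r - 1 < 0" using r by simp
    then have "((L + 1) * \<tau>) powr (1 / r - 1) \<le> real d powr (1 / r - 1)"
      using d d0 by (intro powr_mono2') auto
    then have "((L + 1) * \<tau>) powr (1 / r - 1) * (M * \<delta>) / 32 \<le> real d powr (1 / r - 1) * (M * \<delta>) / 32"
      using M \<delta> \<epsilon> \<gamma> by (intro divide_right_mono mult_right_mono) auto
    moreover have "((L + 1) * \<tau>) powr (1 / r - 1) * (M * \<delta>) / 32 = v"
    proof -
      \<comment> \<open>For \<open>r > 2\<close> the exponent in \<open>\<delta>\<close> corrects
        \<open>1 / r - 1\<close> to \<open>- 1 / 2\<close>; for \<open>r \<le> 2\<close> it is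
        0.\<close>
      have "1 / r - 1 + (1 / 2 - 1 / max r 2) = 1 / s - 1"
        using r by (auto simp: s_def max_def min_def)
      then have "\<tau> powr (1 / r - 1) * \<tau> powr (1 / 2 - 1 / max r 2) = \<tau> powr (1 / s - 1)"
        by (simp flip: powr_add)
      then show ?thesis unfolding v_def c_def \<delta> powr_mult by (simp add: mult_ac)
    qed
    ultimately show ?thesis by simp
  qed
  have vF: "v powr s \<le> (\<Sum>k\<in>F. \<bar>cell_prob p d k - cell_prob p0 d k\<bar> powr s)"
  proof -
    have vr: "v powr r \<le> (\<Sum>k\<in>F. \<bar>cell_prob p d k - cell_prob p0 d k\<bar> powr r)"
      using v v_le r by (intro order_trans[OF powr_mono2 sep]) auto
    show ?thesis
    \<comment> \<open>For \<open>r > 2\<close> a separation in l^r implies the same separation in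
      l^2.\<close>
    proof (cases "r \<le> 2")
      case False
      then have s2: "s = 2" by (simp add: s_def)
      have "v powr r \<le> (\<Sum>k\<in>F. \<bar>cell_prob p d k - cell_prob p0 d k\<bar> powr 2) powr (r / 2)"
        using vr False F by (intro order_trans[OF vr sum_abs_powr_le]) auto
      then have "(v powr r) powr (2 / r) \<le> ((\<Sum>k\<in>F. \<bar>cell_prob p d k - cell_prob p0 d k\<bar> powr 2) powr (r / 2)) powr (2 / r)"
        using r by (intro powr_mono2) auto
      then show ?thesis using r v s2 by (simp add: powr_powr sum_nonneg)
    qed (use vr in \<open>simp add: s_def\<close>)
  qed
  have nv: "real n * v\<^sup>2 = c\<^sup>2 * (\<gamma>\<^sup>2 * \<tau> powr (2 / s - 1))"
  proof -
    have "(\<tau> powr (1 / s - 1))\<^sup>2 = \<tau> powr (2 / s - 2)"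
      by (simp add: power2_eq_square flip: powr_add)
    then have "real n * v\<^sup>2 = c\<^sup>2 * \<gamma>\<^sup>2 * (\<tau> * \<tau> powr (2 / s - 2))"
      by (simp add: v_def power_mult_distrib \<tau>(1))
    also have "\<tau> * \<tau> powr (2 / s - 2) = \<tau> powr (2 / s - 1)"
      using \<tau>0 powr_add[of \<tau> 1 "2 / s - 2"] by simp
    finally show ?thesis by simp
  qed
  have g2: "c\<^sup>2 * \<tau> powr (2 / s - 1) \<le> real n * v\<^sup>2"
  proof -
    have "1 \<le> \<gamma>\<^sup>2" using \<gamma> by (simp add: one_le_power)
    then have "c\<^sup>2 * (1 * \<tau> powr (2 / s - 1)) \<le> c\<^sup>2 * (\<gamma>\<^sup>2 * \<tau> powr (2 / s - 1))"
      by (intro mult_left_mono mult_right_mono) auto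
    then show ?thesis unfolding nv by simp
  qed
  have "(\<integral>\<^sup>+\<omega>\<in>{\<omega>. chi_square w p0 d n F \<omega> \<le> m * real n}. ennreal (lratio p0 n p \<omega>) \<partial>PiM UNIV (\<lambda>_. law p0))
    \<le> ennreal (exp (- ((C + 4) * \<tau>)))"
  proof (rule type_II_error[OF p p0 F n s(1,2), where b = "B / real d" and H = "H * real d" and v = v])
    show "16 * ((C + 4) * \<tau>) * (B / real d) powr (2 - 2 / s) \<le> real n * v\<^sup>2"
    proof -
      have e: "0 \<le> 2 - 2 / s" using s by (simp add: divide_le_eq)
      have "(B / real d) powr (2 - 2 / s) \<le> (B / (L * \<tau>)) powr (2 - 2 / s)"
        using B d d0 L \<tau>0 e by (intro powr_mono2 divide_left_mono) auto
      also have "\<dots> = (B / L) powr (2 - 2 / s) * \<tau> powr (2 / s - 2)"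
      proof -
        have "(B / (L * \<tau>)) powr (2 - 2 / s) = (B / L) powr (2 - 2 / s) / \<tau> powr (2 - 2 / s)"
          using B L \<tau>0 by (simp flip: powr_divide)
        also have "\<dots> = (B / L) powr (2 - 2 / s) * \<tau> powr - (2 - 2 / s)"
          by (simp only: powr_minus divide_inverse)
        finally show ?thesis by simp
      qed
      finally have "16 * ((C + 4) * \<tau>) * (B / real d) powr (2 - 2 / s) \<le> 16 * ((C + 4) * \<tau>) * ((B / L) powr (2 - 2 / s) * \<tau> powr (2 / s - 2))"
        using C \<tau>0 by (intro mult_left_mono) auto
      also have "\<dots> = 16 * (C + 4) * (B / L) powr (2 - 2 / s) * (\<tau> * \<tau> powr (2 / s - 2))" by (simp add: mult_ac)
      also have "\<tau> * \<tau> powr (2 / s - 2) = \<tau> powr (2 / s - 1)"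
        using \<tau>0 powr_add[of \<tau> 1 "2 / s - 2"] by simp
      also have "16 * (C + 4) * (B / L) powr (2 - 2 / s) * \<tau> powr (2 / s - 1) \<le> c\<^sup>2 * \<tau> powr (2 / s - 1)"
        using M(2) unfolding c_def s_def by (intro mult_right_mono) auto
      finally show ?thesis using g2 by simp
    qed
    show "8 * ((C + 4) * \<tau>) \<le> real n * v"
    proof -
      have "8 * (C + 4) * \<epsilon> \<le> 8 * (C + 4) * (C0 * (\<gamma> * \<tau> powr (1 / s - 1)))"
        using rate C unfolding s_def by (intro mult_left_mono) auto
      also have "\<dots> = 8 * (C + 4) * C0 * (\<gamma> * \<tau> powr (1 / s - 1))" by simp
      also have "\<dots> \<le> c * (\<gamma> * \<tau> powr (1 / s - 1))"
        using M(3) \<gamma> unfolding c_def by (intro mult_right_mono) auto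
      finally have "real n * \<epsilon> * (8 * (C + 4) * \<epsilon>) \<le> real n * \<epsilon> * (c * (\<gamma> * \<tau> powr (1 / s - 1)))"
        using \<epsilon> by (intro mult_left_mono) auto
      then show ?thesis by (simp add: v_def \<tau>(1) power2_eq_square mult_ac)
    qed
    show "4 * (H * real d) powr (2 / s - 1) * m \<le> real n * v\<^sup>2"
    proof -
      have e: "0 \<le> 2 / s - 1" using s by (simp add: le_divide_eq)
      have "(H * real d) powr (2 / s - 1) \<le> (H * ((L + 1) * \<tau>)) powr (2 / s - 1)"
        using H d d0 e by (intro powr_mono2 mult_left_mono) auto
      also have "\<dots> = (H * (L + 1)) powr (2 / s - 1) * \<tau> powr (2 / s - 1)"
        by (simp flip: powr_mult add: mult.assoc)
      finally have "4 * (H * real d) powr (2 / s - 1) * m \<le> 4 * ((H * (L + 1)) powr (2 / s - 1) * \<tau> powr (2 / s - 1)) * m"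
        using m by (intro mult_right_mono mult_left_mono) auto
      also have "\<dots> = 4 * (H * (L + 1)) powr (2 / s - 1) * m * \<tau> powr (2 / s - 1)" by simp
      also have "\<dots> \<le> c\<^sup>2 * \<tau> powr (2 / s - 1)"
        using M(4) unfolding c_def s_def by (intro mult_right_mono) auto
      finally show ?thesis using g2 by simp
    qed
    show "s < 2 \<Longrightarrow> (\<Sum>k\<in>F. (1 / w k) powr (s / (2 - s))) \<le> H * real d"
      using w(2) by (auto simp: s_def min_def split: if_splits)
  qed (use B w(1) H d0 v vF m in auto)
  moreover have "- ((C + 4) * \<tau>) = - (C + 4) * real n * \<epsilon>\<^sup>2" by (simp add: \<tau>(1) algebra_simps)
  ultimately show ?thesis by simp
qed

text \<open>The L^r-distance is an integral over \<open>x\<close> of a function of \<open>p\<close>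
  and \<open>x\<close>, so its measurability in \<open>p\<close> rests on joint
  measurability.\<close>

lemma Lr_norm_superlevel_measurable:
  assumes T [measurable]: "T \<in> sets borel" and p0 [measurable]: "p0 \<in> borel_measurable borel"
    and joint: "(\<lambda>(p, x). p x) \<in> borel_measurable (\<pi> \<Otimes>\<^sub>M borel)"
  shows "{p \<in> space \<pi>. ennreal b \<le> Lr_norm T r (\<lambda>x. p x - p0 x)} \<in> sets \<pi>"
proof -
  have [measurable]: "(\<lambda>z. fst z (snd z)) \<in> borel_measurable (\<pi> \<Otimes>\<^sub>M lborel)"
    using joint by (simp add: split_beta' cong: measurable_cong_sets)
  have "(\<lambda>(p, x). ennreal (\<bar>p x - p0 x\<bar> powr r) * indicator T x) \<in> borel_measurable (\<pi> \<Otimes>\<^sub>M lborel)"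
    unfolding split_beta' by measurable
  then have [measurable]: "(\<lambda>p. \<integral>\<^sup>+x\<in>T. ennreal (\<bar>p x - p0 x\<bar> powr r) \<partial>lborel) \<in> borel_measurable \<pi>"
    by (rule lborel.borel_measurable_nn_integral)
  have "(\<lambda>p. Lr_norm T r (\<lambda>x. p x - p0 x)) \<in> borel_measurable \<pi>"
    unfolding Lr_norm_def Let_def by measurable
  then show ?thesis by measurable
qed

text \<open>The order of choices matters: first a radius \<open>R\<close> beyond which the weighted
  mass of \<open>p0\<close> is negligible, which fixes the bound \<open>W\<close> for the weights of
  the near cells, and only then \<open>n\<close>, which makes the Chebyshev bound small.\<close>

lemma type_I_vanishes:
  fixes a :: real and d :: "nat \<Rightarrow> nat"
  defines "w \<equiv> \<lambda>n k. (1 + \<bar>real_of_int k\<bar> / real (d n)) powr a"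
  assumes p0: "density_on T p0" and B: "AE x in lborel. \<bar>p0 x\<bar> \<le> B" "0 < B" and a: "0 \<le> a"
    and g: "integrable lborel (\<lambda>x. p0 x * (1 + \<bar>x\<bar>) powr a)"
    and d: "filterlim (\<lambda>n. real (d n)) at_top sequentially"
  defines "m \<equiv> 2 powr a * (\<integral>x. p0 x * (1 + \<bar>x\<bar>) powr a \<partial>lborel) + 2"
  shows "(\<lambda>n. measure (PiM UNIV (\<lambda>_. law p0)) {\<omega> \<in> space (PiM UNIV (\<lambda>_. law p0)).
    \<exists>i::nat. m * real n < chi_square (w n) p0 (d n) n {- int i..int i} \<omega>}) \<longlonglongrightarrow> 0"
proof (rule LIMSEQ_I)
  fix e :: real assume e: "0 < e"
  let ?g = "\<lambda>x. p0 x * (1 + \<bar>x\<bar>) powr a"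
  let ?S = "PiM UNIV (\<lambda>_::nat. law p0)"
  obtain R :: nat where R: "(\<integral>x. indicat_real {x. real R \<le> \<bar>x\<bar>} x * ?g x \<partial>lborel) \<le> e / (3 * 2 powr a)"
    using tail_integral_small[OF g, of "e / (3 * 2 powr a)"] e by auto
  define D where "D = 2 powr a * (\<integral>x. ?g x \<partial>lborel)"
  define W where "W = (2 + real R) powr a"
  have W: "0 \<le> W" by (simp add: W_def)
  have lim: "(\<lambda>n. 8 * W * (B / real (d n)) * D + 8 * W\<^sup>2 / real n) \<longlonglongrightarrow> 8 * W * 0 * D + 0"
    by (intro tendsto_intros real_tendsto_divide_at_top[OF tendsto_const] d filterlim_real_sequentially)
  then have "\<forall>\<^sub>F n in sequentially. 8 * W * (B / real (d n)) * D + 8 * W\<^sup>2 / real n < e / 3"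
    using e by (intro order_tendstoD(2)) auto
  moreover have "\<forall>\<^sub>F n in sequentially. 1 \<le> real (d n)" using d unfolding filterlim_at_top by blast
  moreover have "\<forall>\<^sub>F n::nat in sequentially. 0 < n" by (rule eventually_gt_at_top)
  ultimately have "\<forall>\<^sub>F n in sequentially. measure ?S {\<omega> \<in> space ?S.
    \<exists>i::nat. m * real n < chi_square (w n) p0 (d n) n {- int i..int i} \<omega>} < e"
  proof eventually_elim
    case (elim n)
    have d1: "0 < d n" using elim by simp
    interpret multinomial_cells T p0 "d n" by unfold_locales (rule p0)
    have "measure S {\<omega> \<in> space S. \<exists>i::nat. (D + 2) * real n < chi_square (w n) p0 (d n) n {- int i..int i} \<omega>} \<le>
      8 * W * (B / real (d n)) * D + 8 * W\<^sup>2 / real n + e / 3"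
    \<comment> \<open>The margin in \<open>R + 1\<close> ensures that cells with index outside
      \<open>A\<close> lie in \<open>{x. R \<le> \<bar>x\<bar>}\<close>, as cells have length at
      most 1.\<close>
    proof (rule type_I_error[where A = "{k. \<bar>real_of_int k\<bar> \<le> (real R + 1) * real (d n)}"])
      fix k assume "k \<in> {k. \<bar>real_of_int k\<bar> \<le> (real R + 1) * real (d n)}"
      then have "\<bar>real_of_int k\<bar> / real (d n) \<le> real R + 1" using d1 by (simp add: pos_divide_le_eq)
      then show "w n k \<le> W" unfolding w_def W_def using a by (intro powr_mono2) auto
    next
      show "cell_prob p0 (d n) k \<le> B / real (d n)" for k by (rule cell_prob_le[OF p0 B(1) d1])
    next
      fix F :: "int set" assume F: "finite F"
      have "(\<Sum>k\<in>F. w n k * cell_prob p0 (d n) k) \<le> 2 powr a * (\<integral>x. indicat_real UNIV x * ?g x \<partial>lborel)"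
        unfolding w_def by (rule weighted_cell_prob_le[OF p0 a d1 F g]) auto
      then show "(\<Sum>k\<in>F. w n k * cell_prob p0 (d n) k) \<le> D" by (simp add: D_def)
    next
      fix F :: "int set" assume F: "finite F" "F \<inter> {k. \<bar>real_of_int k\<bar> \<le> (real R + 1) * real (d n)} = {}"
      have "(\<Sum>k\<in>F. w n k * cell_prob p0 (d n) k) \<le> 2 powr a * (\<integral>x. indicat_real {x. real R \<le> \<bar>x\<bar>} x * ?g x \<partial>lborel)"
        unfolding w_def
      proof (rule weighted_cell_prob_le[OF p0 a d1 F(1) g])
        fix k assume "k \<in> F"
        then have k: "(real R + 1) * real (d n) < \<bar>real_of_int k\<bar>" using F(2) by (auto simp: not_le[symmetric])
        show "cell (d n) k \<subseteq> {x. real R \<le> \<bar>x\<bar>}"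
        proof
          fix x assume "x \<in> cell (d n) k"
          then have "\<bar>real_of_int k\<bar> \<le> \<bar>real (d n) * x\<bar> + 1" unfolding cell_def by (simp, linarith)
          then have "real R * real (d n) \<le> \<bar>x\<bar> * real (d n)" 
          proof -
            have "(real R + 1) * real (d n) = real R * real (d n) + real (d n)" "\<bar>real (d n) * x\<bar> = \<bar>x\<bar> * real (d n)"
              by (simp_all add: abs_mult algebra_simps)
            then show ?thesis using k elim(2) \<open>\<bar>real_of_int k\<bar> \<le> \<bar>real (d n) * x\<bar> + 1\<close> by linarith
          qed
          then show "x \<in> {x. real R \<le> \<bar>x\<bar>}" using d1 by simp
        qed
      qed measurable
      also have "\<dots> \<le> 2 powr a * (e / (3 * 2 powr a))" by (intro mult_left_mono R) auto
      finally show "(\<Sum>k\<in>F. w n k * cell_prob p0 (d n) k) \<le> e / 3" by simp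
    qed (use W elim in \<open>auto simp: w_def\<close>)
    also have "\<dots> < e" using elim e by simp
    finally show ?case by (simp add: m_def D_def)
  qed
  then show "\<exists>N. \<forall>n\<ge>N. norm (measure ?S {\<omega> \<in> space ?S.
    \<exists>i::nat. m * real n < chi_square (w n) p0 (d n) n {- int i..int i} \<omega>} - 0) < e"
    by (simp add: eventually_sequentially)
qed

text \<open>Applies \<open>cells_detect\<close> to \<open>h = p - p0\<close>, whose approximation
  error is bounded by those of \<open>p\<close> and \<open>p0\<close>. The condition on
  \<open>M\<close> makes the term \<open>16 powr r * E\<close> at most half of the integral of
  \<open>\<bar>h\<bar> powr r\<close>; this halving turns 16 into 32.\<close>

lemma separated_cells:
  assumes T: "T = {0..1} \<or> T = UNIV" and K: "translation_regular T J0 K" and r: "1 < r"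
  obtains s where "0 < s" "\<And>j d p p0 B \<delta> M CK A. J0 \<le> j \<Longrightarrow> 2 ^ j \<le> s * real d \<Longrightarrow>
    density_on T p \<Longrightarrow> AE x in lborel. \<bar>p x\<bar> \<le> B \<Longrightarrow> density_on T p0 \<Longrightarrow> AE x in lborel. \<bar>p0 x\<bar> \<le> B \<Longrightarrow>
    0 < \<delta> \<Longrightarrow> 0 < M \<Longrightarrow>
    Lr_norm T r (\<lambda>x. kernel_op T (K j) p x - p x) \<le> ennreal (CK * \<delta>) \<Longrightarrow>
    Lr_norm T r (\<lambda>x. kernel_op T (K j) p0 x - p0 x) \<le> ennreal (A * \<delta>) \<Longrightarrow>
    ennreal (M * \<delta>) \<le> Lr_norm T r (\<lambda>x. p x - p0 x) \<Longrightarrow>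
    2 * 16 powr r * (2 powr (r - 1) * (max CK 0 powr r + max A 0 powr r)) \<le> M powr r \<Longrightarrow>
    \<exists>F. finite F \<and> (real d powr (1 / r - 1) * (M * \<delta>) / 32) powr r \<le>
      (\<Sum>k\<in>F. \<bar>cell_prob p d k - cell_prob p0 d k\<bar> powr r)"
proof -
  have Tb [measurable]: "T \<in> sets borel" using T by auto
  obtain s where s: "0 < s" "\<And>j d h b E I. J0 \<le> j \<Longrightarrow> 2 ^ j \<le> s * real d \<Longrightarrow> integrable lborel h \<Longrightarrow>
    (\<And>x. x \<notin> T \<Longrightarrow> h x = 0) \<Longrightarrow> AE x in lborel. \<bar>h x\<bar> \<le> b \<Longrightarrow> 0 \<le> E \<Longrightarrow> 0 < I \<Longrightarrow>
    (\<integral>\<^sup>+x\<in>T. ennreal (\<bar>kernel_op T (K j) h x - h x\<bar> powr r) \<partial>lborel) \<le> ennreal E \<Longrightarrow>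
    (\<integral>\<^sup>+x. ennreal (\<bar>h x\<bar> powr r) \<partial>lborel) = ennreal I \<Longrightarrow>
    \<exists>F. finite F \<and> I \<le> 16 powr r * (real d powr (r - 1) * (\<Sum>k\<in>F. \<bar>\<integral>x. indicat_real (cell d k) x * h x \<partial>lborel\<bar> powr r) + E)"
    using cells_detect[OF T K r] by blast
  show ?thesis
  proof (rule that[OF s(1)])
    fix j d :: nat and p p0 :: "real \<Rightarrow> real" and B \<delta> M CK A :: real
    assume j: "J0 \<le> j" and jd: "2 ^ j \<le> s * real d" and p: "density_on T p" "AE x in lborel. \<bar>p x\<bar> \<le> B"
      and p0: "density_on T p0" "AE x in lborel. \<bar>p0 x\<bar> \<le> B" and \<delta>: "0 < \<delta>" and M: "0 < M"
      and Kp: "Lr_norm T r (\<lambda>x. kernel_op T (K j) p x - p x) \<le> ennreal (CK * \<delta>)"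
      and Kp0: "Lr_norm T r (\<lambda>x. kernel_op T (K j) p0 x - p0 x) \<le> ennreal (A * \<delta>)"
      and sep: "ennreal (M * \<delta>) \<le> Lr_norm T r (\<lambda>x. p x - p0 x)"
      and Mr: "2 * 16 powr r * (2 powr (r - 1) * (max CK 0 powr r + max A 0 powr r)) \<le> M powr r"
    note pd = density_onD[OF p(1)] and p0d = density_onD[OF p0(1)]
    note [measurable] = pd(1) p0d(1)
    have "(0::real) < 2 ^ j" by simp
    then have "0 < s * real d" using jd by linarith
    then have d: "0 < real d" using s(1) by (simp add: zero_less_mult_iff)
    define h where "h = (\<lambda>x. p x - p0 x)"
    have h: "integrable lborel h" unfolding h_def using pd p0d by simp
    have [measurable]: "h \<in> borel_measurable borel" unfolding h_def by measurable
    have hT: "h x = 0" if "x \<notin> T" for x using that pd(3) p0d(3) by (simp add: h_def)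
    have hB: "AE x in lborel. \<bar>h x\<bar> \<le> 2 * B"
      using p(2) p0(2) by eventually_elim (auto simp: h_def)
    \<comment> \<open>A bounded integrable function has finite L^r-norm: \<open>r - 1\<close> powers
      go into the bound and one is kept for integrability.\<close>
    have fin: "(\<integral>\<^sup>+x. ennreal (\<bar>h x\<bar> powr r) \<partial>lborel) < \<infinity>"
    proof -
      have "(\<integral>\<^sup>+x. ennreal (\<bar>h x\<bar> powr r) \<partial>lborel) \<le> (\<integral>\<^sup>+x. ennreal ((2 * B) powr (r - 1) * \<bar>h x\<bar>) \<partial>lborel)"
      proof (intro nn_integral_mono_AE)
        show "AE x in lborel. ennreal (\<bar>h x\<bar> powr r) \<le> ennreal ((2 * B) powr (r - 1) * \<bar>h x\<bar>)"
          using hB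
        proof eventually_elim
          case (elim x)
          have "\<bar>h x\<bar> powr r = \<bar>h x\<bar> powr (r - 1) * \<bar>h x\<bar>"
            by (cases "h x = 0") (auto simp: powr_diff)
          also have "\<dots> \<le> (2 * B) powr (r - 1) * \<bar>h x\<bar>"
            using elim r by (intro mult_right_mono powr_mono2) auto
          finally show ?case by (rule ennreal_leI)
        qed
      qed
      also have "\<dots> = ennreal (\<integral>x. (2 * B) powr (r - 1) * \<bar>h x\<bar> \<partial>lborel)"
        using h by (intro nn_integral_eq_integral) auto
      finally show ?thesis by (auto intro: le_less_trans)
    qed
    then obtain I where I: "(\<integral>\<^sup>+x. ennreal (\<bar>h x\<bar> powr r) \<partial>lborel) = ennreal I" "0 \<le> I"
      by (cases "\<integral>\<^sup>+x. ennreal (\<bar>h x\<bar> powr r) \<partial>lborel") auto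
    have "(\<integral>\<^sup>+x\<in>T. ennreal (\<bar>p x - p0 x\<bar> powr r) \<partial>lborel) = ennreal I"
      unfolding I(1)[symmetric] using hT by (intro nn_integral_cong) (auto simp: h_def indicator_def)
    then have MI: "(M * \<delta>) powr r \<le> I"
      using sep r M \<delta> I(2) by (intro Lr_norm_ge_imp) auto
    then have I0: "0 < I" using M \<delta> by (intro less_le_trans[OF _ MI]) simp
    define E where "E = 2 powr (r - 1) * (max (CK * \<delta>) 0 powr r + max (A * \<delta>) 0 powr r)"
    have E0: "0 \<le> E" by (simp add: E_def)
    let ?f = "\<lambda>q x. ennreal (\<bar>kernel_op T (K j) q x - q x\<bar> powr r) * indicator T x"
    have kop: "(\<lambda>x. kernel_op T (K j) q x * indicat_real T x) \<in> borel_measurable borel" if [measurable]: "q \<in> borel_measurable borel" for q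
    proof -
      have km [measurable]: "(\<lambda>(x, y). indicat_real T x * indicat_real T y * K j x y) \<in> borel_measurable (borel \<Otimes>\<^sub>M borel)"
        using K j unfolding translation_regular_def by auto
      have "(\<lambda>x. \<integral>y. (indicat_real T x * indicat_real T y * K j x y) * q y \<partial>lborel) \<in> borel_measurable borel"
        by measurable
      moreover have "(\<lambda>x. \<integral>y. (indicat_real T x * indicat_real T y * K j x y) * q y \<partial>lborel) = (\<lambda>x. kernel_op T (K j) q x * indicat_real T x)"
        unfolding kernel_op_def set_lebesgue_integral_def
        by (auto simp: fun_eq_iff indicator_def intro!: Bochner_Integration.integral_cong)
      ultimately show ?thesis by simp
    qed
    have fm: "?f q \<in> borel_measurable borel" if [measurable]: "q \<in> borel_measurable borel" for q
    proof -
      note [measurable] = kop[OF that]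
      have "?f q = (\<lambda>x. ennreal (\<bar>kernel_op T (K j) q x * indicat_real T x - q x\<bar> powr r) * indicator T x)"
        by (auto simp: fun_eq_iff indicator_def)
      then show ?thesis by simp
    qed
    have "(\<integral>\<^sup>+x\<in>T. ennreal (\<bar>kernel_op T (K j) h x - h x\<bar> powr r) \<partial>lborel) \<le>
        (\<integral>\<^sup>+x. ennreal (2 powr (r - 1)) * (?f p x + ?f p0 x) \<partial>lborel)"
    proof (rule nn_integral_mono)
      fix x
      show "ennreal (\<bar>kernel_op T (K j) h x - h x\<bar> powr r) * indicator T x \<le> ennreal (2 powr (r - 1)) * (?f p x + ?f p0 x)"
      proof (cases "x \<in> T")
        case True
        have "kernel_op T (K j) h x - h x = (kernel_op T (K j) p x - p x) - (kernel_op T (K j) p0 x - p0 x)"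
          unfolding h_def kernel_op_diff[OF T K j True p p0] by simp
        then have "\<bar>kernel_op T (K j) h x - h x\<bar> powr r \<le> (\<bar>kernel_op T (K j) p x - p x\<bar> + \<bar>kernel_op T (K j) p0 x - p0 x\<bar>) powr r"
          using r by (intro powr_mono2) auto
        also have "\<dots> \<le> 2 powr (r - 1) * (\<bar>kernel_op T (K j) p x - p x\<bar> powr r + \<bar>kernel_op T (K j) p0 x - p0 x\<bar> powr r)"
          using r by (intro powr_add_le) auto
        finally show ?thesis using True
          by (simp add: ennreal_mult[symmetric] ennreal_plus[symmetric] ennreal_leI del: ennreal_plus)
      qed simp
    qed
    also have "\<dots> = ennreal (2 powr (r - 1)) * ((\<integral>\<^sup>+x. ?f p x \<partial>lborel) + (\<integral>\<^sup>+x. ?f p0 x \<partial>lborel))"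
      using fm[OF pd(1)] fm[OF p0d(1)] by (simp add: nn_integral_cmult nn_integral_add)
    also have "\<dots> \<le> ennreal (2 powr (r - 1)) * (ennreal (max (CK * \<delta>) 0 powr r) + ennreal (max (A * \<delta>) 0 powr r))"
      using r by (intro mult_left_mono add_mono Lr_norm_le_imp Kp Kp0) auto
    also have "\<dots> = ennreal E"
      by (simp add: E_def ennreal_mult[symmetric] ennreal_plus[symmetric] del: ennreal_plus)
    finally have Eh: "(\<integral>\<^sup>+x\<in>T. ennreal (\<bar>kernel_op T (K j) h x - h x\<bar> powr r) \<partial>lborel) \<le> ennreal E" .
    obtain F where F: "finite F" "I \<le> 16 powr r * (real d powr (r - 1) * (\<Sum>k\<in>F. \<bar>\<integral>x. indicat_real (cell d k) x * h x \<partial>lborel\<bar> powr r) + E)"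
      using s(2)[OF j jd h hT hB E0 I0 Eh I(1)] by blast
    have \<Delta>: "(\<integral>x. indicat_real (cell d k) x * h x \<partial>lborel) = cell_prob p d k - cell_prob p0 d k" for k
      unfolding h_def cell_prob_def using integrable_cell[OF p(1), of d k] integrable_cell[OF p0(1), of d k]
      by (simp add: right_diff_distrib)
    have "16 powr r * E \<le> I / 2"
    proof -
      have mx: "max (x * \<delta>) 0 powr r = max x 0 powr r * \<delta> powr r" for x
      proof -
        have "max (x * \<delta>) 0 = max x 0 * \<delta>" using \<delta> by (simp add: max_def zero_le_mult_iff mult_le_0_iff)
        then show ?thesis using \<delta> by (simp add: powr_mult)
      qed
      have "2 * (16 powr r * E) = (2 * 16 powr r * (2 powr (r - 1) * (max CK 0 powr r + max A 0 powr r))) * \<delta> powr r"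
        unfolding E_def mx by (simp add: algebra_simps)
      also have "\<dots> \<le> M powr r * \<delta> powr r" by (intro mult_right_mono Mr) auto
      also have "\<dots> = (M * \<delta>) powr r" by (simp add: powr_mult)
      finally show ?thesis using MI by linarith
    qed
    then have "I / 2 \<le> 16 powr r * (real d powr (r - 1) * (\<Sum>k\<in>F. \<bar>cell_prob p d k - cell_prob p0 d k\<bar> powr r))"
      using F(2) unfolding \<Delta> by (simp add: distrib_left)
    then have 1: "(M * \<delta>) powr r \<le> 32 powr r * real d powr (r - 1) * (\<Sum>k\<in>F. \<bar>cell_prob p d k - cell_prob p0 d k\<bar> powr r)"
    proof -
      assume "I / 2 \<le> 16 powr r * (real d powr (r - 1) * (\<Sum>k\<in>F. \<bar>cell_prob p d k - cell_prob p0 d k\<bar> powr r))"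
      then have "(M * \<delta>) powr r \<le> (2 * 16 powr r) * (real d powr (r - 1) * (\<Sum>k\<in>F. \<bar>cell_prob p d k - cell_prob p0 d k\<bar> powr r))"
        using MI by linarith
      also have "\<dots> \<le> 32 powr r * (real d powr (r - 1) * (\<Sum>k\<in>F. \<bar>cell_prob p d k - cell_prob p0 d k\<bar> powr r))"
      proof (intro mult_right_mono mult_nonneg_nonneg sum_nonneg)
        have "(2::real) powr 1 \<le> 2 powr r" using r by (intro powr_mono) auto
        then have "2 * 16 powr r \<le> 2 powr r * (16::real) powr r" by (intro mult_right_mono) auto
        then show "2 * 16 powr r \<le> (32::real) powr r" by (simp flip: powr_mult)
      qed auto
      finally show ?thesis by (simp add: mult.assoc)
    qed
    have "(real d powr (1 / r - 1) * (M * \<delta>) / 32) powr r = (real d powr (1 / r - 1)) powr r * (M * \<delta>) powr r / 32 powr r"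
      by (simp add: powr_mult powr_divide)
    also have "(real d powr (1 / r - 1)) powr r = 1 / real d powr (r - 1)"
    proof -
      have "(1 / r - 1) * r = - (r - 1)" using r by (simp add: field_simps)
      then show ?thesis by (simp only: powr_powr powr_minus_divide)
    qed
    also have "1 / real d powr (r - 1) * (M * \<delta>) powr r / 32 powr r \<le> (\<Sum>k\<in>F. \<bar>cell_prob p d k - cell_prob p0 d k\<bar> powr r)"
      using 1 d by (simp add: field_simps)
    finally show "\<exists>F. finite F \<and> (real d powr (1 / r - 1) * (M * \<delta>) / 32) powr r \<le> (\<Sum>k\<in>F. \<bar>cell_prob p d k - cell_prob p0 d k\<bar> powr r)"
      using F(1) by blast
  qed
qed

text \<open>For \<open>r \<ge> 2\<close> the weights are trivial, with \<open>a = 0\<close>; on the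
  line the tail hypothesis supplies the exponent; on the unit interval the weight is bounded, and
  \<open>a = 1\<close> exceeds \<open>(2 - r) / r\<close> because \<open>r > 1\<close>.\<close>

lemma exists_weight_exponent:
  assumes T: "T = {0..1} \<or> T = UNIV" and p0: "density_on T p0" and r: "1 < r"
    and tail: "T = UNIV \<and> 1 < r \<and> r < 2 \<longrightarrow> (\<exists>w'>(2 - r) / r. mu_norm T w' p0 < \<infinity>)"
  obtains a where "0 \<le> a" "r < 2 \<Longrightarrow> (2 - r) / r < a" "integrable lborel (\<lambda>x. p0 x * (1 + \<bar>x\<bar>) powr a)"
proof -
  note pd = density_onD[OF p0]
  note [measurable] = pd(1)
  consider "2 \<le> r" | "r < 2" "T = UNIV" | "r < 2" "T = {0..1}" using T by linarith
  then show ?thesis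
  proof cases
    case 1
    have "(\<lambda>x. p0 x * (1 + \<bar>x\<bar>) powr 0) = p0" by (auto simp: fun_eq_iff)
    then show ?thesis using that[of 0] 1 pd(4) by simp
  next
    case 2
    then obtain a where a: "(2 - r) / r < a" "mu_norm T a p0 < \<infinity>" using tail r by auto
    have "0 \<le> (2 - r) / r" using 2 r by simp
    moreover have "integrable lborel (\<lambda>x. p0 x * (1 + \<bar>x\<bar>) powr a)"
    proof (rule integrableI_bounded)
      have "(\<integral>\<^sup>+x. ennreal (norm (p0 x * (1 + \<bar>x\<bar>) powr a)) \<partial>lborel) = mu_norm T a p0"
        unfolding mu_norm_def using 2 by (intro nn_integral_cong) (auto simp: abs_mult)
      then show "(\<integral>\<^sup>+x. ennreal (norm (p0 x * (1 + \<bar>x\<bar>) powr a)) \<partial>lborel) < \<infinity>" using a(2) by simp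
    qed measurable
    ultimately show ?thesis using a by (intro that[of a]) auto
  next
    case 3
    have "integrable lborel (\<lambda>x. p0 x * (1 + \<bar>x\<bar>) powr 1)"
    proof (rule Bochner_Integration.integrable_bound[where f = "\<lambda>x. 2 * p0 x"])
      have "norm (p0 x * (1 + \<bar>x\<bar>) powr 1) \<le> norm (2 * p0 x)" for x
      proof (cases "x \<in> T")
        case True
        then have "p0 x * (1 + \<bar>x\<bar>) \<le> p0 x * 2" using pd(2) 3 by (intro mult_left_mono) auto
        then show ?thesis using pd(2)[of x] by (simp add: abs_mult)
      qed (simp add: pd(3))
      then show "AE x in lborel. norm (p0 x * (1 + \<bar>x\<bar>) powr 1) \<le> norm (2 * p0 x)" by simp
    qed (use pd(4) in auto)
    moreover have "(2 - r) / r < 1" using r by simp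
    ultimately show ?thesis by (intro that[of 1]) auto
  qed
qed

section \<open>Choice of the constants and the contraction rate\<close>

theorem theorem3:
  fixes T :: "real set"
    and P :: "(real \<Rightarrow> real) set"
    and \<pi> :: "nat \<Rightarrow> (real \<Rightarrow> real) measure"
    and P_sieve :: "nat \<Rightarrow> (real \<Rightarrow> real) set"
    and K :: "nat \<Rightarrow> real \<Rightarrow> real \<Rightarrow> real"
    and J :: "nat \<Rightarrow> nat" and J0 :: nat
    and \<epsilon> \<gamma> \<delta> :: "nat \<Rightarrow> real"
    and r c C_K D w :: real
    and p0 :: "real \<Rightarrow> real"
  assumes T: "T = {0..1} \<or> T = UNIV"
    and P: "\<forall>p\<in>P. density_on T p"
    and prior: "\<forall>n\<ge>1. prior_on T P (\<pi> n)"
    and joint_measurability: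
      "\<forall>n\<ge>1. (\<lambda>(p, x). p x) \<in> borel_measurable (\<pi> n \<Otimes>\<^sub>M borel)"
    and r: "1 < r"
    and eps_pos: "\<forall>n\<ge>1. 0 < \<epsilon> n"
    and eps_lim: "\<epsilon> \<longlonglongrightarrow> 0"
    and eps_rate: "filterlim (\<lambda>n. sqrt (real n) * \<epsilon> n) at_top sequentially"
    and gamma: "\<forall>n\<ge>1. 1 \<le> \<gamma> n"
    and delta:
      "\<forall>n\<ge>1. \<delta> n = \<epsilon> n * (real n * (\<epsilon> n)\<^sup>2) powr (1 / 2 - 1 / max r 2) * \<gamma> n"
    and rate_condition:
      "(1 < r \<and> r < 2 \<and> \<epsilon> \<in> O(\<lambda>n. \<gamma> n * (real n * (\<epsilon> n)\<^sup>2) powr (1 / r - 1))) \<or>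
       (2 \<le> r \<and> (\<lambda>n. (\<epsilon> n)\<^sup>2) \<in> O(\<lambda>n. \<gamma> n / sqrt (real n)))"
    and c: "0 < c"
    and J: "\<forall>n\<ge>1. J0 \<le> J n \<and> 2 ^ J n \<le> c * real n * (\<epsilon> n)\<^sup>2"
    and K: "admissible T J0 K"
    and w: "(r < 2 \<longrightarrow> (2 - r) / r < w) \<and> (2 \<le> r \<longrightarrow> w = 0)"
    and sieve:
      "\<forall>n\<ge>1. P_sieve n \<subseteq>
         {p \<in> P. Lr_norm T r (\<lambda>x. kernel_op T (K (J n)) p x - p x) \<le> ennreal (C_K * \<delta> n) \<and>
                 mu_norm T w p \<le> ennreal D}"
    and p0: "density_on T p0"
    and prior_conditions:
      "\<exists>C>0. \<forall>\<^sub>F n in sequentially.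
         P_sieve n \<in> sets (\<pi> n) \<and>
         measure (\<pi> n) (P - P_sieve n) \<le> exp (- (C + 4) * real n * (\<epsilon> n)\<^sup>2) \<and>
         measure (\<pi> n) (kl_neighbourhood P p0 (\<epsilon> n)) \<ge> exp (- C * real n * (\<epsilon> n)\<^sup>2)"
    and posterior_bounded:
      "\<exists>B>0. posterior_vanishes \<pi> p0 (\<lambda>n. {p \<in> P. sup_norm T p > ennreal B})"
    and p0_Linf: "Linf T p0"
    and p0_approx:
      "\<exists>A. \<forall>\<^sub>F n in sequentially.
         Lr_norm T r (\<lambda>x. kernel_op T (K (J n)) p0 x - p0 x) \<le> ennreal (A * \<delta> n)"
    and p0_tail:
      "T = UNIV \<and> 1 < r \<and> r < 2 \<longrightarrow> (\<exists>w'>(2 - r) / r. mu_norm T w' p0 < \<infinity>)"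
    and delta_lim: "\<delta> \<longlonglongrightarrow> 0"
  shows "\<exists>M. posterior_vanishes \<pi> p0
               (\<lambda>n. {p \<in> P. Lr_norm T r (\<lambda>x. p x - p0 x) \<ge> ennreal (M * \<delta> n)})"
proof -
  have [measurable]: "T \<in> sets borel" using T by auto
  note p0d = density_onD[OF p0]
  note [measurable] = p0d(1)
  let ?S = "PiM UNIV (\<lambda>_::nat. law p0)"
  define s where "s = min r 2"
  define \<tau> where "\<tau> = (\<lambda>n. real n * (\<epsilon> n)\<^sup>2)"
  have reg: "translation_regular T J0 K" using T K by (rule admissible_imp_translation_regular)
  obtain sd where sd: "0 < sd" and sep: "\<And>j d p p0 B \<delta> M CK A. J0 \<le> j \<Longrightarrow> 2 ^ j \<le> sd * real d \<Longrightarrow>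
    density_on T p \<Longrightarrow> AE x in lborel. \<bar>p x\<bar> \<le> B \<Longrightarrow> density_on T p0 \<Longrightarrow> AE x in lborel. \<bar>p0 x\<bar> \<le> B \<Longrightarrow>
    0 < \<delta> \<Longrightarrow> 0 < M \<Longrightarrow>
    Lr_norm T r (\<lambda>x. kernel_op T (K j) p x - p x) \<le> ennreal (CK * \<delta>) \<Longrightarrow>
    Lr_norm T r (\<lambda>x. kernel_op T (K j) p0 x - p0 x) \<le> ennreal (A * \<delta>) \<Longrightarrow>
    ennreal (M * \<delta>) \<le> Lr_norm T r (\<lambda>x. p x - p0 x) \<Longrightarrow>
    2 * 16 powr r * (2 powr (r - 1) * (max CK 0 powr r + max A 0 powr r)) \<le> M powr r \<Longrightarrow>
    \<exists>F. finite F \<and> (real d powr (1 / r - 1) * (M * \<delta>) / 32) powr r \<le>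
      (\<Sum>k\<in>F. \<bar>cell_prob p d k - cell_prob p0 d k\<bar> powr r)"
    using separated_cells[OF T reg r] by blast
  obtain C where C: "0 < C" and prior_ev: "\<forall>\<^sub>F n in sequentially.
         P_sieve n \<in> sets (\<pi> n) \<and>
         measure (\<pi> n) (P - P_sieve n) \<le> exp (- (C + 4) * real n * (\<epsilon> n)\<^sup>2) \<and>
         measure (\<pi> n) (kl_neighbourhood P p0 (\<epsilon> n)) \<ge> exp (- C * real n * (\<epsilon> n)\<^sup>2)"
    using prior_conditions by blast
  obtain Bp where Bp: "0 < Bp" and post: "posterior_vanishes \<pi> p0 (\<lambda>n. {p \<in> P. sup_norm T p > ennreal Bp})"
    using posterior_bounded by blast
  obtain A where A: "\<forall>\<^sub>F n in sequentially. Lr_norm T r (\<lambda>x. kernel_op T (K (J n)) p0 x - p0 x) \<le> ennreal (A * \<delta> n)"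
    using p0_approx by blast
  obtain B0 where B0: "AE x in lborel. x \<in> T \<longrightarrow> \<bar>p0 x\<bar> \<le> B0" using p0_Linf unfolding Linf_def by blast
  \<comment> \<open>A common bound for \<open>p0\<close> and for all \<open>p\<close> outside the
    exceptional set of the posterior.\<close>
  define B where "B = max Bp B0"
  have B: "0 < B" using Bp by (simp add: B_def)
  have p0B: "AE x in lborel. \<bar>p0 x\<bar> \<le> B"
    using B0
  proof eventually_elim
    case (elim x)
    then show ?case using p0d(3)[of x] B by (cases "x \<in> T") (auto simp: B_def)
  qed
  have pB: "\<bar>p x\<bar> \<le> B" if p: "p \<in> P" "\<not> sup_norm T p > ennreal Bp" for p x
  proof (cases "x \<in> T")
    case True
    then have "ennreal \<bar>p x\<bar> \<le> sup_norm T p" unfolding sup_norm_def by (rule SUP_upper)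
    also have "\<dots> \<le> ennreal Bp" using p by simp
    finally have "\<bar>p x\<bar> \<le> Bp" using Bp by (subst (asm) ennreal_le_iff) auto
    then show ?thesis by (simp add: B_def)
  next
    case False
    then show ?thesis using P p(1) B density_onD(3)[of T p x] by simp
  qed
  obtain a where a: "0 \<le> a" "r < 2 \<Longrightarrow> (2 - r) / r < a" and g: "integrable lborel (\<lambda>x. p0 x * (1 + \<bar>x\<bar>) powr a)"
    using exists_weight_exponent[OF T p0 r p0_tail] by blast
  obtain H where H: "0 < H" and weights: "\<And>d F. r < 2 \<Longrightarrow> 0 < d \<Longrightarrow> finite F \<Longrightarrow>
      (\<Sum>k\<in>F. (1 / (1 + \<bar>real_of_int k\<bar> / real d) powr a) powr (r / (2 - r))) \<le> H * real d"
  proof (cases "r < 2")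
    case True
    \<comment> \<open>The reciprocal weights enter with the power \<open>r / (2 - r)\<close>; their
      sum is of order \<open>d\<close> once \<open>\<beta> > 1\<close>, which is the condition
      \<open>(2 - r) / r < a\<close>.\<close>
    define \<beta> where "\<beta> = a * (r / (2 - r))"
    have "(2 - r) / r * (r / (2 - r)) < \<beta>" unfolding \<beta>_def
      using True r a(2)[OF True] by (intro mult_strict_right_mono) auto
    then have "1 < \<beta>" using True r by simp
    then obtain H where H: "0 < H" "\<And>d F. 0 < d \<Longrightarrow> finite F \<Longrightarrow>
        (\<Sum>k\<in>F. (1 + \<bar>real_of_int k\<bar> / real d) powr - \<beta>) \<le> H * real d"
      using sum_weights_le by blast
    have "(1 / (1 + \<bar>real_of_int k\<bar> / real d) powr a) powr (r / (2 - r)) = (1 + \<bar>real_of_int k\<bar> / real d) powr - \<beta>" for k d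
      unfolding powr_minus_divide[symmetric] powr_powr by (simp add: \<beta>_def)
    then show ?thesis using that[OF H(1)] H(2) by simp
  qed (use that[of 1] in auto)
  define m where "m = 2 powr a * (\<integral>x. p0 x * (1 + \<bar>x\<bar>) powr a \<partial>lborel) + 2"
  have m: "0 \<le> m" unfolding m_def using p0d(2)
    by (intro add_nonneg_nonneg mult_nonneg_nonneg integral_nonneg_AE) auto
  \<comment> \<open>Gives \<open>2 ^ J n \<le> c * \<tau> n = sd * (L * \<tau> n) \<le> sd * d
    n\<close>, so that the cells are short enough for level \<open>J n\<close>.\<close>
  define L where "L = c / sd"
  have L: "0 < L" using c sd by (simp add: L_def)
  define d where "d = (\<lambda>n. nat \<lceil>L * \<tau> n\<rceil>)"
  \<comment> \<open>From here on \<open>w\<close> denotes the cell weights and shadows the moment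
    exponent of the statement.\<close>
  define w where "w = (\<lambda>n k. (1 + \<bar>real_of_int k\<bar> / real (d n)) powr a)"
  have w1: "1 \<le> w n k" for n k unfolding w_def using a(1) by (intro ge_one_powr_ge_zero) auto
  have \<tau>_lim: "filterlim \<tau> at_top sequentially"
  proof -
    have "filterlim (\<lambda>n. (sqrt (real n) * \<epsilon> n) * (sqrt (real n) * \<epsilon> n)) at_top sequentially"
      by (rule filterlim_at_top_mult_at_top[OF eps_rate eps_rate])
    moreover have "(\<lambda>n. (sqrt (real n) * \<epsilon> n) * (sqrt (real n) * \<epsilon> n)) = \<tau>"
      by (auto simp: \<tau>_def fun_eq_iff power2_eq_square)
    ultimately show ?thesis by simp
  qed
  have L\<tau>_lim: "filterlim (\<lambda>n. L * \<tau> n) at_top sequentially"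
    by (rule filterlim_tendsto_pos_mult_at_top[OF tendsto_const L \<tau>_lim])
  have d_ge: "L * \<tau> n \<le> real (d n)" for n unfolding d_def by linarith
  have d_lim: "filterlim (\<lambda>n. real (d n)) at_top sequentially"
    by (rule filterlim_at_top_mono[OF L\<tau>_lim]) (simp add: d_ge)
  \<comment> \<open>The common form of the two alternatives. For \<open>r \<ge> 2\<close> the power
    of \<open>\<tau>\<close> is \<open>1 / (sqrt n * \<epsilon>)\<close>, and the condition on
    \<open>\<epsilon>\<^sup>2\<close> is divided by \<open>\<epsilon>\<close>.\<close>
  obtain C0 where rate: "\<forall>\<^sub>F n in sequentially. \<epsilon> n \<le> C0 * (\<gamma> n * \<tau> n powr (1 / s - 1))"
    using rate_condition
  proof (elim disjE conjE)
    assume "r < 2" and "\<epsilon> \<in> O(\<lambda>n. \<gamma> n * (real n * (\<epsilon> n)\<^sup>2) powr (1 / r - 1))"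
    then obtain C1 where "\<forall>\<^sub>F n in sequentially. norm (\<epsilon> n) \<le> C1 * norm (\<gamma> n * (real n * (\<epsilon> n)\<^sup>2) powr (1 / r - 1))"
      by (elim landau_o.bigE)
    then have "\<forall>\<^sub>F n in sequentially. \<epsilon> n \<le> C1 * (\<gamma> n * \<tau> n powr (1 / s - 1))"
      using eventually_ge_at_top[of 1]
    proof eventually_elim
      case (elim n)
      have gm: "1 \<le> \<gamma> n" using elim gamma by simp
      have "\<epsilon> n \<le> norm (\<epsilon> n)" by simp
      also have "\<dots> \<le> C1 * norm (\<gamma> n * (real n * (\<epsilon> n)\<^sup>2) powr (1 / r - 1))" by (rule elim)
      finally show ?case using gm \<open>r < 2\<close> by (simp add: abs_mult s_def \<tau>_def)
    qed
    then show ?thesis by (rule that)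
  next
    assume r2: "2 \<le> r" and "(\<lambda>n. (\<epsilon> n)\<^sup>2) \<in> O(\<lambda>n. \<gamma> n / sqrt (real n))"
    then obtain C1 where "\<forall>\<^sub>F n in sequentially. norm ((\<epsilon> n)\<^sup>2) \<le> C1 * norm (\<gamma> n / sqrt (real n))"
      by (elim landau_o.bigE)
    then have "\<forall>\<^sub>F n in sequentially. \<epsilon> n \<le> C1 * (\<gamma> n * \<tau> n powr (1 / s - 1))"
      using eventually_ge_at_top[of 1]
    proof eventually_elim
      case (elim n)
      have e: "0 < \<epsilon> n" and gm: "1 \<le> \<gamma> n" using elim eps_pos gamma by auto
      have "1 / s - 1 = - (1 / 2)" using r2 by (simp add: s_def)
      then have "\<tau> n powr (1 / s - 1) = 1 / sqrt (\<tau> n)"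
        using e by (simp add: powr_minus_divide powr_half_sqrt \<tau>_def)
      also have "sqrt (\<tau> n) = sqrt (real n) * \<epsilon> n" using e by (simp add: \<tau>_def real_sqrt_mult)
      finally have t: "\<tau> n powr (1 / s - 1) = 1 / (sqrt (real n) * \<epsilon> n)" .
      have "\<epsilon> n * \<epsilon> n \<le> C1 * (\<gamma> n / sqrt (real n))" using elim gm by (simp add: power2_eq_square)
      then have "\<epsilon> n * \<epsilon> n / \<epsilon> n \<le> C1 * (\<gamma> n / sqrt (real n)) / \<epsilon> n" using e by (intro divide_right_mono) auto
      then show ?case unfolding t using e by simp
    qed
    then show ?thesis by (rule that)
  qed
  define c2 where "c2 = (L + 1) powr (1 / r - 1) / 32"
  have c2: "0 < c2" using L by (simp add: c2_def)
  \<comment> \<open>\<open>x1\<close> and \<open>x2\<close> come from the Chernoff bound, \<open>x3\<close> from the threshold \<open>m\<close> of the test and \<open>x4\<close>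
    from the approximation errors of \<open>p\<close> and \<open>p0\<close>.\<close>
  define x1 where "x1 = 16 * (C + 4) * (B / L) powr (2 - 2 / s)"
  define x2 where "x2 = 8 * (C + 4) * C0"
  define x3 where "x3 = 4 * (H * (L + 1)) powr (2 / s - 1) * m"
  define x4 where "x4 = 2 * 16 powr r * (2 powr (r - 1) * (max C_K 0 powr r + max A 0 powr r))"
  have x0: "0 \<le> x1" "0 \<le> x3" "0 \<le> x4" using C m by (auto simp: x1_def x3_def x4_def)
  \<comment> \<open>\<open>x1\<close> and \<open>x3\<close> must stay below
    \<open>(M * c2)\<^sup>2\<close>, hence the roots, \<open>x2\<close> below \<open>M * c2\<close>,
    and \<open>x4\<close> below \<open>M powr r\<close>; the summand 1 makes \<open>M\<close>
    positive.\<close>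
  define M where "M = (1 + sqrt x1 + \<bar>x2\<bar> + sqrt x3) / c2 + x4 powr (1 / r)"
  have pos: "0 < 1 + sqrt x1 + \<bar>x2\<bar> + sqrt x3"
    using x0 by (intro add_pos_nonneg) auto
  have M: "0 < M" unfolding M_def by (intro add_pos_nonneg divide_pos_pos[OF pos c2]) simp
  have Mc: "1 + sqrt x1 + \<bar>x2\<bar> + sqrt x3 \<le> M * c2"
  proof -
    have "M * c2 = (1 + sqrt x1 + \<bar>x2\<bar> + sqrt x3) + x4 powr (1 / r) * c2"
      using c2 unfolding M_def distrib_right by simp
    moreover have "0 \<le> x4 powr (1 / r) * c2" using c2 by simp
    ultimately show ?thesis by linarith
  qed
  have M1: "x1 \<le> (M * c2)\<^sup>2" and M3: "x3 \<le> (M * c2)\<^sup>2"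
  proof -
    have s1: "0 \<le> sqrt x1" and s3: "0 \<le> sqrt x3" using x0 by auto
    have "sqrt x1 \<le> M * c2" "sqrt x3 \<le> M * c2" using Mc s1 s3 abs_ge_zero[of x2] by linarith+
    then have sq: "(sqrt x1)\<^sup>2 \<le> (M * c2)\<^sup>2" "(sqrt x3)\<^sup>2 \<le> (M * c2)\<^sup>2" using s1 s3 by (intro power_mono; simp)+
    show "x1 \<le> (M * c2)\<^sup>2" "x3 \<le> (M * c2)\<^sup>2" using sq x0 by simp_all
  qed
  have M2: "x2 \<le> M * c2"
  proof -
    have "0 \<le> sqrt x1" "0 \<le> sqrt x3" "x2 \<le> \<bar>x2\<bar>" using x0 by auto
    then show ?thesis using Mc by linarith
  qed
  have M4: "x4 \<le> M powr r"
  proof -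
    have "x4 = (x4 powr (1 / r)) powr r" using x0 r by (simp add: powr_powr)
    also have "\<dots> \<le> M powr r" unfolding M_def using r divide_pos_pos[OF pos c2] by (intro powr_mono2) auto
    finally show ?thesis .
  qed
  define U where "U = (\<lambda>n. {p \<in> P. Lr_norm T r (\<lambda>x. p x - p0 x) \<ge> ennreal (M * \<delta> n)})"
  define Bs where "Bs = {p \<in> P. sup_norm T p > ennreal Bp}"
  define rej where "rej = (\<lambda>n. {\<omega> \<in> space ?S. \<exists>i::nat. m * real n < chi_square (w n) p0 (d n) n {- int i..int i} \<omega>})"
  have model: "bayes_model T P (\<pi> n) p0 n" if "1 \<le> n" for n
  proof (rule bayes_model.intro)
    show "prob_space (\<pi> n)" "space (\<pi> n) = P" using prior that by (simp_all add: prior_on_def)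
    show "(\<lambda>(p, x). p x) \<in> borel_measurable (\<pi> n \<Otimes>\<^sub>M borel)" using joint_measurability that by simp
  qed (use P p0 that in auto)
  have U_sets: "U n \<in> sets (\<pi> n)" if n: "1 \<le> n" for n
  proof -
    have "space (\<pi> n) = P" using prior n by (simp add: prior_on_def)
    then show ?thesis
      using Lr_norm_superlevel_measurable[of T p0 "\<pi> n" "M * \<delta> n" r] joint_measurability n
      by (simp add: U_def)
  qed
  have rej_lim: "(\<lambda>n. measure ?S (rej n)) \<longlonglongrightarrow> 0"
    unfolding rej_def w_def m_def by (rule type_I_vanishes[OF p0 p0B B a(1) g d_lim])
  have Bs_ev: "\<forall>\<^sub>F n in sequentially. Bs \<in> sets (\<pi> n)"
    and Bs_lim: "\<And>\<eta>. 0 < \<eta> \<Longrightarrow> (\<lambda>n. measure ?S {\<omega> \<in> space ?S. \<bar>posterior (\<pi> n) n \<omega> Bs - 0\<bar> > \<eta>}) \<longlonglongrightarrow> 0"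
    using post unfolding posterior_vanishes_def tendsto_in_prob_def Bs_def by auto
  have "tendsto_in_prob ?S (\<lambda>n \<omega>. posterior (\<pi> n) n \<omega> (U n)) 0"
    unfolding tendsto_in_prob_def
  proof (intro allI impI)
    fix \<eta> :: real assume \<eta>: "0 < \<eta>"
    let ?b = "\<lambda>n. 2 / \<tau> n + 2 * exp (- \<tau> n) + measure ?S (rej n)
        + measure ?S {\<omega> \<in> space ?S. \<bar>posterior (\<pi> n) n \<omega> Bs - 0\<bar> > \<eta> / 2}"
    have exp_lim: "(\<lambda>n. exp (- \<tau> n)) \<longlonglongrightarrow> 0"
      by (rule filterlim_compose[OF exp_at_bot]) (simp add: filterlim_uminus_at_bot \<tau>_lim)
    have "?b \<longlonglongrightarrow> 0 + 2 * 0 + 0 + 0"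
      using \<eta> by (intro tendsto_add tendsto_mult tendsto_const exp_lim rej_lim Bs_lim
          real_tendsto_divide_at_top[OF tendsto_const \<tau>_lim]) auto
    then have b_lim: "?b \<longlonglongrightarrow> 0" by simp
    have exp_ev: "\<forall>\<^sub>F n in sequentially. exp (- \<tau> n) < \<eta> / 8"
      using exp_lim \<eta> by (intro order_tendstoD(2)) auto
    have \<tau>_ev: "\<forall>\<^sub>F n in sequentially. max 1 (1 / L) \<le> \<tau> n"
      using \<tau>_lim unfolding filterlim_at_top by blast
    have d_ev: "\<forall>\<^sub>F n in sequentially. 1 \<le> real (d n)"
      using d_lim unfolding filterlim_at_top by blast
    have le: "\<forall>\<^sub>F n in sequentially. measure ?S {\<omega> \<in> space ?S. \<bar>posterior (\<pi> n) n \<omega> (U n) - 0\<bar> > \<eta>} \<le> ?b n"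
      using prior_ev A rate exp_ev \<tau>_ev d_ev Bs_ev eventually_ge_at_top[of 1]
    proof eventually_elim
      case (elim n)
      have n1: "1 \<le> n" using elim by simp
      interpret bayes_model T P "\<pi> n" p0 n using n1 by (rule model)
      interpret multinomial_cells T p0 "d n" by unfold_locales (rule p0)
      define E where "E = space S - rej n"
      have rej_m [measurable]: "rej n \<in> sets S" unfolding rej_def by measurable
      have e: "0 < \<epsilon> n" and gm: "1 \<le> \<gamma> n" using eps_pos gamma n1 by auto
      have \<tau>1: "1 \<le> \<tau> n" using elim by simp
      have dn: "\<delta> n = \<epsilon> n * \<tau> n powr (1 / 2 - 1 / max r 2) * \<gamma> n" using delta n1 by (simp add: \<tau>_def)
      have \<delta>0: "0 < \<delta> n" unfolding dn using e gm \<tau>1 by simp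
      have d_le: "real (d n) \<le> (L + 1) * \<tau> n"
      proof -
        have "0 \<le> L * \<tau> n" using L \<tau>1 by simp
        then have "real (d n) \<le> L * \<tau> n + 1" unfolding d_def by linarith
        also have "\<dots> \<le> (L + 1) * \<tau> n" using \<tau>1 by (simp add: distrib_right)
        finally show ?thesis .
      qed
      have Jd: "2 ^ J n \<le> sd * real (d n)"
      proof -
        have "2 ^ J n \<le> c * \<tau> n" using J n1 by (simp add: \<tau>_def mult.assoc)
        also have "\<dots> = sd * (L * \<tau> n)" using sd by (simp add: L_def)
        also have "\<dots> \<le> sd * real (d n)" using sd by (intro mult_left_mono d_ge) auto
        finally show ?thesis .
      qed
      have sv: "P_sieve n \<in> sets (\<pi> n)" using elim by simp
      have Pn: "P \<in> sets (\<pi> n)" using sets.top[of "\<pi> n"] by (simp add: prior(2))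
      \<comment> \<open>The densities left to the test: far from \<open>p0\<close>, inside the sieve
        and bounded by \<open>Bp\<close>.\<close>
      define W where "W = U n \<inter> P_sieve n \<inter> (P - Bs)"
      have Ws: "W \<in> sets (\<pi> n)" unfolding W_def using U_sets[OF n1] sv Pn elim by auto
      have typeII: "(\<integral>\<^sup>+\<omega>\<in>E. ennreal (lratio p0 n p \<omega>) \<partial>S) \<le> ennreal (exp (- (C + 4) * real n * (\<epsilon> n)\<^sup>2))"
        if p: "p \<in> W" for p
      proof -
        have pP: "p \<in> P" and pU: "ennreal (M * \<delta> n) \<le> Lr_norm T r (\<lambda>x. p x - p0 x)" and ps: "p \<in> P_sieve n"
          and pBs: "\<not> sup_norm T p > ennreal Bp"
          using p by (auto simp: W_def U_def Bs_def)
        have pd: "density_on T p" by (rule dens[OF pP])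
        have pAE: "AE x in lborel. \<bar>p x\<bar> \<le> B" using pB[OF pP pBs] by simp
        have pK: "Lr_norm T r (\<lambda>x. kernel_op T (K (J n)) p x - p x) \<le> ennreal (C_K * \<delta> n)"
          using sieve n1 ps by auto
        obtain F where F: "finite F" "(real (d n) powr (1 / r - 1) * (M * \<delta> n) / 32) powr r \<le>
            (\<Sum>k\<in>F. \<bar>cell_prob p (d n) k - cell_prob p0 (d n) k\<bar> powr r)"
          using sep[OF _ Jd pd pAE p0 p0B \<delta>0 M pK _ pU M4[unfolded x4_def]] J n1 elim by auto
        have d0: "0 < d n" using elim by simp
        have "(\<integral>\<^sup>+\<omega>\<in>{\<omega>. chi_square (w n) p0 (d n) n F \<omega> \<le> m * real n}. ennreal (lratio p0 n p \<omega>) \<partial>S)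
            \<le> ennreal (exp (- (C + 4) * real n * (\<epsilon> n)\<^sup>2))"
        proof (rule type_II_error_rate[OF pd p0 F(1) _ r B _ w1, where H = H and \<gamma> = "\<gamma> n" and \<tau> = "\<tau> n" and \<delta> = "\<delta> n"
              and L = L and C = C and ?C0.0 = C0 and M = M])
          show "cell_prob p (d n) k \<le> B / real (d n)" for k by (rule cell_prob_le[OF pd pAE d0])
          show "r < 2 \<Longrightarrow> (\<Sum>k\<in>F. (1 / w n k) powr (r / (2 - r))) \<le> H * real (d n)"
            unfolding w_def by (rule weights[OF _ d0 F(1)])
          show "\<epsilon> n \<le> C0 * (\<gamma> n * \<tau> n powr (1 / min r 2 - 1))" using elim by (simp add: s_def)
          show "16 * (C + 4) * (B / L) powr (2 - 2 / min r 2) \<le> (M * ((L + 1) powr (1 / r - 1) / 32))\<^sup>2"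
            using M1 by (simp add: x1_def c2_def s_def)
          show "8 * (C + 4) * C0 \<le> M * ((L + 1) powr (1 / r - 1) / 32)"
            using M2 by (simp add: x2_def c2_def)
          show "4 * (H * (L + 1)) powr (2 / min r 2 - 1) * m \<le> (M * ((L + 1) powr (1 / r - 1) / 32))\<^sup>2"
            using M3 by (simp add: x3_def c2_def s_def)
          show "\<tau> n = real n * (\<epsilon> n)\<^sup>2" by (simp add: \<tau>_def)
        qed (use n1 H e gm \<tau>1 dn L d_ge d_le C m M F(2) in auto)
        moreover have "(\<integral>\<^sup>+\<omega>\<in>E. ennreal (lratio p0 n p \<omega>) \<partial>S) \<le>
            (\<integral>\<^sup>+\<omega>\<in>{\<omega>. chi_square (w n) p0 (d n) n F \<omega> \<le> m * real n}. ennreal (lratio p0 n p \<omega>) \<partial>S)"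
        proof (rule nn_integral_mono)
          fix \<omega> assume \<omega>: "\<omega> \<in> space S"
          have "chi_square (w n) p0 (d n) n F \<omega> \<le> m * real n" if "\<omega> \<in> E"
          proof -
            \<comment> \<open>The set \<open>F\<close> depends on \<open>p\<close>, but it lies in
              some window, and the statistic increases with the index set since the weights are
              nonnegative.\<close>
            obtain i :: nat where i: "F \<subseteq> {- int i..int i}"
            proof -
              have "F \<subseteq> {- int (\<Sum>k\<in>F. nat \<bar>k\<bar>)..int (\<Sum>k\<in>F. nat \<bar>k\<bar>)}"
              proof
                fix k assume "k \<in> F"
                then have "nat \<bar>k\<bar> \<le> (\<Sum>k\<in>F. nat \<bar>k\<bar>)" using F(1) by (intro member_le_sum) auto
                then show "k \<in> {- int (\<Sum>k\<in>F. nat \<bar>k\<bar>)..int (\<Sum>k\<in>F. nat \<bar>k\<bar>)}"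
                  unfolding atLeastAtMost_iff by linarith
              qed
              then show ?thesis by (rule that)
            qed
            have "chi_square (w n) p0 (d n) n F \<omega> \<le> chi_square (w n) p0 (d n) n {- int i..int i} \<omega>"
              unfolding chi_square_def using order_trans[OF zero_le_one w1[of n]]
              by (intro sum_mono2 i) auto
            also have "\<dots> \<le> m * real n" using \<open>\<omega> \<in> E\<close> \<omega> by (auto simp: E_def rej_def not_less)
            finally show ?thesis .
          qed
          then show "ennreal (lratio p0 n p \<omega>) * indicator E \<omega> \<le>
            ennreal (lratio p0 n p \<omega>) * indicator {\<omega>. chi_square (w n) p0 (d n) n F \<omega> \<le> m * real n} \<omega>"
            by (intro mult_left_mono) (auto simp: indicator_def)
        qed
        ultimately show ?thesis by (rule order_trans[rotated])
      qed
      have "measure S {\<omega> \<in> space S. \<bar>posterior (\<pi> n) n \<omega> (U n) - 0\<bar> > \<eta>} \<le>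
        2 / (real n * (\<epsilon> n)\<^sup>2) + 2 * exp (- (real n * (\<epsilon> n)\<^sup>2)) + measure S (space S - E)
        + measure S {\<omega> \<in> space S. \<bar>posterior (\<pi> n) n \<omega> Bs - 0\<bar> > \<eta> / 2}"
      proof (rule posterior_contraction[where V = "P - P_sieve n" and W = W and C = C])
        show "U n \<subseteq> Bs \<union> (P - P_sieve n) \<union> W" by (auto simp: W_def U_def)
        show "E \<in> sets S" unfolding E_def by measurable
        show "4 * exp (- (real n * (\<epsilon> n)\<^sup>2)) \<le> \<eta> / 2" using elim by (simp add: \<tau>_def)
      qed (use U_sets[OF n1] elim sv Pn Ws e C typeII in auto)
      moreover have "space S - E = rej n" unfolding E_def using sets.sets_into_space[OF rej_m] by auto
      ultimately show ?case by (simp add: \<tau>_def)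
    qed
    show "(\<lambda>n. measure ?S {\<omega> \<in> space ?S. \<bar>posterior (\<pi> n) n \<omega> (U n) - 0\<bar> > \<eta>}) \<longlonglongrightarrow> 0"
      by (rule tendsto_sandwich[OF _ le tendsto_const b_lim]) simp
  qed
  moreover have "\<forall>\<^sub>F n in sequentially. U n \<in> sets (\<pi> n)"
    using eventually_ge_at_top[of 1] by eventually_elim (rule U_sets)
  ultimately have "posterior_vanishes \<pi> p0 U" unfolding posterior_vanishes_def by simp
  then show ?thesis unfolding U_def by blast
qed

end
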